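(* Given a finite set $\mathcal{I}$ of intervals and a positive integer $k$, it is NP-hard to decide whether $\chi(\mathcal{C}[\mathcal{I}])\le k$.
   Context: For a finite set $\mathcal{I}$ of intervals on the real line, the containment interval graph $\mathcal{C}[\mathcal{I}]$ is the mixed graph with vertex set $\mathcal{I}$ in which, for every pair of distinct intersecting intervals $u,v$: there is an arc $(u,v)$ if $u$ contains $v$, and an (undirected) edge $\{u,v\}$ if $u$ and $v$ overlap (intersect but neither contains the other). A proper coloring of a mixed graph $G$ is a function $f\colon V(G)\to\mathbb{N}$ such that $f(u)\neq f(v)$ for every edge $\{u,v\}$ and $f(u)<f(v)$ for every arc $(u,v)$. $\chi(G)$ is the minimum number of colors in a proper coloring of $G$. *)

theory Defs
  imports Complex_Main "HOL-Computational_Algebra.Polynomial"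
begin

section \<open>Mixed graphs and containment interval graphs\<close>

record 'a mixed_graph =
  verts :: "'a set"
  edges :: "'a set set"
  arcs :: "('a \<times> 'a) set"

definition proper_coloring :: "'a mixed_graph \<Rightarrow> ('a \<Rightarrow> nat) \<Rightarrow> bool" where
  "proper_coloring G f \<longleftrightarrow>
     (\<forall>u v. {u, v} \<in> edges G \<longrightarrow> f u \<noteq> f v) \<and>
     (\<forall>u v. (u, v) \<in> arcs G \<longrightarrow> f u < f v)"

text \<open>
  The value is meaningful only for graphs that admit a proper coloring; containment interval
  graphs of finite sets always do (lemma \<open>containment_graph_colorable\<close> below).
\<close>
definition chromatic_number :: "'a mixed_graph \<Rightarrow> nat" where
  "chromatic_number G = (LEAST n. \<exists>f. proper_coloring G f \<and> card (f ` verts G) = n)"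

definition containment_graph :: "real set set \<Rightarrow> real set mixed_graph" where
  "containment_graph I =
     \<lparr>verts = I,
      edges = {{u, v} | u v. u \<in> I \<and> v \<in> I \<and> u \<noteq> v \<and> u \<inter> v \<noteq> {} \<and> \<not> v \<subseteq> u \<and> \<not> u \<subseteq> v},
      arcs = {(u, v) | u v. u \<in> I \<and> v \<in> I \<and> u \<noteq> v \<and> u \<inter> v \<noteq> {} \<and> v \<subseteq> u}\<rparr>"

lemma containment_graph_colorable:
  assumes "finite I"
  shows "\<exists>f. proper_coloring (containment_graph I) f"
proof -
  have "\<exists>f::real set \<Rightarrow> nat. inj_on f I \<and> (\<forall>u\<in>I. \<forall>v\<in>I. v \<subset> u \<longrightarrow> f u < f v)"
    using assms
  proof (induction "card I" arbitrary: I)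
    case 0
    then show ?case by auto
  next
    case (Suc n)
    then have "I \<noteq> {}" by auto
    with Suc.prems obtain m where m: "m \<in> I" "\<forall>b\<in>I. b \<subseteq> m \<longrightarrow> m = b"
      using finite_has_minimal by blast
    have "n = card (I - {m})" using Suc m by simp
    moreover have "finite (I - {m})" using Suc.prems by simp
    ultimately obtain f :: "real set \<Rightarrow> nat" where
      f: "inj_on f (I - {m})" "\<forall>u\<in>I - {m}. \<forall>v\<in>I - {m}. v \<subset> u \<longrightarrow> f u < f v"
      by (drule_tac Suc.hyps(1)) blast+
    define g where "g = f(m := Suc (Max (insert 0 (f ` I))))"
    have lt: "f u < g m" if "u \<in> I" for u
      using that Suc.prems by (simp add: g_def less_Suc_eq_le)
    have g: "g u = f u" if "u \<noteq> m" for u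
      using that by (simp add: g_def)
    have "inj_on g I"
    proof (rule inj_onI)
      fix u v assume uv: "u \<in> I" "v \<in> I" "g u = g v"
      show "u = v"
      proof (cases "u = m \<or> v = m")
        case True
        then show ?thesis using uv g lt by (metis less_irrefl)
      next
        case False
        then have "f u = f v" using uv g by simp
        then show ?thesis using False uv f(1) by (auto dest: inj_onD)
      qed
    qed
    moreover have "g u < g v" if "u \<in> I" "v \<in> I" "v \<subset> u" for u v
    proof (cases "v = m")
      case True
      then show ?thesis using that g lt by (metis psubset_eq)
    next
      case False
      moreover have "u \<noteq> m" using that m by blast
      ultimately show ?thesis using that f(2) g by simp
    qed
    ultimately show ?case by blast
  qed
  then obtain f :: "real set \<Rightarrow> nat"
    where f: "inj_on f I" "\<forall>u\<in>I. \<forall>v\<in>I. v \<subset> u \<longrightarrow> f u < f v" by blast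
  have "proper_coloring (containment_graph I) f"
    unfolding proper_coloring_def containment_graph_def
  proof (intro conjI allI impI; simp)
    fix u v
    assume "\<exists>ua va. {u, v} = {ua, va} \<and> ua \<in> I \<and> va \<in> I \<and> ua \<noteq> va \<and> ua \<inter> va \<noteq> {} \<and>
              \<not> va \<subseteq> ua \<and> \<not> ua \<subseteq> va"
    then have "u \<in> I" "v \<in> I" "u \<noteq> v" by (auto simp: doubleton_eq_iff)
    then show "f u \<noteq> f v" using f(1) by (auto dest: inj_onD)
  next
    fix u v
    assume "u \<in> I \<and> v \<in> I \<and> u \<noteq> v \<and> u \<inter> v \<noteq> {} \<and> v \<subseteq> u"
    then show "f u < f v" using f(2) by blast
  qed
  then show ?thesis by blast
qed


section \<open>Turing machines\<close>

text \<open>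
  Nondeterministic multi-tape machines with two-way infinite tapes. States and tape symbols are
  natural numbers, of which a machine uses only finitely many because its transition set is
  finite. Symbol 0 is the blank.
\<close>

datatype move = Move_Left | Move_None | Move_Right

fun offset :: "move \<Rightarrow> int" where
  "offset Move_Left = -1"
| "offset Move_None = 0"
| "offset Move_Right = 1"

record turing_machine =
  num_tapes :: nat
  start_state :: nat
  accept_state :: nat
  transitions :: "(nat \<times> nat list \<times> nat \<times> (nat \<times> move) list) set"

definition wf_machine :: "turing_machine \<Rightarrow> bool" where
  "wf_machine M \<longleftrightarrow>
     num_tapes M \<ge> 1 \<and> finite (transitions M) \<and>
     (\<forall>(q, rs, q', as) \<in> transitions M. length rs = num_tapes M \<and> length as = num_tapes M)"

definition deterministic :: "turing_machine \<Rightarrow> bool" where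
  "deterministic M \<longleftrightarrow>
     (\<forall>q rs a b. (q, rs, a) \<in> transitions M \<longrightarrow> (q, rs, b) \<in> transitions M \<longrightarrow> a = b)"

text \<open>A tape is its contents together with the position of the head.\<close>
type_synonym tape = "(int \<Rightarrow> nat) \<times> int"
type_synonym config = "nat \<times> tape list"

fun read_tape :: "tape \<Rightarrow> nat" where
  "read_tape (t, h) = t h"

fun act_tape :: "nat \<times> move \<Rightarrow> tape \<Rightarrow> tape" where
  "act_tape (s, d) (t, h) = (t(h := s), h + offset d)"

definition step :: "turing_machine \<Rightarrow> (config \<times> config) set" where
  "step M = {((q, ts), (q', map2 act_tape as ts)) | q ts q' as.
               (q, map read_tape ts, q', as) \<in> transitions M}"

definition halted :: "turing_machine \<Rightarrow> config \<Rightarrow> bool" where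
  "halted M c \<longleftrightarrow> c \<notin> Domain (step M)"

definition word_contents :: "bool list \<Rightarrow> int \<Rightarrow> nat" where
  "word_contents w i =
     (if 0 \<le> i \<and> nat i < length w then (if w ! nat i then 2 else 1) else 0)"

definition initial :: "turing_machine \<Rightarrow> bool list \<Rightarrow> config" where
  "initial M w =
     (start_state M, (word_contents w, 0) # replicate (num_tapes M - 1) (word_contents [], 0))"

definition accepts :: "turing_machine \<Rightarrow> bool list \<Rightarrow> bool" where
  "accepts M w \<longleftrightarrow>
     (\<exists>c. (initial M w, c) \<in> (step M)\<^sup>* \<and> halted M c \<and> fst c = accept_state M)"

text \<open>All computations, on all inputs, halt within the given number of steps.\<close>
definition runs_in_time :: "turing_machine \<Rightarrow> (nat \<Rightarrow> nat) \<Rightarrow> bool" where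
  "runs_in_time M T \<longleftrightarrow>
     (\<forall>w n c. (initial M w, c) \<in> step M ^^ n \<longrightarrow> n \<le> T (length w))"

text \<open>The output is what the last tape contains on halting.\<close>
definition computes :: "turing_machine \<Rightarrow> (bool list \<Rightarrow> bool list) \<Rightarrow> bool" where
  "computes M f \<longleftrightarrow>
     (\<forall>w. \<exists>c. (initial M w, c) \<in> (step M)\<^sup>* \<and> halted M c \<and>
        fst (last (snd c)) = word_contents (f w))"


section \<open>NP-hardness\<close>

definition NP :: "bool list set set" where
  "NP = {A. \<exists>M (p :: nat poly). wf_machine M \<and> runs_in_time M (poly p) \<and>
             A = {w. accepts M w}}"

definition poly_time_computable :: "(bool list \<Rightarrow> bool list) \<Rightarrow> bool" where
  "poly_time_computable f \<longleftrightarrow>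
     (\<exists>M (p :: nat poly). wf_machine M \<and> deterministic M \<and> runs_in_time M (poly p) \<and>
        computes M f)"

definition poly_time_reducible :: "bool list set \<Rightarrow> bool list set \<Rightarrow> bool" where
  "poly_time_reducible A B \<longleftrightarrow>
     (\<exists>f. poly_time_computable f \<and> (\<forall>w. w \<in> A \<longleftrightarrow> f w \<in> B))"

definition NP_hard :: "bool list set \<Rightarrow> bool" where
  "NP_hard B \<longleftrightarrow> (\<forall>A\<in>NP. poly_time_reducible A B)"


section \<open>Encoding of instances\<close>

text \<open>Binary representation, least significant bit first, without leading zeros.\<close>
fun bits :: "nat \<Rightarrow> bool list" where
  "bits n = (if n = 0 then [] else odd n # bits (n div 2))"

declare bits.simps [simp del]

text \<open>Every bit is preceded by a continuation marker, which makes the code prefix-free.\<close>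
definition enc_nat :: "nat \<Rightarrow> bool list" where
  "enc_nat n = concat (map (\<lambda>b. [True, b]) (bits n)) @ [False]"

definition enc_int :: "int \<Rightarrow> bool list" where
  "enc_int i = (i < 0) # enc_nat (nat \<bar>i\<bar>)"

definition enc_rat :: "rat \<Rightarrow> bool list" where
  "enc_rat r = (case quotient_of r of (a, b) \<Rightarrow> enc_int a @ enc_nat (nat b))"

definition enc_instance :: "(rat \<times> rat) list \<Rightarrow> nat \<Rightarrow> bool list" where
  "enc_instance xs k = enc_nat k @ concat (map (\<lambda>(l, r). enc_rat l @ enc_rat r) xs)"

fun interval_of :: "rat \<times> rat \<Rightarrow> real set" where
  "interval_of (l, r) = {real_of_rat l .. real_of_rat r}"

text \<open>
  An instance lists the endpoint pairs of the intervals, each interval once, together with \<open>k\<close>.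
\<close>
definition containment_coloring_problem :: "bool list set" where
  "containment_coloring_problem =
     {enc_instance xs k | xs k.
        distinct xs \<and> (\<forall>(l, r) \<in> set xs. l \<le> r) \<and> k > 0 \<and>
        chromatic_number (containment_graph (interval_of ` set xs)) \<le> k}"

text \<open>The encoding is injective, so membership in the language determines the answer on each instance.\<close>

lemma bits_inj: "bits m = bits n \<Longrightarrow> m = n"
proof (induction m arbitrary: n rule: less_induct)
  case (less m)
  show ?case
  proof (cases "m = 0 \<or> n = 0")
    case True
    then show ?thesis using less.prems
      using bits.simps[of m] bits.simps[of n] by (auto split: if_splits)
  next
    case False
    then have "odd m = odd n" "bits (m div 2) = bits (n div 2)"
      using less.prems bits.simps[of m] bits.simps[of n] by auto
    moreover from this have "m div 2 = n div 2" using less.IH[of "m div 2"] False by simp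
    ultimately show ?thesis by (metis even_two_times_div_two odd_two_times_div_two_succ)
  qed
qed

lemma enc_nat_prefix_free: "enc_nat m @ u = enc_nat n @ v \<Longrightarrow> m = n \<and> u = v"
proof -
  have "concat (map (\<lambda>b. [True, b]) bs) @ False # u = concat (map (\<lambda>b. [True, b]) cs) @ False # v
        \<Longrightarrow> bs = cs \<and> u = v" for bs cs
  proof (induction bs arbitrary: cs)
    case Nil
    then show ?case by (cases cs) auto
  next
    case (Cons b bs)
    then show ?case by (cases cs) auto
  qed
  from this[of "bits m" "bits n"]
  show "enc_nat m @ u = enc_nat n @ v \<Longrightarrow> m = n \<and> u = v"
    unfolding enc_nat_def by (auto dest: bits_inj)
qed

lemma enc_int_prefix_free: "enc_int i @ u = enc_int j @ v \<Longrightarrow> i = j \<and> u = v"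
  unfolding enc_int_def by (auto dest!: enc_nat_prefix_free)

lemma enc_rat_prefix_free: "enc_rat r @ u = enc_rat s @ v \<Longrightarrow> r = s \<and> u = v"
proof -
  assume eq: "enc_rat r @ u = enc_rat s @ v"
  obtain a b c d where q: "quotient_of r = (a, b)" "quotient_of s = (c, d)"
    by (metis surj_pair)
  then have "b > 0" "d > 0" using quotient_of_denom_pos by blast+
  moreover have "a = c \<and> nat b = nat d \<and> u = v"
    using eq by (auto simp: enc_rat_def q dest!: enc_int_prefix_free enc_nat_prefix_free)
  ultimately show ?thesis using q by (metis eq_nat_nat_iff less_imp_le quotient_of_inject)
qed

lemma enc_instance_inj: "enc_instance xs k = enc_instance ys l \<Longrightarrow> xs = ys \<and> k = l"
proof -
  assume eq: "enc_instance xs k = enc_instance ys l"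
  have ne: "enc_rat r \<noteq> []" for r
    by (simp add: enc_rat_def enc_int_def split: prod.split)
  have "concat (map (\<lambda>(l, r). enc_rat l @ enc_rat r) xs) =
        concat (map (\<lambda>(l, r). enc_rat l @ enc_rat r) ys) \<Longrightarrow> xs = ys"
  proof (induction xs arbitrary: ys)
    case Nil
    then show ?case using ne by (cases ys) auto
  next
    case (Cons x xs)
    then show ?case using ne
      by (cases ys; cases x) (auto dest!: enc_rat_prefix_free)
  qed
  then show ?thesis using eq unfolding enc_instance_def by (auto dest!: enc_nat_prefix_free)
qed

end

theory Submission
  imports Defs
begin

text \<open>
  Satisfiability of the Cook--Levin tableau of a polynomial-time nondeterministic machine is reduced
  to the coloring problem. In the interval gadget as many intervals as there are colors overlap at
  almost every point, so an interval can only inherit the color of an interval that has just ended;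
  where several intervals end before new ones start, the new ones may permute the released colors,
  and these choices encode an assignment. Containments orient the inherited colors, which lets the
  gadget compare the choices made at different places and thereby test clauses.

  The tableau is a bounded number of clause families indexed by numbers below a polynomial of the
  input length, so the intervals can be printed by nested loops whose bounds and outputs are
  arithmetic expressions. Such loop programs compile to programs for counters, and a counter is a
  tape of a Turing machine on which only the head position matters.
\<close>

text \<open>An interval hands its color on only once, when it ends, so a literal that every clause
  has to inspect needs one copy per clause. The copies are nested, and strict increase of colors
  along the nest makes a true copy force all copies inside it to be true. This single direction is
  enough, because the conflict between a literal and its negation is tested on the innermost copies
  only. In the same spirit the tableau has no clauses saying that a cell holds just one symbol: the
  facts of the run are propagated forwards, and additional true atoms can only violate more of the
  negative conditions. The obstacle to the converse coloring is unwanted containment. Groups of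
  intervals therefore end in the order in which they start, so that unrelated ones overlap; nesting
  remains only where a comparison is wanted or where the order of literals and levels already agrees
  with it. Expressions offer no division, so a clause number cannot be decoded while printing. This
  is why clauses come in families with separate loop variables, whose values are combined to the
  number.\<close>

section \<open>Counter programs and their compilation to Turing machines\<close>

text \<open>
  Register 0 is the position of the head on the input tape; it is only tested through the symbol
  read there. All other registers are counters that can be tested for zero.
\<close>

datatype test = IsZero nat | Reads nat

datatype com =
    CSkip | CInc nat | CDec nat | COut bool | CSeq com com | CIf test com com | CUntil test com

type_synonym state = "(nat \<Rightarrow> nat) \<times> bool list"

fun holds :: "bool list \<Rightarrow> test \<Rightarrow> state \<Rightarrow> bool" where
  "holds w (IsZero r) (s, os) \<longleftrightarrow> s r = 0"
| "holds w (Reads c) (s, os) \<longleftrightarrow> word_contents w (int (s 0)) = c"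

text \<open>The step counts are those of the compiled code: the else branch is placed first and
  leaves by a jump, hence its extra 1, and each round of a loop pays for its test and for the jump
  back.\<close>

inductive exec :: "bool list \<Rightarrow> com \<Rightarrow> state \<Rightarrow> nat \<Rightarrow> state \<Rightarrow> bool" for w where
  exec_skip: "exec w CSkip s 0 s"
| exec_inc: "exec w (CInc r) (s, os) 1 (s(r := Suc (s r)), os)"
| exec_dec: "s r = Suc n \<Longrightarrow> exec w (CDec r) (s, os) 1 (s(r := n), os)"
| exec_out: "exec w (COut b) (s, os) 1 (s, os @ [b])"
| exec_seq: "exec w c s m s' \<Longrightarrow> exec w d s' n s'' \<Longrightarrow> exec w (CSeq c d) s (m + n) s''"
| exec_if_true: "holds w t s \<Longrightarrow> exec w c s n s' \<Longrightarrow> exec w (CIf t c d) s (1 + n) s'"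
| exec_if_false: "\<not> holds w t s \<Longrightarrow> exec w d s n s' \<Longrightarrow> exec w (CIf t c d) s (1 + (n + 1)) s'"
| exec_until_true: "holds w t s \<Longrightarrow> exec w (CUntil t c) s 1 s"
| exec_until_false:
    "\<not> holds w t s \<Longrightarrow> exec w c s m s' \<Longrightarrow> exec w (CUntil t c) s' n s'' \<Longrightarrow>
     exec w (CUntil t c) s (1 + (m + (1 + n))) s''"

datatype instr = IInc nat | IDec nat | IOut bool | IBranch test nat | IJump nat

fun clen :: "com \<Rightarrow> nat" where
  "clen CSkip = 0"
| "clen (CInc r) = 1"
| "clen (CDec r) = 1"
| "clen (COut b) = 1"
| "clen (CSeq c d) = clen c + clen d"
| "clen (CIf t c d) = clen c + clen d + 2"
| "clen (CUntil t c) = clen c + 2"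

fun code :: "nat \<Rightarrow> com \<Rightarrow> instr list" where
  "code p CSkip = []"
| "code p (CInc r) = [IInc r]"
| "code p (CDec r) = [IDec r]"
| "code p (COut b) = [IOut b]"
| "code p (CSeq c d) = code p c @ code (p + clen c) d"
| "code p (CIf t c d) =
     IBranch t (p + 2 + clen d) # code (p + 1) d @ IJump (p + 2 + clen d + clen c) #
     code (p + 2 + clen d) c"
| "code p (CUntil t c) = IBranch t (p + clen c + 2) # code (p + 1) c @ [IJump p]"

lemma length_code: "length (code p c) = clen c"
  by (induction c arbitrary: p) auto

text \<open>Zero tests must avoid register 0: its tape carries the input instead of a mark.\<close>

fun uses :: "nat \<Rightarrow> com \<Rightarrow> bool" where
  "uses R CSkip \<longleftrightarrow> True"
| "uses R (CInc r) \<longleftrightarrow> r \<le> R"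
| "uses R (CDec r) \<longleftrightarrow> r \<le> R"
| "uses R (COut b) \<longleftrightarrow> True"
| "uses R (CSeq c d) \<longleftrightarrow> uses R c \<and> uses R d"
| "uses R (CIf t c d) \<longleftrightarrow> (\<forall>r. t = IsZero r \<longrightarrow> 0 < r \<and> r \<le> R) \<and> uses R c \<and> uses R d"
| "uses R (CUntil t c) \<longleftrightarrow> (\<forall>r. t = IsZero r \<longrightarrow> 0 < r \<and> r \<le> R) \<and> uses R c"

lemma uses_mono: "uses R c \<Longrightarrow> R \<le> R' \<Longrightarrow> uses R' c"
  by (induction c) (auto intro: le_trans)

text \<open>A counter tape carries a mark in cell 0; the value of the counter is the head position.\<close>

definition mark :: "int \<Rightarrow> nat" where "mark = (\<lambda>i. if i = 0 then 1 else 0)"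

definition tape_of :: "nat \<Rightarrow> bool list \<Rightarrow> state \<Rightarrow> nat \<Rightarrow> tape" where
  "tape_of R w st j =
     (if j = 0 then (word_contents w, int (fst st 0))
      else if j \<le> R then (mark, int (fst st j))
      else (word_contents (snd st), int (length (snd st))))"

definition config_of :: "nat \<Rightarrow> bool list \<Rightarrow> nat \<Rightarrow> state \<Rightarrow> config" where
  "config_of R w pc st = (Suc pc, map (tape_of R w st) [0..<R + 2])"

fun check :: "test \<Rightarrow> nat list \<Rightarrow> bool" where
  "check (IsZero r) rs \<longleftrightarrow> rs ! r = 1"
| "check (Reads c) rs \<longleftrightarrow> rs ! 0 = c"

fun target :: "instr \<Rightarrow> nat \<Rightarrow> nat list \<Rightarrow> nat" where
  "target (IBranch t l) pc rs = (if check t rs then l else Suc pc)"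
| "target (IJump l) pc rs = l"
| "target _ pc rs = Suc pc"

fun acts :: "nat \<Rightarrow> instr \<Rightarrow> nat list \<Rightarrow> nat \<Rightarrow> nat \<times> move" where
  "acts R (IInc r) rs j = (rs ! j, if j = r then Move_Right else Move_None)"
| "acts R (IDec r) rs j = (rs ! j, if j = r then Move_Left else Move_None)"
| "acts R (IOut b) rs j = (if j = Suc R then (if b then 2 else 1, Move_Right) else (rs ! j, Move_None))"
| "acts R _ rs j = (rs ! j, Move_None)"

definition rows :: "nat \<Rightarrow> nat list set" where
  "rows R = {rs. set rs \<subseteq> {..2} \<and> length rs = R + 2}"

text \<open>State 0 only writes the marks on the counter tapes. State \<open>Suc pc\<close> stands
  for program position \<open>pc\<close>, so the state behind the last instruction has no transition
  and the machine halts there.\<close>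

definition machine :: "nat \<Rightarrow> instr list \<Rightarrow> turing_machine" where
  "machine R prg = \<lparr>num_tapes = R + 2, start_state = 0, accept_state = 0,
     transitions =
       (\<lambda>rs. (0, rs, 1, map (\<lambda>j. (if j = 0 \<or> j = Suc R then rs ! j else 1, Move_None)) [0..<R + 2])) ` rows R \<union>
       (\<lambda>(pc, rs). (Suc pc, rs, Suc (target (prg ! pc) pc rs), map (acts R (prg ! pc) rs) [0..<R + 2])) `
         ({..<length prg} \<times> rows R)\<rparr>"

section \<open>Simulation of programs by machine runs\<close>

lemma finite_rows: "finite (rows R)"
  unfolding rows_def by (rule finite_lists_length_eq) simp

lemma wf_machine_machine: "wf_machine (machine R prg)"
  using finite_rows[of R]
  by (auto simp: wf_machine_def machine_def simp del: upt_Suc) (auto simp: rows_def)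

lemma deterministic_machine: "deterministic (machine R prg)"
  by (auto simp: deterministic_def machine_def)

lemma word_contents_le: "word_contents w i \<le> 2"
  by (simp add: word_contents_def)

lemma word_contents_nil: "word_contents [] = (\<lambda>_. 0)"
  by (auto simp: word_contents_def)

lemma word_contents_snoc:
  "(word_contents os)(int (length os) := if b then 2 else 1) = word_contents (os @ [b])"
  by (auto simp: word_contents_def nth_append fun_eq_iff nat_less_iff)

lemma read_tape_of: "read_tape (tape_of R w st j) \<le> 2"
  by (auto simp: tape_of_def word_contents_le mark_def)

lemma reads_in_rows: "map read_tape (map (tape_of R w st) [0..<R + 2]) \<in> rows R"
  by (auto simp: rows_def read_tape_of simp del: upt_Suc)

lemma machine_step:
  assumes "pc < length prg"
    and "\<And>j. j < R + 2 \<Longrightarrow>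
      act_tape (acts R (prg ! pc) (map (read_tape \<circ> tape_of R w st) [0..<R + 2]) j) (tape_of R w st j)
        = tape_of R w st' j"
    and "target (prg ! pc) pc (map (read_tape \<circ> tape_of R w st) [0..<R + 2]) = pc'"
  shows "(config_of R w pc st, config_of R w pc' st') \<in> step (machine R prg)"
proof -
  let ?ts = "map (tape_of R w st) [0..<R + 2]"
  let ?rs = "map read_tape ?ts"
  let ?as = "map (acts R (prg ! pc) ?rs) [0..<R + 2]"
  have rs: "?rs = map (read_tape \<circ> tape_of R w st) [0..<R + 2]" by (simp del: upt_Suc)
  have "(Suc pc, ?rs, Suc pc', ?as) \<in> transitions (machine R prg)"
    using assms(1) assms(3)[symmetric] reads_in_rows[of R w st] rs
    by (force simp: machine_def simp del: upt_Suc)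
  moreover have "map2 act_tape ?as ?ts = map (tape_of R w st') [0..<R + 2]"
    unfolding map2_map_map using assms(2) rs by (intro map_cong) (auto simp del: upt_Suc)
  ultimately show ?thesis
    unfolding step_def config_of_def by force
qed

lemma act_same: "act_tape (read_tape t, Move_None) t = t"
  by (cases t) auto

lemma nth_reads: "j < R + 2 \<Longrightarrow> map (read_tape \<circ> tape_of R w st) [0..<R + 2] ! j = read_tape (tape_of R w st j)"
  by (simp del: upt_Suc)

lemma step_inc:
  assumes "pc < length prg" "prg ! pc = IInc r" "r \<le> R"
  shows "(config_of R w pc (s, os), config_of R w (Suc pc) (s(r := Suc (s r)), os)) \<in> step (machine R prg)"
  using assms by (intro machine_step) (auto simp: nth_reads act_same simp del: upt_Suc, auto simp: tape_of_def)

lemma step_dec: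
  assumes "pc < length prg" "prg ! pc = IDec r" "r \<le> R" "s r = Suc n"
  shows "(config_of R w pc (s, os), config_of R w (Suc pc) (s(r := n), os)) \<in> step (machine R prg)"
  using assms by (intro machine_step) (auto simp: nth_reads act_same simp del: upt_Suc, auto simp: tape_of_def)

lemma step_out:
  assumes "pc < length prg" "prg ! pc = IOut b"
  shows "(config_of R w pc (s, os), config_of R w (Suc pc) (s, os @ [b])) \<in> step (machine R prg)"
  using assms word_contents_snoc[of os b]
  by (intro machine_step) (auto simp: nth_reads act_same simp del: upt_Suc, auto simp: tape_of_def)

lemma step_jump:
  assumes "pc < length prg" "prg ! pc = IJump l"
  shows "(config_of R w pc st, config_of R w l st) \<in> step (machine R prg)"
  using assms by (intro machine_step) (auto simp: nth_reads act_same simp del: upt_Suc)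

lemma step_branch:
  assumes "pc < length prg" "prg ! pc = IBranch t l" "\<forall>r. t = IsZero r \<longrightarrow> 0 < r \<and> r \<le> R"
  shows "(config_of R w pc st, config_of R w (if holds w t st then l else Suc pc) st) \<in> step (machine R prg)"
proof (rule machine_step)
  obtain s os where st: "st = (s, os)" by (metis surj_pair)
  have "check t (map (read_tape \<circ> tape_of R w st) [0..<R + 2]) = holds w t st"
    using assms(3) by (cases t) (auto simp: nth_reads tape_of_def mark_def st simp del: upt_Suc)
  then show "target (prg ! pc) pc (map (read_tape \<circ> tape_of R w st) [0..<R + 2])
      = (if holds w t st then l else Suc pc)"
    using assms(2) by simp
qed (use assms in \<open>auto simp: nth_reads act_same simp del: upt_Suc\<close>)

text \<open>Jump targets are absolute, so the induction has to know where the code sits: the prefix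
  \<open>xs\<close> supplies this position and \<open>zs\<close> is whatever follows.\<close>

lemma exec_machine:
  assumes "exec w c st n st'" "prg = xs @ code (length xs) c @ zs" "uses R c"
  shows "(config_of R w (length xs) st, config_of R w (length xs + clen c) st') \<in> step (machine R prg) ^^ n"
  using assms
proof (induction arbitrary: xs zs rule: exec.induct)
  case (exec_skip s)
  then show ?case by simp
next
  case (exec_inc r s os)
  then show ?case using step_inc[of "length xs" prg r R w s os] by simp
next
  case (exec_dec s r n os)
  then show ?case using step_dec[of "length xs" prg r R s n w os] by simp
next
  case (exec_out b s os)
  then show ?case using step_out[of "length xs" prg b R w s os] by simp
next
  case (exec_seq c s m s' d n s'')
  have "(config_of R w (length xs) s, config_of R w (length xs + clen c) s') \<in> step (machine R prg) ^^ m"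
    using exec_seq.prems by (intro exec_seq.IH(1)[of xs "code (length xs + clen c) d @ zs"]) auto
  moreover have "(config_of R w (length xs + clen c) s', config_of R w (length xs + clen c + clen d) s'')
      \<in> step (machine R prg) ^^ n"
    using exec_seq.IH(2)[of "xs @ code (length xs) c" zs] exec_seq.prems by (simp add: length_code)
  ultimately show ?case by (auto simp: relpow_add add.assoc)
next
  case (exec_if_true t s c n s' d)
  let ?l = "length xs + 2 + clen d"
  have "(config_of R w (length xs) s, config_of R w ?l s) \<in> step (machine R prg)"
    using step_branch[of "length xs" prg t ?l R w s] exec_if_true by simp
  moreover have "(config_of R w ?l s, config_of R w (?l + clen c) s') \<in> step (machine R prg) ^^ n"
    using exec_if_true.IH[of "xs @ IBranch t ?l # code (length xs + 1) d @ [IJump (?l + clen c)]" zs]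
      exec_if_true.prems by (simp add: length_code)
  ultimately have "(config_of R w (length xs) s, config_of R w (?l + clen c) s') \<in> step (machine R prg) ^^ (1 + n)"
    unfolding relpow_add by auto
  then show ?case by (simp add: add.commute add.left_commute)
next
  case (exec_if_false t s d n s' c)
  let ?l = "length xs + 2 + clen d"
  have 1: "(config_of R w (length xs) s, config_of R w (Suc (length xs)) s) \<in> step (machine R prg)"
    using step_branch[of "length xs" prg t ?l R w s] exec_if_false by simp
  have 2: "(config_of R w (Suc (length xs)) s, config_of R w (Suc (length xs) + clen d) s') \<in> step (machine R prg) ^^ n"
    using exec_if_false.IH[of "xs @ [IBranch t ?l]" "IJump (?l + clen c) # code ?l c @ zs"]
      exec_if_false.prems by simp
  have "prg ! (Suc (length xs) + clen d) = IJump (?l + clen c)"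
    using exec_if_false.prems by (simp add: nth_append length_code)
  then have 3: "(config_of R w (Suc (length xs) + clen d) s', config_of R w (?l + clen c) s') \<in> step (machine R prg)"
    using exec_if_false.prems by (intro step_jump) (auto simp: length_code)
  have "(config_of R w (length xs) s, config_of R w (?l + clen c) s') \<in> step (machine R prg) ^^ (1 + (n + 1))"
    unfolding relpow_add using 1 2 3 by auto
  then show ?case by (simp add: add.commute add.left_commute)
next
  case (exec_until_true t s c)
  then show ?case using step_branch[of "length xs" prg t "length xs + clen c + 2" R w s] by simp
next
  case (exec_until_false t s c m s' n s'')
  let ?l = "length xs + clen c + 2"
  have 1: "(config_of R w (length xs) s, config_of R w (Suc (length xs)) s) \<in> step (machine R prg)"
    using step_branch[of "length xs" prg t ?l R w s] exec_until_false by simp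
  have 2: "(config_of R w (Suc (length xs)) s, config_of R w (Suc (length xs) + clen c) s') \<in> step (machine R prg) ^^ m"
    using exec_until_false.IH(1)[of "xs @ [IBranch t ?l]" "IJump (length xs) # zs"]
      exec_until_false.prems by simp
  have "prg ! (Suc (length xs) + clen c) = IJump (length xs)"
    using exec_until_false.prems by (simp add: nth_append length_code)
  then have 3: "(config_of R w (Suc (length xs) + clen c) s', config_of R w (length xs) s') \<in> step (machine R prg)"
    using exec_until_false.prems by (intro step_jump) (auto simp: length_code)
  have 4: "(config_of R w (length xs) s', config_of R w (length xs + clen (CUntil t c)) s'') \<in> step (machine R prg) ^^ n"
    using exec_until_false.IH(2) exec_until_false.prems by blast
  show ?case
    unfolding relpow_add using 1 2 3 4 by auto
qed

text \<open>With a single-valued step relation there is only one run, so one halting computation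
  bounds all others. This turns the cost of one execution into \<open>runs_in_time\<close>.\<close>

lemma relpow_halt:
  assumes "single_valued r" "(x, y) \<in> r ^^ m" "y \<notin> Domain r" "(x, z) \<in> r ^^ n"
  shows "n \<le> m"
  using assms(2,4)
proof (induction m arbitrary: x n)
  case 0
  then show ?case using assms(3) by (cases n) (auto simp del: relpow.simps(2) dest!: relpow_Suc_D2)
next
  case (Suc m)
  show ?case
  proof (cases n)
    case (Suc n')
    obtain u where u: "(x, u) \<in> r" "(u, y) \<in> r ^^ m" using Suc.prems(1) relpow_Suc_D2 by metis
    obtain v where v: "(x, v) \<in> r" "(v, z) \<in> r ^^ n'" using Suc.prems(2) Suc relpow_Suc_D2 by metis
    have "u = v" using u(1) v(1) assms(1) by (auto dest: single_valuedD)
    then show ?thesis using Suc.IH[of u n'] u v Suc by auto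
  qed simp
qed

lemma single_valued_step: "deterministic M \<Longrightarrow> single_valued (step M)"
  unfolding single_valued_def step_def deterministic_def by (auto; metis prod.inject)

lemma program_computes:
  fixes p :: "nat poly"
  assumes run: "\<And>w. \<exists>n s. n \<le> poly p (length w) \<and> exec w c (\<lambda>_. 0, []) n (s, f w)"
    and R: "uses R c"
  shows "poly_time_computable f"
proof -
  define prg where "prg = code 0 c"
  define M where "M = machine R prg"
  \<comment> \<open>The added 1 pays for the initial step that writes the marks.\<close>
  have tr: "\<exists>n d. n \<le> poly (p + 1) (length w) \<and> (initial M w, d) \<in> step M ^^ n \<and> halted M d \<and>
      fst (last (snd d)) = word_contents (f w)" for w
  proof -
    obtain n s where n: "n \<le> poly p (length w)" "exec w c (\<lambda>_. 0, []) n (s, f w)" using run by blast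
    let ?d = "config_of R w (clen c) (s, f w)"
    have run': "(config_of R w 0 (\<lambda>_. 0, []), ?d) \<in> step M ^^ n"
      using exec_machine[OF n(2), of prg "[]" "[]" R] R by (simp add: M_def prg_def)
    let ?ts = "(word_contents w, 0) # replicate (Suc R) (word_contents [], 0)"
    have nth: "?ts = map (\<lambda>j. if j = 0 then (word_contents w, 0) else (word_contents [], 0)) [0..<R + 2]"
      by (rule nth_equalityI) (auto simp: nth_Cons' simp del: upt_Suc replicate_Suc)
    let ?rs = "map read_tape ?ts"
    let ?as = "map (\<lambda>j. (if j = 0 \<or> j = Suc R then ?rs ! j else 1, Move_None)) [0..<R + 2]"
    have "?rs \<in> rows R" by (auto simp: rows_def word_contents_le)
    then have "(0 :: nat, ?rs, 1 :: nat, ?as) \<in> (\<lambda>rs. (0, rs, 1,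
        map (\<lambda>j. (if j = 0 \<or> j = Suc R then rs ! j else 1, Move_None)) [0..<R + 2])) ` rows R"
      by (rule image_eqI[OF refl])
    then have "(0, ?rs, 1, ?as) \<in> transitions M"
      unfolding M_def machine_def by (simp only: turing_machine.simps Un_iff simp_thms)
    moreover have "map2 act_tape ?as ?ts = map (tape_of R w (\<lambda>_. 0, [])) [0..<R + 2]"
    proof (rule nth_equalityI)
      fix j assume "j < length (map2 act_tape ?as ?ts)"
      then have j: "j < R + 2" by simp
      have ts: "?ts ! j = (if j = 0 then (word_contents w, 0) else (word_contents [], 0))"
        by (subst nth) (use j in \<open>simp del: upt_Suc\<close>)
      have "?rs ! j = read_tape (?ts ! j)" using j by (intro nth_map) simp
      moreover have "map2 act_tape ?as ?ts ! j = act_tape (?as ! j) (?ts ! j)"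
        using j by (simp del: upt_Suc replicate_Suc list.map nth_Cons_0)
      moreover have "?as ! j = (if j = 0 \<or> j = Suc R then ?rs ! j else 1, Move_None)"
        using j by (simp del: upt_Suc replicate_Suc list.map)
      ultimately show "map2 act_tape ?as ?ts ! j = map (tape_of R w (\<lambda>_. 0, [])) [0..<R + 2] ! j"
        unfolding ts using j
        by (auto simp: tape_of_def mark_def word_contents_nil fun_eq_iff simp del: upt_Suc replicate_Suc list.map)
    qed simp
    ultimately have "((0, ?ts), config_of R w 0 (\<lambda>_. 0, [])) \<in> step M"
      unfolding step_def config_of_def by force
    moreover have "initial M w = (0, ?ts)"
      by (simp add: initial_def M_def machine_def)
    ultimately have "(initial M w, ?d) \<in> step M ^^ Suc n"
      using run' by (metis relpow_Suc_I2)
    moreover have "halted M ?d"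
      by (auto simp: halted_def step_def config_of_def M_def machine_def prg_def length_code)
    moreover have "fst (last (snd ?d)) = word_contents (f w)"
      by (simp add: config_of_def tape_of_def)
    ultimately show ?thesis using n(1) by (intro exI[of _ "Suc n"] exI[of _ ?d]) auto
  qed
  have "wf_machine M" "deterministic M"
    by (simp_all add: M_def wf_machine_machine deterministic_machine)
  moreover have "runs_in_time M (poly (p + 1))"
    unfolding runs_in_time_def
  proof (intro allI impI)
    fix w n d assume d: "(initial M w, d) \<in> step M ^^ n"
    obtain m e where e: "m \<le> poly (p + 1) (length w)" "(initial M w, e) \<in> step M ^^ m" "halted M e"
      using tr[of w] by blast
    have "n \<le> m"
      by (rule relpow_halt[OF single_valued_step e(2) _ d])
        (use e(3) \<open>deterministic M\<close> in \<open>auto simp: halted_def\<close>)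
    then show "n \<le> poly (p + 1) (length w)" using e(1) by simp
  qed
  moreover have "computes M f"
    unfolding computes_def using tr by (meson relpow_imp_rtrancl)
  ultimately show ?thesis unfolding poly_time_computable_def by blast
qed

section \<open>Loop programs without assignment are polynomial\<close>

text \<open>
  Loop bounds are built from the input length by the semiring operations, and loop variables are
  read-only, so all values and running times are polynomially bounded by construction.
\<close>

datatype aexp =
    Num nat | Var nat | Plus aexp aexp | Minus aexp aexp | Times aexp aexp | Sym aexp

fun eval :: "bool list \<Rightarrow> (nat \<Rightarrow> nat) \<Rightarrow> aexp \<Rightarrow> nat" where
  "eval w s (Num n) = n"
| "eval w s (Var x) = s x"
| "eval w s (Plus a b) = eval w s a + eval w s b"
| "eval w s (Minus a b) = eval w s a - eval w s b"
| "eval w s (Times a b) = eval w s a * eval w s b"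
| "eval w s (Sym a) = word_contents w (int (eval w s a))"

fun vars :: "aexp \<Rightarrow> nat set" where
  "vars (Num n) = {}"
| "vars (Var x) = {x}"
| "vars (Plus a b) = vars a \<union> vars b"
| "vars (Minus a b) = vars a \<union> vars b"
| "vars (Times a b) = vars a \<union> vars b"
| "vars (Sym a) = vars a"

datatype gen = Put "bool list" | PutNat aexp | Then gen gen | Each nat aexp gen

fun den :: "bool list \<Rightarrow> (nat \<Rightarrow> nat) \<Rightarrow> gen \<Rightarrow> bool list" where
  "den w s (Put bs) = bs"
| "den w s (PutNat a) = enc_nat (eval w s a)"
| "den w s (Then g h) = den w s g @ den w s h"
| "den w s (Each x a g) = concat (map (\<lambda>i. den w (s(x := i)) g) [0..<eval w s a])"

fun scoped :: "nat set \<Rightarrow> nat \<Rightarrow> gen \<Rightarrow> bool" where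
  "scoped D k (Put bs) \<longleftrightarrow> True"
| "scoped D k (PutNat a) \<longleftrightarrow> vars a \<subseteq> D"
| "scoped D k (Then g h) \<longleftrightarrow> scoped D k g \<and> scoped D k h"
| "scoped D k (Each x a g) \<longleftrightarrow> x = k \<and> vars a \<subseteq> D \<and> scoped (insert k D) (k + 2) g"

lemma eval_cong: "(\<And>x. x \<in> vars a \<Longrightarrow> s x = s' x) \<Longrightarrow> eval w s a = eval w s' a"
  by (induction a) auto

lemma den_cong: "scoped D k g \<Longrightarrow> (\<And>x. x \<in> D \<Longrightarrow> s x = s' x) \<Longrightarrow> den w s g = den w s' g"
proof (induction g arbitrary: D k s s')
  case (PutNat a)
  have "eval w s a = eval w s' a" using PutNat.prems by (intro eval_cong) auto
  then show ?case by simp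
next
  case (Then g h)
  then show ?case by (metis den.simps(3) scoped.simps(3))
next
  case (Each x a g)
  have "eval w s a = eval w s' a" using Each.prems by (intro eval_cong) auto
  moreover have "den w (s(x := i)) g = den w (s'(x := i)) g" for i
    using Each.prems by (intro Each.IH[of "insert k D" "k + 2"]) auto
  ultimately show ?case by simp
qed simp

section \<open>Polynomial time bounds for loop programs\<close>

definition runs :: "bool list \<Rightarrow> com \<Rightarrow> state \<Rightarrow> nat \<Rightarrow> state \<Rightarrow> bool" where
  "runs w c s t s' \<longleftrightarrow> (\<exists>n\<le>t. exec w c s n s')"

lemma runs_mono: "runs w c s t s' \<Longrightarrow> t \<le> t' \<Longrightarrow> runs w c s t' s'"
  unfolding runs_def by (meson le_trans)

lemma runs_eq: "runs w c s t s' \<Longrightarrow> s = u \<Longrightarrow> s' = v \<Longrightarrow> t \<le> t' \<Longrightarrow> runs w c u t' v"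
  using runs_mono by blast

lemma runs_skip: "runs w CSkip s t s"
  unfolding runs_def using exec_skip by blast

lemma runs_inc: "runs w (CInc r) (s, os) 1 (s(r := Suc (s r)), os)"
  unfolding runs_def using exec_inc by blast

lemma runs_dec: "s r = Suc n \<Longrightarrow> runs w (CDec r) (s, os) 1 (s(r := n), os)"
  unfolding runs_def using exec_dec by blast

lemma runs_out: "runs w (COut b) (s, os) 1 (s, os @ [b])"
  unfolding runs_def using exec_out by blast

lemma runs_seq: "runs w c s m s' \<Longrightarrow> runs w d s' n s'' \<Longrightarrow> runs w (CSeq c d) s (m + n) s''"
  unfolding runs_def by (meson add_mono exec_seq)

lemma runs_if:
  assumes "holds w t s \<Longrightarrow> runs w c s m s'" "\<not> holds w t s \<Longrightarrow> runs w d s m s'"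
  shows "runs w (CIf t c d) s (m + 2) s'"
proof (cases "holds w t s")
  case True
  then obtain n where "n \<le> m" "exec w c s n s'" using assms unfolding runs_def by blast
  then have "exec w (CIf t c d) s (1 + n) s'" using True exec_if_true by blast
  then show ?thesis unfolding runs_def using \<open>n \<le> m\<close> by (intro exI[of _ "1 + n"]) simp
next
  case False
  then obtain n where "n \<le> m" "exec w d s n s'" using assms unfolding runs_def by blast
  then have "exec w (CIf t c d) s (1 + (n + 1)) s'" using False exec_if_false by blast
  then show ?thesis unfolding runs_def using \<open>n \<le> m\<close> by (intro exI[of _ "1 + (n + 1)"]) simp
qed

lemma runs_until_done: "holds w t s \<Longrightarrow> runs w (CUntil t c) s 1 s"
  unfolding runs_def using exec_until_true by blast

lemma runs_until_step:
  assumes "\<not> holds w t s" "runs w c s m s'" "runs w (CUntil t c) s' n s''"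
  shows "runs w (CUntil t c) s (m + n + 2) s''"
proof -
  obtain a b where "a \<le> m" "exec w c s a s'" "b \<le> n" "exec w (CUntil t c) s' b s''"
    using assms unfolding runs_def by blast
  then show ?thesis using assms(1) exec_until_false[of w t s c a s' b s'']
    unfolding runs_def by (intro exI[of _ "1 + (a + (1 + b))"]) simp
qed

definition CFor :: "nat \<Rightarrow> com \<Rightarrow> com" where
  "CFor r c = CUntil (IsZero r) (CSeq (CDec r) c)"

text \<open>\<open>S i\<close> is the state before round \<open>i\<close>. The loop consumes its
  counter, and the body sees it already decreased. The 3 per round are test, decrement and jump; the
  last 1 is the failing round's test.\<close>

lemma runs_for:
  assumes "\<And>i. i \<le> m \<Longrightarrow> fst (S i) r = m - i"
    and "\<And>i. i < m \<Longrightarrow> runs w c ((fst (S i))(r := m - Suc i), snd (S i)) t (S (Suc i))"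
  shows "runs w (CFor r c) (S 0) (m * (t + 3) + 1) (S m)"
  using assms
proof (induction m arbitrary: S)
  case 0
  then have "holds w (IsZero r) (S 0)" by (cases "S 0") (metis diff_zero fst_conv holds.simps(1) le_refl)
  then show ?case unfolding CFor_def using runs_until_done by simp
next
  case (Suc m)
  have r0: "fst (S 0) r = Suc m" using Suc.prems(1)[of 0] by simp
  have dec: "runs w (CDec r) (S 0) 1 ((fst (S 0))(r := m), snd (S 0))"
    using runs_dec[of "fst (S 0)" r m w "snd (S 0)"] r0 by simp
  have "runs w c ((fst (S 0))(r := m), snd (S 0)) t (S 1)"
    by (rule runs_eq[OF Suc.prems(2)[OF zero_less_Suc]]) (auto simp: fun_eq_iff)
  then have body: "runs w (CSeq (CDec r) c) (S 0) (1 + t) (S 1)"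
    by (rule runs_seq[OF dec])
  have rest: "runs w (CFor r c) (S 1) (m * (t + 3) + 1) (S (Suc m))"
    using Suc.IH[of "\<lambda>i. S (Suc i)"] Suc.prems by auto
  have "\<not> holds w (IsZero r) (S 0)" using r0 by (cases "S 0") simp
  then have "runs w (CFor r c) (S 0) (1 + t + (m * (t + 3) + 1) + 2) (S (Suc m))"
    using body rest unfolding CFor_def by (rule runs_until_step)
  then show ?case by (rule runs_mono) simp
qed

lemma runs_move:
  assumes "r \<noteq> d" "s r = m"
  shows "runs w (CFor r (CInc d)) (s, os) (m * 4 + 1) (s(r := 0, d := s d + m), os)"
proof -
  have "runs w (CFor r (CInc d)) ((\<lambda>i. (s(r := m - i, d := s d + i), os)) 0) (m * (1 + 3) + 1)
      ((\<lambda>i. (s(r := m - i, d := s d + i), os)) m)"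
  proof (rule runs_for)
    fix i assume "i < m"
    show "runs w (CInc d) ((fst (s(r := m - i, d := s d + i), os))(r := m - Suc i), snd (s(r := m - i, d := s d + i), os)) 1
        (s(r := m - Suc i, d := s d + Suc i), os)"
      using runs_inc[of w d "s(r := m - Suc i, d := s d + i)" os] assms
      by (simp add: fun_upd_twist)
  qed (use assms in auto)
  then show ?thesis using assms by (simp add: fun_upd_idem)
qed

text \<open>The value is added to \<open>d\<close>; all other registers end as they began, and those
  from \<open>k\<close> on are scratch space that starts at 0. A counter can be read only by
  counting it down, so a variable is moved to \<open>k\<close> and back. For \<open>Sym\<close> the
  input head itself walks to the position, and \<open>k + 1\<close> remembers the way home.\<close>

fun cexp :: "aexp \<Rightarrow> nat \<Rightarrow> nat \<Rightarrow> com" where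
  "cexp (Num n) d k = ((\<lambda>c. CSeq (CInc d) c) ^^ n) CSkip"
| "cexp (Var x) d k = CSeq (CFor x (CSeq (CInc d) (CInc k))) (CFor k (CInc x))"
| "cexp (Plus a b) d k = CSeq (cexp a d k) (cexp b d k)"
| "cexp (Minus a b) d k =
     CSeq (cexp a k (k + 2)) (CSeq (cexp b (k + 1) (k + 2))
       (CSeq (CFor (k + 1) (CIf (IsZero k) CSkip (CDec k))) (CFor k (CInc d))))"
| "cexp (Times a b) d k = CSeq (cexp a k (k + 1)) (CFor k (cexp b d (k + 1)))"
| "cexp (Sym a) d k =
     CSeq (cexp a k (k + 2)) (CSeq (CFor k (CSeq (CInc (k + 1)) (CInc 0)))
       (CSeq (CIf (Reads 2) (CSeq (CInc d) (CInc d)) (CIf (Reads 1) (CInc d) CSkip))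
         (CFor (k + 1) (CDec 0))))"

text \<open>Running times are measured in a separate bound \<open>B\<close>, not in the input
  length, because loop variables may exceed the length.\<close>

definition calm :: "bool list \<Rightarrow> (nat \<Rightarrow> nat) \<Rightarrow> nat set \<Rightarrow> nat \<Rightarrow> nat \<Rightarrow> bool" where
  "calm w s D k B \<longleftrightarrow> (\<forall>x\<in>D. s x \<le> B) \<and> length w \<le> B \<and> (\<forall>r\<ge>k. s r = 0) \<and> s 0 = 0"

lemma eval_poly_bound:
  "\<exists>q :: nat poly. \<forall>w s k B. calm w s (vars a) k B \<longrightarrow> eval w s a \<le> poly q B"
proof (induction a)
  case (Num n)
  show ?case by (rule exI[of _ "[:n:]"]) simp
next
  case (Var x)
  show ?case by (rule exI[of _ "[:0, 1:]"]) (simp add: calm_def)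
next
  case (Plus a b)
  then obtain p q :: "nat poly" where pq:
    "\<And>w s k B. calm w s (vars a) k B \<Longrightarrow> eval w s a \<le> poly p B"
    "\<And>w s k B. calm w s (vars b) k B \<Longrightarrow> eval w s b \<le> poly q B" by blast
  show ?case
    by (rule exI[of _ "p + q"]) (auto simp: calm_def intro!: add_mono pq)
next
  case (Minus a b)
  then obtain p :: "nat poly" where p:
    "\<And>w s k B. calm w s (vars a) k B \<Longrightarrow> eval w s a \<le> poly p B" by blast
  show ?case
    by (rule exI[of _ p]) (auto simp: calm_def intro!: le_trans[OF diff_le_self] p)
next
  case (Times a b)
  then obtain p q :: "nat poly" where pq:
    "\<And>w s k B. calm w s (vars a) k B \<Longrightarrow> eval w s a \<le> poly p B"
    "\<And>w s k B. calm w s (vars b) k B \<Longrightarrow> eval w s b \<le> poly q B" by blast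
  show ?case
    by (rule exI[of _ "p * q"]) (auto simp: calm_def intro!: mult_mono pq)
next
  case (Sym a)
  show ?case by (rule exI[of _ "[:2:]"]) (simp add: word_contents_le)
qed

lemma runs_num: "runs w (((\<lambda>c. CSeq (CInc d) c) ^^ n) CSkip) (s, os) n (s(d := s d + n), os)"
proof (induction n arbitrary: s)
  case 0
  then show ?case using runs_skip by simp
next
  case (Suc n)
  have "runs w (CSeq (CInc d) (((\<lambda>c. CSeq (CInc d) c) ^^ n) CSkip)) (s, os) (1 + n)
      ((s(d := Suc (s d)))(d := (s(d := Suc (s d))) d + n), os)"
    by (rule runs_seq[OF runs_inc Suc.IH])
  then show ?case unfolding funpow.simps comp_apply by (rule runs_eq) (auto simp: fun_eq_iff)
qed

lemma cexp_runs:
  assumes "vars a \<subseteq> {1..<k}" "d \<notin> vars a" "0 < d" "d < k"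
  shows "\<exists>p :: nat poly. \<forall>w s os B. calm w s (vars a) k B \<longrightarrow>
    runs w (cexp a d k) (s, os) (poly p B) (s(d := s d + eval w s a), os)"
  using assms
proof (induction a arbitrary: d k)
  case (Num n)
  show ?case
  proof (rule exI[of _ "[:n:]"], intro allI impI)
    fix w s os B
    show "runs w (cexp (Num n) d k) (s, os) (poly [:n:] B) (s(d := s d + eval w s (Num n)), os)"
      unfolding cexp.simps by (rule runs_eq[OF runs_num]) auto
  qed
next
  case (Var x)
  have ne: "x \<noteq> d" "x \<noteq> k" "d \<noteq> k" using Var.prems by auto
  show ?case
  proof (rule exI[of _ "[:2, 9:]"], intro allI impI)
    fix w s B and os :: "bool list" assume calm: "calm w s (vars (Var x)) k B"
    then have sk: "s k = 0" "s x \<le> B" by (auto simp: calm_def)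
    let ?S = "\<lambda>i. (s(x := s x - i, d := s d + i, k := i), os)"
    have "runs w (CFor x (CSeq (CInc d) (CInc k))) (?S 0) (s x * (2 + 3) + 1) (?S (s x))"
    proof (rule runs_for)
      fix i assume "i < s x"
      let ?s = "s(x := s x - Suc i, d := s d + i, k := i)"
      have "runs w (CSeq (CInc d) (CInc k)) (?s, os) (1 + 1)
          ((?s(d := Suc (?s d)))(k := Suc ((?s(d := Suc (?s d))) k)), os)"
        by (rule runs_seq[OF runs_inc runs_inc])
      then show "runs w (CSeq (CInc d) (CInc k)) ((fst (?S i))(x := s x - Suc i), snd (?S i)) 2 (?S (Suc i))"
        by (rule runs_eq) (use ne in \<open>auto simp: fun_eq_iff\<close>)
    qed (use ne in auto)
    then have "runs w (cexp (Var x) d k) (?S 0) (s x * (2 + 3) + 1 + (s x * 4 + 1))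
        ((fst (?S (s x)))(k := 0, x := fst (?S (s x)) x + s x), os)"
      unfolding cexp.simps by (rule runs_seq) (use runs_move[of k x "fst (?S (s x))" "s x" w os] ne in auto)
    then show "runs w (cexp (Var x) d k) (s, os) (poly [:2, 9:] B) (s(d := s d + eval w s (Var x)), os)"
      by (rule runs_eq) (use ne sk in \<open>auto simp: fun_eq_iff\<close>)
  qed
next
  case (Plus a b)
  obtain p q :: "nat poly" where pq:
    "\<And>w s os B. calm w s (vars a) k B \<Longrightarrow> runs w (cexp a d k) (s, os) (poly p B) (s(d := s d + eval w s a), os)"
    "\<And>w s os B. calm w s (vars b) k B \<Longrightarrow> runs w (cexp b d k) (s, os) (poly q B) (s(d := s d + eval w s b), os)"
  proof -
    have v: "vars a \<subseteq> {1..<k}" "d \<notin> vars a" "vars b \<subseteq> {1..<k}" "d \<notin> vars b"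
      using Plus.prems by auto
    show ?thesis using that Plus.IH(1)[OF v(1,2) Plus.prems(3,4)] Plus.IH(2)[OF v(3,4) Plus.prems(3,4)]
      by blast
  qed
  show ?case
  proof (rule exI[of _ "p + q"], intro allI impI)
    fix w s B and os :: "bool list" assume calm: "calm w s (vars (Plus a b)) k B"
    let ?s = "s(d := s d + eval w s a)"
    have "runs w (cexp a d k) (s, os) (poly p B) (?s, os)"
      using calm by (intro pq) (auto simp: calm_def)
    moreover have "runs w (cexp b d k) (?s, os) (poly q B) (?s(d := ?s d + eval w ?s b), os)"
      using calm Plus.prems by (intro pq) (auto simp: calm_def)
    moreover have "eval w ?s b = eval w s b" using Plus.prems by (intro eval_cong) auto
    ultimately show "runs w (cexp (Plus a b) d k) (s, os) (poly (p + q) B) (s(d := s d + eval w s (Plus a b)), os)"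
      unfolding cexp.simps by - (drule (1) runs_seq, erule runs_eq, auto simp: fun_eq_iff)
  qed
next
  case (Minus a b)
  obtain p q :: "nat poly" where pq:
    "\<And>w s os B. calm w s (vars a) (k + 2) B \<Longrightarrow> runs w (cexp a k (k + 2)) (s, os) (poly p B) (s(k := s k + eval w s a), os)"
    "\<And>w s os B. calm w s (vars b) (k + 2) B \<Longrightarrow> runs w (cexp b (k + 1) (k + 2)) (s, os) (poly q B) (s(k + 1 := s (k + 1) + eval w s b), os)"
  proof -
    have v: "vars a \<subseteq> {1..<k + 2}" "k \<notin> vars a" "vars b \<subseteq> {1..<k + 2}" "k + 1 \<notin> vars b"
      "0 < k" "0 < k + 1" "k < k + 2" "k + 1 < k + 2"
      using Minus.prems by auto
    show ?thesis using that Minus.IH(1)[OF v(1,2,5,7)] Minus.IH(2)[OF v(3,4,6,8)] by blast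
  qed
  obtain va vb :: "nat poly" where v:
    "\<And>w s k B. calm w s (vars a) k B \<Longrightarrow> eval w s a \<le> poly va B"
    "\<And>w s k B. calm w s (vars b) k B \<Longrightarrow> eval w s b \<le> poly vb B"
    using eval_poly_bound[of a] eval_poly_bound[of b] by blast
  show ?case
  proof (rule exI[of _ "p + q + smult 6 vb + smult 4 va + [:2:]"], intro allI impI)
    fix w s B and os :: "bool list" assume calm: "calm w s (vars (Minus a b)) k B"
    let ?a = "eval w s a" and ?b = "eval w s b"
    have z: "s k = 0" "s (k + 1) = 0" using calm by (auto simp: calm_def)
    have ab: "?a \<le> poly va B" "?b \<le> poly vb B" using calm v[of w s k B] by (auto simp: calm_def)
    let ?s1 = "s(k := ?a)" and ?s2 = "s(k := ?a, k + 1 := ?b)"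
    have 1: "runs w (cexp a k (k + 2)) (s, os) (poly p B) (?s1, os)"
      by (rule runs_eq[OF pq(1)[of w s B os]]) (use calm z in \<open>auto simp: calm_def\<close>)
    have "eval w ?s1 b = ?b" using Minus.prems by (intro eval_cong) auto
    then have 2: "runs w (cexp b (k + 1) (k + 2)) (?s1, os) (poly q B) (?s2, os)"
      by - (rule runs_eq[OF pq(2)[of w ?s1 B os]], use calm z Minus.prems in \<open>auto simp: calm_def fun_eq_iff\<close>)
    let ?S = "\<lambda>i. (s(k := ?a - i, k + 1 := ?b - i), os)"
    have "runs w (CFor (k + 1) (CIf (IsZero k) CSkip (CDec k))) (?S 0) (?b * (3 + 3) + 1) (?S ?b)"
    proof (rule runs_for)
      fix i assume i: "i < ?b"
      let ?s = "s(k := ?a - i, k + 1 := ?b - Suc i)"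
      have "runs w (CIf (IsZero k) CSkip (CDec k)) (?s, os) (1 + 2) (s(k := ?a - Suc i, k + 1 := ?b - Suc i), os)"
      proof (rule runs_if)
        assume "holds w (IsZero k) (?s, os)"
        then have "?a - Suc i = ?a - i" by simp
        then show "runs w CSkip (?s, os) 1 (s(k := ?a - Suc i, k + 1 := ?b - Suc i), os)"
          using runs_skip by simp
      next
        assume "\<not> holds w (IsZero k) (?s, os)"
        then have "?s k = Suc (?a - Suc i)" by simp
        from runs_dec[of ?s k "?a - Suc i" w os, OF this]
        show "runs w (CDec k) (?s, os) 1 (s(k := ?a - Suc i, k + 1 := ?b - Suc i), os)"
          by (rule runs_eq) (auto simp: fun_eq_iff)
      qed
      then show "runs w (CIf (IsZero k) CSkip (CDec k)) ((fst (?S i))(k + 1 := ?b - Suc i), snd (?S i)) 3 (?S (Suc i))"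
        by (rule runs_eq) (auto simp: fun_eq_iff)
    qed auto
    then have 3: "runs w (CFor (k + 1) (CIf (IsZero k) CSkip (CDec k))) (?s2, os) (?b * 6 + 1) (s(k := ?a - ?b), os)"
      by (rule runs_eq) (use z in \<open>auto simp: fun_eq_iff\<close>)
    have "runs w (CFor k (CInc d)) (s(k := ?a - ?b), os) ((?a - ?b) * 4 + 1)
        ((s(k := ?a - ?b))(k := 0, d := (s(k := ?a - ?b)) d + (?a - ?b)), os)"
      using Minus.prems by (intro runs_move) auto
    then have 4: "runs w (CFor k (CInc d)) (s(k := ?a - ?b), os) ((?a - ?b) * 4 + 1) (s(d := s d + (?a - ?b)), os)"
      by (rule runs_eq) (use z Minus.prems in \<open>auto simp: fun_eq_iff\<close>)
    have "runs w (cexp (Minus a b) d k) (s, os)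
        (poly p B + (poly q B + ((?b * 6 + 1) + ((?a - ?b) * 4 + 1)))) (s(d := s d + (?a - ?b)), os)"
      unfolding cexp.simps by (intro runs_seq[OF 1] runs_seq[OF 2] runs_seq[OF 3] 4)
    then show "runs w (cexp (Minus a b) d k) (s, os) (poly (p + q + smult 6 vb + smult 4 va + [:2:]) B)
        (s(d := s d + eval w s (Minus a b)), os)"
      by (rule runs_eq) (use ab in auto)
  qed
next
  case (Times a b)
  obtain p q :: "nat poly" where pq:
    "\<And>w s os B. calm w s (vars a) (k + 1) B \<Longrightarrow> runs w (cexp a k (k + 1)) (s, os) (poly p B) (s(k := s k + eval w s a), os)"
    "\<And>w s os B. calm w s (vars b) (k + 1) B \<Longrightarrow> runs w (cexp b d (k + 1)) (s, os) (poly q B) (s(d := s d + eval w s b), os)"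
  proof -
    have v: "vars a \<subseteq> {1..<k + 1}" "k \<notin> vars a" "vars b \<subseteq> {1..<k + 1}" "d \<notin> vars b"
      "0 < k" "0 < d" "k < k + 1" "d < k + 1"
      using Times.prems by auto
    show ?thesis using that Times.IH(1)[OF v(1,2,5,7)] Times.IH(2)[OF v(3,4,6,8)] by blast
  qed
  obtain va :: "nat poly" where v: "\<And>w s k B. calm w s (vars a) k B \<Longrightarrow> eval w s a \<le> poly va B"
    using eval_poly_bound[of a] by blast
  show ?case
  proof (rule exI[of _ "p + va * (q + [:3:]) + [:1:]"], intro allI impI)
    fix w s B and os :: "bool list" assume calm: "calm w s (vars (Times a b)) k B"
    let ?a = "eval w s a" and ?b = "eval w s b"
    have z: "s k = 0" using calm by (auto simp: calm_def)
    have a: "?a \<le> poly va B" using calm v[of w s k B] by (auto simp: calm_def)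
    have 1: "runs w (cexp a k (k + 1)) (s, os) (poly p B) (s(k := ?a), os)"
      by (rule runs_eq[OF pq(1)[of w s B os]]) (use calm z in \<open>auto simp: calm_def\<close>)
    let ?S = "\<lambda>i. (s(k := ?a - i, d := s d + i * ?b), os)"
    have "runs w (CFor k (cexp b d (k + 1))) (?S 0) (?a * (poly q B + 3) + 1) (?S ?a)"
    proof (rule runs_for)
      fix i assume i: "i < ?a"
      let ?s = "s(k := ?a - Suc i, d := s d + i * ?b)"
      have ev: "eval w ?s b = ?b" using Times.prems by (intro eval_cong) auto
      have "calm w ?s (vars b) (k + 1) B" using calm Times.prems by (auto simp: calm_def)
      from pq(2)[OF this, of os]
      show "runs w (cexp b d (k + 1)) ((fst (?S i))(k := ?a - Suc i), snd (?S i)) (poly q B) (?S (Suc i))"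
        by (rule runs_eq) (use ev Times.prems in \<open>auto simp: fun_eq_iff\<close>)
    qed (use Times.prems in auto)
    then have 2: "runs w (CFor k (cexp b d (k + 1))) (s(k := ?a), os) (?a * (poly q B + 3) + 1) (s(d := s d + ?a * ?b), os)"
      by (rule runs_eq) (use z Times.prems in \<open>auto simp: fun_eq_iff\<close>)
    have "?a * (poly q B + 3) \<le> poly va B * (poly q B + 3)" using a by (rule mult_le_mono1)
    with runs_seq[OF 1 2]
    show "runs w (cexp (Times a b) d k) (s, os) (poly (p + va * (q + [:3:]) + [:1:]) B)
        (s(d := s d + eval w s (Times a b)), os)"
      unfolding cexp.simps by (elim runs_eq) auto
  qed
next
  case (Sym a)
  obtain p :: "nat poly" where p:
    "\<And>w s os B. calm w s (vars a) (k + 2) B \<Longrightarrow> runs w (cexp a k (k + 2)) (s, os) (poly p B) (s(k := s k + eval w s a), os)"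
  proof -
    have v: "vars a \<subseteq> {1..<k + 2}" "k \<notin> vars a" "0 < k" "k < k + 2"
      using Sym.prems by auto
    show ?thesis using that Sym.IH[OF v] by blast
  qed
  obtain va :: "nat poly" where v: "\<And>w s k B. calm w s (vars a) k B \<Longrightarrow> eval w s a \<le> poly va B"
    using eval_poly_bound[of a] by blast
  show ?case
  proof (rule exI[of _ "p + smult 9 va + [:7:]"], intro allI impI)
    fix w s B and os :: "bool list" assume calm: "calm w s (vars (Sym a)) k B"
    let ?a = "eval w s a"
    let ?v = "word_contents w (int ?a)"
    have z: "s k = 0" "s (k + 1) = 0" "s 0 = 0" using calm by (auto simp: calm_def)
    have a: "?a \<le> poly va B" using calm v[of w s k B] by (auto simp: calm_def)
    have k: "0 < k" using Sym.prems by auto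
    have 1: "runs w (cexp a k (k + 2)) (s, os) (poly p B) (s(k := ?a), os)"
      by (rule runs_eq[OF p[of w s B os]]) (use calm z in \<open>auto simp: calm_def\<close>)
    let ?S = "\<lambda>i. (s(k := ?a - i, k + 1 := i, 0 := i), os)"
    have "runs w (CFor k (CSeq (CInc (k + 1)) (CInc 0))) (?S 0) (?a * (2 + 3) + 1) (?S ?a)"
    proof (rule runs_for)
      fix i assume i: "i < ?a"
      let ?s = "s(k := ?a - Suc i, k + 1 := i, 0 := i)"
      have "runs w (CSeq (CInc (k + 1)) (CInc 0)) (?s, os) (1 + 1)
          ((?s(k + 1 := Suc (?s (k + 1))))(0 := Suc ((?s(k + 1 := Suc (?s (k + 1)))) 0)), os)"
        by (rule runs_seq[OF runs_inc runs_inc])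
      then show "runs w (CSeq (CInc (k + 1)) (CInc 0)) ((fst (?S i))(k := ?a - Suc i), snd (?S i)) 2 (?S (Suc i))"
        by (rule runs_eq) (use k in \<open>auto simp: fun_eq_iff\<close>)
    qed (use k in auto)
    then have 2: "runs w (CFor k (CSeq (CInc (k + 1)) (CInc 0))) (s(k := ?a), os) (?a * 5 + 1) (s(k + 1 := ?a, 0 := ?a), os)"
      by (rule runs_eq) (use z k in \<open>auto simp: fun_eq_iff\<close>)
    let ?t = "s(k + 1 := ?a, 0 := ?a)"
    have dne: "d \<noteq> 0" "d \<noteq> k + 1" "d \<noteq> k" using Sym.prems by auto
    have 3: "runs w (CIf (Reads 2) (CSeq (CInc d) (CInc d)) (CIf (Reads 1) (CInc d) CSkip)) (?t, os) (3 + 2)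
        (?t(d := s d + ?v), os)"
    proof (rule runs_if)
      assume "holds w (Reads 2) (?t, os)"
      then have v2: "?v = 2" by simp
      have "runs w (CSeq (CInc d) (CInc d)) (?t, os) (1 + 1)
          ((?t(d := Suc (?t d)))(d := Suc ((?t(d := Suc (?t d))) d)), os)"
        by (rule runs_seq[OF runs_inc runs_inc])
      then show "runs w (CSeq (CInc d) (CInc d)) (?t, os) 3 (?t(d := s d + ?v), os)"
        by (rule runs_eq) (use v2 dne in \<open>auto simp: fun_eq_iff\<close>)
    next
      assume n2: "\<not> holds w (Reads 2) (?t, os)"
      have "runs w (CIf (Reads 1) (CInc d) CSkip) (?t, os) (1 + 2) (?t(d := s d + ?v), os)"
      proof (rule runs_if)
        assume "holds w (Reads 1) (?t, os)"
        then have v1: "?v = 1" by simp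
        show "runs w (CInc d) (?t, os) 1 (?t(d := s d + ?v), os)"
          by (rule runs_eq[OF runs_inc[of w d ?t os]]) (use v1 dne in \<open>auto simp: fun_eq_iff\<close>)
      next
        assume "\<not> holds w (Reads 1) (?t, os)"
        then have "?v = 0" using n2 word_contents_le[of w "int ?a"] by simp
        then show "runs w CSkip (?t, os) 1 (?t(d := s d + ?v), os)"
          using dne by (intro runs_eq[OF runs_skip[of w "(?t, os)"]]) (auto simp: fun_eq_iff)
      qed
      then show "runs w (CIf (Reads 1) (CInc d) CSkip) (?t, os) 3 (?t(d := s d + ?v), os)"
        by (rule runs_eq) simp_all
    qed
    let ?U = "\<lambda>i. (s(k + 1 := ?a - i, 0 := ?a - i, d := s d + ?v), os)"
    have "runs w (CFor (k + 1) (CDec 0)) (?U 0) (?a * (1 + 3) + 1) (?U ?a)"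
    proof (rule runs_for)
      fix i assume i: "i < ?a"
      let ?s = "s(k + 1 := ?a - Suc i, 0 := ?a - i, d := s d + ?v)"
      have "?s 0 = Suc (?a - Suc i)" using i dne by auto
      from runs_dec[of ?s 0 "?a - Suc i" w os, OF this]
      show "runs w (CDec 0) ((fst (?U i))(k + 1 := ?a - Suc i), snd (?U i)) 1 (?U (Suc i))"
        by (rule runs_eq) (use dne in \<open>auto simp: fun_eq_iff\<close>)
    qed (use dne in auto)
    then have 4: "runs w (CFor (k + 1) (CDec 0)) (?t(d := s d + ?v), os) (?a * 4 + 1) (s(d := s d + ?v), os)"
      by (rule runs_eq) (use z dne in \<open>auto simp: fun_eq_iff\<close>)
    have "runs w (cexp (Sym a) d k) (s, os)
        (poly p B + ((?a * 5 + 1) + ((3 + 2) + (?a * 4 + 1)))) (s(d := s d + ?v), os)"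
      unfolding cexp.simps by (intro runs_seq[OF 1] runs_seq[OF 2] runs_seq[OF 3] 4)
    then show "runs w (cexp (Sym a) d k) (s, os) (poly (p + smult 9 va + [:7:]) B)
        (s(d := s d + eval w s (Sym a)), os)"
      by (rule runs_eq) (use a in auto)
  qed
qed

section \<open>Halving and binary output\<close>

definition chalve :: "nat \<Rightarrow> com" where
  "chalve k = CFor k (CIf (IsZero k) (CInc (k + 2)) (CSeq (CDec k) (CInc (k + 1))))"

text \<open>Each round takes two units from \<open>k\<close> and credits one to
  \<open>k + 1\<close>; a single unit left at the end goes to \<open>k + 2\<close> as the
  remainder.\<close>

lemma runs_halve:
  "s k = n \<Longrightarrow> runs w (chalve k) (s, os) (n * 8 + 1)
     (s(k := 0, k + 1 := s (k + 1) + n div 2, k + 2 := s (k + 2) + n mod 2), os)"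
proof (induction n arbitrary: s rule: less_induct)
  case (less n)
  let ?body = "CSeq (CDec k) (CIf (IsZero k) (CInc (k + 2)) (CSeq (CDec k) (CInc (k + 1))))"
  consider "n = 0" | "n = 1" | m where "n = Suc (Suc m)" by (metis One_nat_def not0_implies_Suc)
  then show ?case
  proof cases
    case 1
    have "runs w (chalve k) (s, os) 1 (s, os)"
      unfolding chalve_def CFor_def using less 1 by (intro runs_until_done) simp
    then show ?thesis by (rule runs_eq) (use less 1 in \<open>auto simp: fun_eq_iff\<close>)
  next
    case 2
    let ?s = "s(k := 0)"
    have sk: "s k = Suc 0" using less 2 by simp
    have "runs w (CIf (IsZero k) (CInc (k + 2)) (CSeq (CDec k) (CInc (k + 1)))) (?s, os) (1 + 2)
        (?s(k + 2 := Suc (?s (k + 2))), os)"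
    proof (rule runs_if)
      show "runs w (CInc (k + 2)) (?s, os) 1 (?s(k + 2 := Suc (?s (k + 2))), os)" by (rule runs_inc)
    qed simp
    then have "runs w ?body (s, os) (1 + (1 + 2)) (?s(k + 2 := Suc (?s (k + 2))), os)"
      by (rule runs_seq[OF runs_dec[of s k 0, OF sk]])
    moreover have "runs w (chalve k) (?s(k + 2 := Suc (?s (k + 2))), os) 1 (?s(k + 2 := Suc (?s (k + 2))), os)"
      unfolding chalve_def CFor_def by (intro runs_until_done) simp
    ultimately have "runs w (chalve k) (s, os) (1 + (1 + 2) + 1 + 2) (?s(k + 2 := Suc (?s (k + 2))), os)"
      unfolding chalve_def CFor_def using sk by (intro runs_until_step) auto
    then show ?thesis by (rule runs_eq) (use 2 in \<open>auto simp: fun_eq_iff\<close>)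
  next
    case (3 m)
    let ?s = "s(k := Suc m)"
    let ?u = "s(k := m, k + 1 := Suc (s (k + 1)))"
    have sk: "s k = Suc (Suc m)" using less 3 by simp
    have "runs w (CSeq (CDec k) (CInc (k + 1))) (?s, os) (1 + 1)
        ((?s(k := m))(k + 1 := Suc ((?s(k := m)) (k + 1))), os)"
      by (rule runs_seq[OF runs_dec[of ?s k m] runs_inc]) simp
    then have b: "runs w (CSeq (CDec k) (CInc (k + 1))) (?s, os) 2 (?u, os)"
      by (rule runs_eq) (auto simp: fun_eq_iff)
    have "runs w (CIf (IsZero k) (CInc (k + 2)) (CSeq (CDec k) (CInc (k + 1)))) (?s, os) (2 + 2) (?u, os)"
      by (rule runs_if) (use b in auto)
    then have body: "runs w ?body (s, os) (1 + (2 + 2)) (?u, os)"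
      by (rule runs_seq[OF runs_dec[of s k "Suc m", OF sk]])
    have "runs w (chalve k) (?u, os) (m * 8 + 1)
        (?u(k := 0, k + 1 := ?u (k + 1) + m div 2, k + 2 := ?u (k + 2) + m mod 2), os)"
      by (rule less.IH) (use 3 in auto)
    with body have "runs w (chalve k) (s, os) (1 + (2 + 2) + (m * 8 + 1) + 2)
        (?u(k := 0, k + 1 := ?u (k + 1) + m div 2, k + 2 := ?u (k + 2) + m mod 2), os)"
      unfolding chalve_def CFor_def using sk by (intro runs_until_step[OF _ body]) auto
    then show ?thesis by (rule runs_eq) (use 3 in \<open>auto simp: fun_eq_iff\<close>)
  qed
qed

definition cbits :: "nat \<Rightarrow> com" where
  "cbits k = CUntil (IsZero k)
     (CSeq (chalve k) (CSeq (COut True)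
       (CSeq (CIf (IsZero (k + 2)) (COut False) (CSeq (COut True) (CDec (k + 2)))) (CFor (k + 1) (CInc k)))))"

lemma runs_bits:
  "s k = n \<Longrightarrow> s (k + 1) = 0 \<Longrightarrow> s (k + 2) = 0 \<Longrightarrow>
   runs w (cbits k) (s, os) (n * (n * 12 + 12) + 1)
     (s(k := 0), os @ concat (map (\<lambda>b. [True, b]) (bits n)))"
proof (induction n arbitrary: s os rule: less_induct)
  case (less n)
  show ?case
  proof (cases "n = 0")
    case True
    have "runs w (cbits k) (s, os) 1 (s, os)"
      unfolding cbits_def using less.prems True by (intro runs_until_done) simp
    then show ?thesis by (rule runs_eq) (use less.prems True in \<open>auto simp: fun_eq_iff bits.simps[of 0]\<close>)
  next
    case False
    let ?s1 = "s(k := 0, k + 1 := n div 2, k + 2 := n mod 2)"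
    let ?s2 = "s(k := 0, k + 1 := n div 2)"
    let ?s3 = "s(k := n div 2)"
    have 1: "runs w (chalve k) (s, os) (n * 8 + 1) (?s1, os)"
      by (rule runs_eq[OF runs_halve[of s k n w os, OF less.prems(1)]]) (use less.prems in \<open>auto simp: fun_eq_iff\<close>)
    have 2: "runs w (CIf (IsZero (k + 2)) (COut False) (CSeq (COut True) (CDec (k + 2))))
        (?s1, os @ [True]) (2 + 2) (?s2, os @ [True, odd n])"
    proof (rule runs_if)
      assume "holds w (IsZero (k + 2)) (?s1, os @ [True])"
      then have "n mod 2 = 0" by simp
      then show "runs w (COut False) (?s1, os @ [True]) 2 (?s2, os @ [True, odd n])"
        by - (rule runs_eq[OF runs_out[of w False ?s1 "os @ [True]"]], use less.prems in \<open>auto simp: fun_eq_iff\<close>)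
    next
      assume "\<not> holds w (IsZero (k + 2)) (?s1, os @ [True])"
      then have odd: "n mod 2 = Suc 0" by (auto simp: mod2_eq_if split: if_splits)
      have "runs w (CSeq (COut True) (CDec (k + 2))) (?s1, os @ [True]) (1 + 1)
          (?s1(k + 2 := 0), (os @ [True]) @ [True])"
        by (rule runs_seq[OF runs_out runs_dec[of ?s1 "k + 2" 0]]) (simp add: odd)
      then show "runs w (CSeq (COut True) (CDec (k + 2))) (?s1, os @ [True]) 2 (?s2, os @ [True, odd n])"
        by (rule runs_eq) (use less.prems odd in \<open>auto simp: fun_eq_iff odd_iff_mod_2_eq_one\<close>)
    qed
    have "runs w (CFor (k + 1) (CInc k)) (?s2, os @ [True, odd n]) (n div 2 * 4 + 1)
        (?s2(k + 1 := 0, k := ?s2 k + n div 2), os @ [True, odd n])"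
      by (rule runs_move) auto
    then have 3: "runs w (CFor (k + 1) (CInc k)) (?s2, os @ [True, odd n]) (n div 2 * 4 + 1)
        (?s3, os @ [True, odd n])"
      by (rule runs_eq) (use less.prems in \<open>auto simp: fun_eq_iff\<close>)
    let ?n = "n div 2"
    have 4: "runs w (cbits k) (?s3, os @ [True, odd n]) (?n * (?n * 12 + 12) + 1)
        (?s3(k := 0), (os @ [True, odd n]) @ concat (map (\<lambda>b. [True, b]) (bits ?n)))"
      by (rule less.IH) (use less.prems False in auto)
    have body: "runs w (CSeq (chalve k) (CSeq (COut True)
       (CSeq (CIf (IsZero (k + 2)) (COut False) (CSeq (COut True) (CDec (k + 2)))) (CFor (k + 1) (CInc k)))))
       (s, os) (n * 8 + 1 + (1 + ((2 + 2) + (?n * 4 + 1)))) (?s3, os @ [True, odd n])"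
      by (intro runs_seq[OF 1] runs_seq[OF runs_out] runs_seq[OF 2] 3)
    have "runs w (cbits k) (s, os) ((n * 8 + 1 + (1 + ((2 + 2) + (?n * 4 + 1)))) + (?n * (?n * 12 + 12) + 1) + 2)
        (?s3(k := 0), (os @ [True, odd n]) @ concat (map (\<lambda>b. [True, b]) (bits ?n)))"
      unfolding cbits_def
      by (rule runs_until_step[OF _ body 4[unfolded cbits_def]]) (use less.prems False in simp)
    moreover have "(n * 8 + 1 + (1 + ((2 + 2) + (?n * 4 + 1)))) + (?n * (?n * 12 + 12) + 1) + 2
        \<le> n * (n * 12 + 12) + 1"
    proof -
      obtain m where m: "n = Suc m" using False not0_implies_Suc by blast
      \<comment> \<open>The quadratic bound is generous: a digit costs linear time, and for the
        remaining digits it is enough that halving a positive number decreases it by at least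
        1.\<close>
      have "?n \<le> m" using m by simp
      then have "?n * (?n * 12 + 12) \<le> m * (m * 12 + 12)" by (intro mult_le_mono) auto
      moreover have "n * 8 + ?n * 4 + 10 + m * (m * 12 + 12) \<le> n * (n * 12 + 12) + 1"
        using \<open>?n \<le> m\<close> by (simp add: m algebra_simps)
      ultimately show ?thesis by linarith
    qed
    ultimately show ?thesis
      by (elim runs_eq) (use False in \<open>auto simp: fun_eq_iff bits.simps[of n]\<close>)
  qed
qed

text \<open>A loop occupies two registers, its variable \<open>k\<close> and the number
  \<open>k + 1\<close> of rounds left, which is why \<open>scoped\<close> advances by 2. The closing
  \<open>CFor k CSkip\<close> resets the variable to 0.\<close>

fun cgen :: "gen \<Rightarrow> nat \<Rightarrow> com" where
  "cgen (Put bs) k = foldr (\<lambda>b. CSeq (COut b)) bs CSkip"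
| "cgen (PutNat a) k = CSeq (cexp a k (k + 1)) (CSeq (cbits k) (COut False))"
| "cgen (Then g h) k = CSeq (cgen g k) (cgen h k)"
| "cgen (Each x a g) k =
     CSeq (cexp a (k + 1) (k + 2))
       (CSeq (CFor (k + 1) (CSeq (cgen g (k + 2)) (CInc k))) (CFor k CSkip))"

lemma runs_put: "runs w (foldr (\<lambda>b. CSeq (COut b)) bs CSkip) (s, os) (length bs) (s, os @ bs)"
proof (induction bs arbitrary: os)
  case Nil
  then show ?case using runs_skip by simp
next
  case (Cons b bs)
  have "runs w (CSeq (COut b) (foldr (\<lambda>b. CSeq (COut b)) bs CSkip)) (s, os) (1 + length bs) (s, (os @ [b]) @ bs)"
    by (rule runs_seq[OF runs_out Cons.IH])
  then show ?case by simp
qed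

lemma calm_subset: "calm w s D k B \<Longrightarrow> D' \<subseteq> D \<Longrightarrow> k \<le> k' \<Longrightarrow> calm w s D' k' B"
  unfolding calm_def by auto

lemma cgen_runs:
  assumes "scoped D k g" "D \<subseteq> {1..<k}" "0 < k"
  shows "\<exists>p :: nat poly. \<forall>w s os B. calm w s D k B \<longrightarrow>
    runs w (cgen g k) (s, os) (poly p B) (s, os @ den w s g)"
  using assms
proof (induction g arbitrary: D k)
  case (Put bs)
  show ?case
  proof (rule exI[of _ "[:length bs:]"], intro allI impI)
    fix w s os B
    show "runs w (cgen (Put bs) k) (s, os) (poly [:length bs:] B) (s, os @ den w s (Put bs))"
      unfolding cgen.simps by (rule runs_eq[OF runs_put]) auto
  qed
next
  case (PutNat a)
  have v: "vars a \<subseteq> {1..<k + 1}" "k \<notin> vars a" "0 < k" "k < k + 1" using PutNat.prems by auto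
  obtain p :: "nat poly" where p: "\<And>w s os B. calm w s (vars a) (k + 1) B \<Longrightarrow>
      runs w (cexp a k (k + 1)) (s, os) (poly p B) (s(k := s k + eval w s a), os)"
    using cexp_runs[OF v] by blast
  obtain q :: "nat poly" where q: "\<And>w s k B. calm w s (vars a) k B \<Longrightarrow> eval w s a \<le> poly q B"
    using eval_poly_bound[of a] by blast
  show ?case
  proof (rule exI[of _ "p + q * (smult 12 q + [:12:]) + [:2:]"], intro allI impI)
    fix w s B and os :: "bool list" assume c: "calm w s D k B"
    let ?n = "eval w s a"
    have c': "calm w s (vars a) (k + 1) B" using c PutNat.prems by (auto intro: calm_subset)
    have z: "s k = 0" "s (k + 1) = 0" "s (k + 2) = 0" using c by (auto simp: calm_def)
    have 1: "runs w (cexp a k (k + 1)) (s, os) (poly p B) (s(k := ?n), os)"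
      by (rule runs_eq[OF p[OF c']]) (use z in auto)
    have 2: "runs w (cbits k) (s(k := ?n), os) (?n * (?n * 12 + 12) + 1)
        (s, os @ concat (map (\<lambda>b. [True, b]) (bits ?n)))"
      by (rule runs_eq[OF runs_bits[of "s(k := ?n)" k ?n]]) (use z in \<open>auto simp: fun_eq_iff\<close>)
    have "runs w (cgen (PutNat a) k) (s, os) (poly p B + ((?n * (?n * 12 + 12) + 1) + 1))
        (s, (os @ concat (map (\<lambda>b. [True, b]) (bits ?n))) @ [False])"
      unfolding cgen.simps by (intro runs_seq[OF 1] runs_seq[OF 2] runs_out)
    moreover have "?n * (?n * 12 + 12) \<le> poly q B * (poly q B * 12 + 12)"
      using q[OF c'] by (intro mult_le_mono) auto
    ultimately show "runs w (cgen (PutNat a) k) (s, os) (poly (p + q * (smult 12 q + [:12:]) + [:2:]) B)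
        (s, os @ den w s (PutNat a))"
      by (elim runs_eq) (auto simp: enc_nat_def algebra_simps)
  qed
next
  case (Then g h)
  obtain p :: "nat poly" where p: "\<And>w s os B. calm w s D k B \<Longrightarrow>
      runs w (cgen g k) (s, os) (poly p B) (s, os @ den w s g)"
    using Then.IH(1)[of D k] Then.prems by auto
  obtain q :: "nat poly" where q: "\<And>w s os B. calm w s D k B \<Longrightarrow>
      runs w (cgen h k) (s, os) (poly q B) (s, os @ den w s h)"
    using Then.IH(2)[of D k] Then.prems by auto
  show ?case
  proof (rule exI[of _ "p + q"], intro allI impI)
    fix w s B and os :: "bool list" assume c: "calm w s D k B"
    show "runs w (cgen (Then g h) k) (s, os) (poly (p + q) B) (s, os @ den w s (Then g h))"
      using runs_seq[OF p[OF c, of os] q[OF c, of "os @ den w s g"]] by simp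
  qed
next
  case (Each x a g)
  have sc: "x = k" "vars a \<subseteq> D" "scoped (insert k D) (k + 2) g" using Each.prems by auto
  have v: "vars a \<subseteq> {1..<k + 2}" "k + 1 \<notin> vars a" "0 < k + 1" "k + 1 < k + 2"
    using Each.prems sc by auto
  obtain p :: "nat poly" where p: "\<And>w s os B. calm w s (vars a) (k + 2) B \<Longrightarrow>
      runs w (cexp a (k + 1) (k + 2)) (s, os) (poly p B) (s(k + 1 := s (k + 1) + eval w s a), os)"
    using cexp_runs[OF v] by blast
  obtain q :: "nat poly" where q: "\<And>w s k B. calm w s (vars a) k B \<Longrightarrow> eval w s a \<le> poly q B"
    using eval_poly_bound[of a] by blast
  have D: "insert k D \<subseteq> {1..<k + 2}" "0 < k + 2" using Each.prems by auto
  obtain b :: "nat poly" where b: "\<And>w s os B. calm w s (insert k D) (k + 2) B \<Longrightarrow>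
      runs w (cgen g (k + 2)) (s, os) (poly b B) (s, os @ den w s g)"
    using Each.IH[OF sc(3) D] by blast
  show ?case
  \<comment> \<open>Inside the body the new loop variable stays below \<open>poly q B\<close>, so
    the body is run under the larger bound \<open>poly q B + B\<close>; composition of polynomials
    accounts for this.\<close>
  proof (rule exI[of _ "p + q * (pcompose b (q + [:0, 1:]) + [:4:]) + smult 3 q + [:2:]"], intro allI impI)
    fix w s B and os :: "bool list" assume c: "calm w s D k B"
    let ?n = "eval w s a"
    have c': "calm w s (vars a) (k + 2) B" using c sc by (auto intro: calm_subset)
    have n: "?n \<le> poly q B" using q[OF c'] .
    have z: "s k = 0" "s (k + 1) = 0" using c by (auto simp: calm_def)
    have kD: "k \<notin> D" "k + 1 \<notin> D" using Each.prems by auto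
    have 1: "runs w (cexp a (k + 1) (k + 2)) (s, os) (poly p B) (s(k + 1 := ?n), os)"
      by (rule runs_eq[OF p[OF c']]) (use z in auto)
    let ?o = "\<lambda>i. os @ concat (map (\<lambda>j. den w (s(x := j)) g) [0..<i])"
    let ?S = "\<lambda>i. (s(k := i, k + 1 := ?n - i), ?o i)"
    let ?t = "poly (pcompose b (q + [:0, 1:])) B"
    have "runs w (CFor (k + 1) (CSeq (cgen g (k + 2)) (CInc k))) (?S 0) (?n * ((?t + 1) + 3) + 1) (?S ?n)"
    proof (rule runs_for)
      fix i assume i: "i < ?n"
      let ?s = "s(k := i, k + 1 := ?n - Suc i)"
      have "calm w ?s (insert k D) (k + 2) (poly q B + B)"
        using c n i Each.prems unfolding calm_def by (auto intro: le_trans trans_le_add2)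
      from b[OF this, of "?o i"]
      have "runs w (cgen g (k + 2)) (?s, ?o i) ?t (?s, ?o i @ den w ?s g)"
        by (rule runs_eq) (auto simp: poly_pcompose)
      from runs_seq[OF this runs_inc]
      have "runs w (CSeq (cgen g (k + 2)) (CInc k)) (?s, ?o i) (?t + 1) (?s(k := Suc (?s k)), ?o i @ den w ?s g)" .
      moreover have "den w ?s g = den w (s(x := i)) g"
        using kD sc(1) by (intro den_cong[OF sc(3)]) auto
      ultimately show "runs w (CSeq (cgen g (k + 2)) (CInc k)) ((fst (?S i))(k + 1 := ?n - Suc i), snd (?S i)) (?t + 1) (?S (Suc i))"
        by (elim runs_eq) (auto simp: fun_eq_iff)
    qed auto
    then have 2: "runs w (CFor (k + 1) (CSeq (cgen g (k + 2)) (CInc k))) (s(k + 1 := ?n), os)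
        (?n * (?t + 4) + 1) (s(k := ?n), ?o ?n)"
      by (rule runs_eq) (use z in \<open>auto simp: fun_eq_iff\<close>)
    let ?Q = "\<lambda>i. (s(k := ?n - i), ?o ?n)"
    have "runs w (CFor k CSkip) (?Q 0) (?n * (0 + 3) + 1) (?Q ?n)"
    proof (rule runs_for)
      fix i
      show "runs w CSkip ((fst (?Q i))(k := ?n - Suc i), snd (?Q i)) 0 (?Q (Suc i))"
        by (rule runs_eq[OF runs_skip]) (auto simp: fun_eq_iff)
    qed auto
    then have 3: "runs w (CFor k CSkip) (s(k := ?n), ?o ?n) (?n * 3 + 1) (s, ?o ?n)"
      by (rule runs_eq) (use z in \<open>auto simp: fun_eq_iff\<close>)
    have "runs w (cgen (Each x a g) k) (s, os) (poly p B + ((?n * (?t + 4) + 1) + (?n * 3 + 1))) (s, ?o ?n)"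
      unfolding cgen.simps by (intro runs_seq[OF 1] runs_seq[OF 2] 3)
    moreover have "?n * (?t + 4) \<le> poly q B * (?t + 4)" using n by (rule mult_le_mono1)
    ultimately show "runs w (cgen (Each x a g) k) (s, os)
        (poly (p + q * (pcompose b (q + [:0, 1:]) + [:4:]) + smult 3 q + [:2:]) B) (s, os @ den w s (Each x a g))"
      by (elim runs_eq) (use n in \<open>auto simp: mult.commute[of _ 3] intro!: add_mono mult_le_mono\<close>)
  qed
qed

section \<open>Finitely many registers suffice\<close>

lemma uses_for: "uses R (CFor r c) \<longleftrightarrow> 0 < r \<and> r \<le> R \<and> uses R c"
  by (auto simp: CFor_def)

lemma uses_num: "d \<le> R \<Longrightarrow> uses R (((\<lambda>c. CSeq (CInc d) c) ^^ n) CSkip)"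
  by (induction n) auto

lemma cexp_uses:
  assumes "vars a \<subseteq> {1..<k}" "0 < d" "d < k"
  shows "\<exists>R\<ge>k + 1. uses R (cexp a d k)"
  using assms
proof (induction a arbitrary: d k)
  case (Num n)
  then show ?case by (auto intro!: exI[of _ "k + 1"] uses_num)
next
  case (Var x)
  then show ?case by (auto intro!: exI[of _ "k + 1"] simp: uses_for)
next
  case (Plus a b)
  obtain R R' where "R \<ge> k + 1" "uses R (cexp a d k)" "uses R' (cexp b d k)"
    using Plus.IH(1)[of k d] Plus.IH(2)[of k d] Plus.prems by auto
  then show ?case by (intro exI[of _ "max R R'"]) (auto intro: uses_mono)
next
  case (Minus a b)
  have "vars a \<subseteq> {1..<k + 2}" "vars b \<subseteq> {1..<k + 2}" using Minus.prems by auto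
  then obtain R R' where "R \<ge> k + 2 + 1" "uses R (cexp a k (k + 2))" "uses R' (cexp b (k + 1) (k + 2))"
    using Minus.IH(1)[of "k + 2" k] Minus.IH(2)[of "k + 2" "k + 1"] Minus.prems by auto
  then show ?case using Minus.prems
    by (intro exI[of _ "max R R'"]) (auto intro: uses_mono simp: uses_for)
next
  case (Times a b)
  have "vars a \<subseteq> {1..<k + 1}" "vars b \<subseteq> {1..<k + 1}" using Times.prems by auto
  then obtain R R' where "R \<ge> k + 1 + 1" "uses R (cexp a k (k + 1))" "uses R' (cexp b d (k + 1))"
    using Times.IH(1)[of "k + 1" k] Times.IH(2)[of "k + 1" d] Times.prems by auto
  then show ?case using Times.prems
    by (intro exI[of _ "max R R'"]) (auto intro: uses_mono simp: uses_for)
next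
  case (Sym a)
  have "vars a \<subseteq> {1..<k + 2}" using Sym.prems by auto
  then obtain R where "R \<ge> k + 2 + 1" "uses R (cexp a k (k + 2))"
    using Sym.IH[of "k + 2" k] Sym.prems by auto
  then show ?case using Sym.prems by (intro exI[of _ R]) (auto simp: uses_for)
qed

lemma cgen_uses:
  assumes "scoped D k g" "D \<subseteq> {1..<k}" "0 < k"
  shows "\<exists>R\<ge>k. uses R (cgen g k)"
  using assms
proof (induction g arbitrary: D k)
  case (Put bs)
  have "uses k (foldr (\<lambda>b. CSeq (COut b)) bs CSkip)" by (induction bs) auto
  then show ?case by auto
next
  case (PutNat a)
  then have "vars a \<subseteq> {1..<k + 1}" by auto
  then obtain R where "R \<ge> k + 2" "uses R (cexp a k (k + 1))"
    using cexp_uses[of a "k + 1" k] PutNat.prems by auto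
  then show ?case using PutNat.prems
    by (intro exI[of _ R]) (auto simp: uses_for cbits_def chalve_def)
next
  case (Then g h)
  obtain R R' where "R \<ge> k" "uses R (cgen g k)" "uses R' (cgen h k)"
    using Then.IH(1)[of D k] Then.IH(2)[of D k] Then.prems by auto
  then show ?case by (intro exI[of _ "max R R'"]) (auto intro: uses_mono)
next
  case (Each x a g)
  have v: "vars a \<subseteq> {1..<k + 2}" "insert k D \<subseteq> {1..<k + 2}" using Each.prems by auto
  obtain R where R: "R \<ge> k + 3" "uses R (cexp a (k + 1) (k + 2))"
    using cexp_uses[OF v(1), of "k + 1"] by (auto simp: numeral_3_eq_3)
  obtain R' where "uses R' (cgen g (k + 2))" using Each.IH[of "insert k D" "k + 2"] Each.prems v by auto
  then show ?case using R Each.prems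
    by (intro exI[of _ "max R R'"]) (auto intro: uses_mono simp: uses_for)
qed

section \<open>Measuring the input length\<close>

definition cmeasure :: com where
  "cmeasure = CSeq (CUntil (Reads 0) (CSeq (CInc 0) (CInc 1)))
     (CSeq (CFor 1 (CSeq (CInc 2) (CDec 0))) (CFor 2 (CInc 1)))"

text \<open>The letters of a word are never blank, so the first blank is at position
  \<open>length w\<close>. Walking the head back uses up the count, which register 2 saves
  meanwhile.\<close>

lemma runs_measure:
  "runs w cmeasure (\<lambda>_. 0, []) (length w * 13 + 3) ((\<lambda>_. 0)(1 := length w), [])"
proof -
  let ?n = "length w"
  have fwd: "runs w (CUntil (Reads 0) (CSeq (CInc 0) (CInc 1))) ((\<lambda>_. 0)(0 := i, 1 := i), os)
      ((?n - i) * 4 + 1) ((\<lambda>_. 0)(0 := ?n, 1 := ?n), os)" if "i \<le> ?n" for i os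
    using that
  proof (induction "?n - i" arbitrary: i)
    case 0
    then have i: "i = ?n" by simp
    have "runs w (CUntil (Reads 0) (CSeq (CInc 0) (CInc 1))) ((\<lambda>_. 0)(0 := i, 1 := i), os) 1
        ((\<lambda>_. 0)(0 := i, 1 := i), os)"
      by (rule runs_until_done) (simp add: i word_contents_def)
    then show ?case unfolding i by (rule runs_eq) auto
  next
    case (Suc m)
    then have lt: "i < ?n" by simp
    let ?s = "(\<lambda>_ :: nat. 0 :: nat)(0 := i, 1 := i)"
    have "runs w (CSeq (CInc 0) (CInc 1)) (?s, os) (1 + 1)
        ((?s(0 := Suc (?s 0)))(1 := Suc ((?s(0 := Suc (?s 0))) 1)), os)"
      by (rule runs_seq[OF runs_inc[of w 0 ?s os] runs_inc[of w 1 "?s(0 := Suc (?s 0))" os]])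
    then have body: "runs w (CSeq (CInc 0) (CInc 1)) (?s, os) 2 ((\<lambda>_. 0)(0 := Suc i, 1 := Suc i), os)"
      by (rule runs_eq) (auto simp: fun_eq_iff)
    have rest: "runs w (CUntil (Reads 0) (CSeq (CInc 0) (CInc 1))) ((\<lambda>_. 0)(0 := Suc i, 1 := Suc i), os)
        ((?n - Suc i) * 4 + 1) ((\<lambda>_. 0)(0 := ?n, 1 := ?n), os)"
      using Suc.hyps(1)[of "Suc i"] Suc.hyps(2) lt by simp
    have "runs w (CUntil (Reads 0) (CSeq (CInc 0) (CInc 1))) (?s, os)
        (2 + ((?n - Suc i) * 4 + 1) + 2) ((\<lambda>_. 0)(0 := ?n, 1 := ?n), os)"
      by (rule runs_until_step[OF _ body rest]) (use lt in \<open>simp add: word_contents_def\<close>)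
    then show ?case by (rule runs_eq) (use lt in auto)
  qed
  have 1: "runs w (CUntil (Reads 0) (CSeq (CInc 0) (CInc 1))) (\<lambda>_. 0, []) (?n * 4 + 1)
      ((\<lambda>_. 0)(0 := ?n, 1 := ?n), [])"
    by (rule runs_eq[OF fwd[of 0]]) (auto simp: fun_eq_iff)
  let ?S = "\<lambda>i. ((\<lambda>_. 0)(0 := ?n - i, 1 := ?n - i, 2 := i), [] :: bool list)"
  have "runs w (CFor 1 (CSeq (CInc 2) (CDec 0))) (?S 0) (?n * (2 + 3) + 1) (?S ?n)"
  proof (rule runs_for)
    fix i assume i: "i < ?n"
    let ?s = "(\<lambda>_ :: nat. 0 :: nat)(0 := ?n - i, 1 := ?n - Suc i, 2 := i)"
    let ?u = "?s(2 := Suc (?s 2))"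
    have "?u 0 = Suc (?n - Suc i)" using i by auto
    from runs_seq[OF runs_inc[of w 2 ?s "[]"] runs_dec[of ?u 0 "?n - Suc i", OF this]]
    show "runs w (CSeq (CInc 2) (CDec 0)) ((fst (?S i))(1 := ?n - Suc i), snd (?S i)) 2 (?S (Suc i))"
      by (rule runs_eq) (auto simp: fun_eq_iff)
  qed auto
  then have 2: "runs w (CFor 1 (CSeq (CInc 2) (CDec 0))) ((\<lambda>_. 0)(0 := ?n, 1 := ?n), []) (?n * 5 + 1)
      ((\<lambda>_. 0)(2 := ?n), [])"
    by (rule runs_eq) (auto simp: fun_eq_iff)
  have "runs w (CFor 2 (CInc 1)) ((\<lambda>_. 0)(2 := ?n), []) (?n * 4 + 1)
      (((\<lambda>_. 0)(2 := ?n))(2 := 0, 1 := ((\<lambda>_ :: nat. 0)(2 := ?n)) 1 + ?n), [])"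
    by (rule runs_move) auto
  then have 3: "runs w (CFor 2 (CInc 1)) ((\<lambda>_. 0)(2 := ?n), []) (?n * 4 + 1) ((\<lambda>_. 0)(1 := ?n), [])"
    by (rule runs_eq) (auto simp: fun_eq_iff)
  have "runs w cmeasure (\<lambda>_. 0, []) ((?n * 4 + 1) + ((?n * 5 + 1) + (?n * 4 + 1))) ((\<lambda>_. 0)(1 := ?n), [])"
    unfolding cmeasure_def by (intro runs_seq[OF 1] runs_seq[OF 2] 3)
  then show ?thesis by (rule runs_eq) auto
qed

theorem generator_poly_time:
  assumes "scoped {1} 2 g"
  shows "poly_time_computable (\<lambda>w. den w ((\<lambda>_. 0)(1 := length w)) g)"
proof -
  obtain p :: "nat poly" where p: "\<And>w s os B. calm w s {1} 2 B \<Longrightarrow>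
      runs w (cgen g 2) (s, os) (poly p B) (s, os @ den w s g)"
    using cgen_runs[OF assms] by auto
  obtain R where R: "R \<ge> 2" "uses R (cgen g 2)" using cgen_uses[OF assms] by auto
  show ?thesis
  proof (rule program_computes)
    show "uses R (CSeq cmeasure (cgen g 2))" using R by (auto simp: cmeasure_def uses_for)
    fix w :: "bool list"
    let ?s = "(\<lambda>_ :: nat. 0 :: nat)(1 := length w)"
    have "calm w ?s {1} 2 (length w)" by (auto simp: calm_def)
    from runs_seq[OF runs_measure p[OF this, of "[]"]]
    have "runs w (CSeq cmeasure (cgen g 2)) (\<lambda>_. 0, []) (length w * 13 + 3 + poly p (length w)) (?s, den w ?s g)"
      by simp
    then show "\<exists>n s. n \<le> poly ([:3, 13:] + p) (length w) \<and>
        exec w (CSeq cmeasure (cgen g 2)) (\<lambda>_. 0, []) n (s, den w ?s g)"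
      unfolding runs_def by (auto simp: algebra_simps)
  qed
qed

section \<open>Uniform clause families\<close>

text \<open>
  A template is a guard and a list of literals (sign, kind, time, position). It stands for the
  clauses obtained by letting the variables 4, 6 and 8 range over the numbers below the size; the
  guard and the coordinates are arithmetic expressions, so that a loop program can print the
  clauses.
\<close>

type_synonym 'k clause = "aexp \<times> (bool \<times> 'k \<times> aexp \<times> aexp) list"

text \<open>The numbers match the registers of the printing loops: 1 holds the input length, 2 the
  index of the family, 4, 6, 8 the template variables and 10 the literal; the odd registers in
  between are round counters.\<close>

definition env :: "bool list \<Rightarrow> nat \<Rightarrow> nat \<Rightarrow> nat \<Rightarrow> nat \<Rightarrow> nat" where
  "env w t i j = (\<lambda>_. 0)(1 := length w, 4 := t, 6 := i, 8 := j)"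

definition clause_holds :: "bool list \<Rightarrow> ('k \<Rightarrow> nat \<Rightarrow> nat \<Rightarrow> bool) \<Rightarrow> 'k clause \<Rightarrow> nat \<Rightarrow> nat \<Rightarrow> nat \<Rightarrow> bool" where
  "clause_holds w A c t i j \<longleftrightarrow> (eval w (env w t i j) (fst c) \<noteq> 0 \<longrightarrow>
     (\<exists>(b, k, x, y)\<in>set (snd c). A k (eval w (env w t i j) x) (eval w (env w t i j) y) = b))"

definition models :: "bool list \<Rightarrow> nat \<Rightarrow> ('k \<Rightarrow> nat \<Rightarrow> nat \<Rightarrow> bool) \<Rightarrow> 'k clause list \<Rightarrow> bool" where
  "models w S A cs \<longleftrightarrow> (\<forall>c\<in>set cs. \<forall>t<S. \<forall>i<S. \<forall>j<S. clause_holds w A c t i j)"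

text \<open>Coordinates have to be in range only where the guard is nonzero, so a guard may cut off
  instances that would leave the tableau.\<close>

definition clause_wf :: "aexp \<Rightarrow> 'k clause \<Rightarrow> bool" where
  "clause_wf a c \<longleftrightarrow> vars (fst c) \<subseteq> {1, 4, 6, 8} \<and>
     (\<forall>(b, k, x, y)\<in>set (snd c). vars x \<subseteq> {1, 4, 6, 8} \<and> vars y \<subseteq> {1, 4, 6, 8} \<and>
       (\<forall>w t i j. let S = eval w (env w t i j) a in
          t < S \<longrightarrow> i < S \<longrightarrow> j < S \<longrightarrow> eval w (env w t i j) (fst c) \<noteq> 0 \<longrightarrow>
          eval w (env w t i j) x < S \<and> eval w (env w t i j) y < S))"

text \<open>Truncated subtraction turns comparisons into the numbers 0 and 1, and products of these
  serve as conjunctions.\<close>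

definition Eq :: "aexp \<Rightarrow> aexp \<Rightarrow> aexp" where
  "Eq a b = Minus (Num 1) (Plus (Minus a b) (Minus b a))"

definition Less :: "aexp \<Rightarrow> aexp \<Rightarrow> aexp" where
  "Less a b = Minus (Num 1) (Minus (Plus a (Num 1)) b)"

definition Neq :: "aexp \<Rightarrow> aexp \<Rightarrow> aexp" where
  "Neq a b = Minus (Num 1) (Eq a b)"

definition Poly :: "nat poly \<Rightarrow> aexp" where
  "Poly p = foldr (\<lambda>c a. Plus (Num c) (Times (Var 1) a)) (coeffs p) (Num 0)"

lemma eval_Eq [simp]: "eval w s (Eq a b) = (if eval w s a = eval w s b then 1 else 0)"
  by (auto simp: Eq_def)

lemma eval_Less [simp]: "eval w s (Less a b) = (if eval w s a < eval w s b then 1 else 0)"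
  by (auto simp: Less_def)

lemma eval_Neq [simp]: "eval w s (Neq a b) = (if eval w s a = eval w s b then 0 else 1)"
  by (auto simp: Neq_def)

lemma vars_Eq [simp]: "vars (Eq a b) = vars a \<union> vars b"
  by (auto simp: Eq_def)

lemma vars_Neq [simp]: "vars (Neq a b) = vars a \<union> vars b"
  by (auto simp: Neq_def)

lemma vars_Less [simp]: "vars (Less a b) = vars a \<union> vars b"
  by (auto simp: Less_def)

lemma eval_Poly [simp]: "eval w s (Poly p) = poly p (s 1)"
proof -
  have "eval w s (foldr (\<lambda>c a. Plus (Num c) (Times (Var 1) a)) cs (Num 0)) = horner_sum id (s 1) cs" for cs
    by (induction cs) auto
  then show ?thesis by (simp add: Poly_def poly_def)
qed

lemma vars_Poly: "vars (Poly p) \<subseteq> {1}"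
proof -
  have "vars (foldr (\<lambda>c a. Plus (Num c) (Times (Var 1) a)) cs (Num 0)) \<subseteq> {1}" for cs
    by (induction cs) auto
  then show ?thesis by (simp add: Poly_def)
qed

section \<open>Cook--Levin\<close>

type_synonym transition = "nat \<times> nat list \<times> nat \<times> (nat \<times> move) list"

text \<open>\<open>Rd h s\<close> records the symbol scanned on tape \<open>h\<close> without the
  head position. A condition on all tapes at once, such as that a transition does not apply, would
  otherwise need one position variable per tape, while a template has three variables in
  total.\<close>

datatype kind = St nat | Rd nat nat | Tr transition | Stop | Hd nat | Ce nat nat

fun shift :: "move \<Rightarrow> nat" where
  "shift Move_Left = 0" | "shift Move_None = 1" | "shift Move_Right = 2"

lemma offset_shift: "offset m = int (shift m) - 1"
  by (cases m) auto

locale tableau =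
  fixes M :: turing_machine and p :: "nat poly"
  assumes wf: "wf_machine M" and time: "runs_in_time M (poly p)"
begin

definition tapes :: nat where "tapes = num_tapes M"
definition trs :: "transition list" where "trs = (SOME l. set l = transitions M)"
definition states :: "nat list" where
  "states = start_state M # accept_state M # map (\<lambda>(q, rs, q', as). q') trs"
definition symbols :: "nat list" where
  "symbols = [0, 1, 2] @ concat (map (\<lambda>(q, rs, q', as). map fst as) trs)"

definition tm :: "bool list \<Rightarrow> nat" where "tm w = poly p (length w)"
text \<open>A head that starts at \<open>mid w\<close> is at one of the positions \<open>1\<close>
  to \<open>2 * tm w + 1\<close> up to time \<open>tm w\<close>, so one further move still stays
  below \<open>size w\<close>.\<close>

definition mid :: "bool list \<Rightarrow> nat" where "mid w = tm w + 1"
definition size :: "bool list \<Rightarrow> nat" where "size w = 2 * tm w + 3"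
definition Mid :: aexp where "Mid = Plus (Poly p) (Num 1)"
definition Size :: aexp where "Size = Plus (Times (Num 2) (Poly p)) (Num 3)"

abbreviation "vt \<equiv> Var 4"
abbreviation "vi \<equiv> Var 6"
abbreviation "vj \<equiv> Var 8"
abbreviation "z \<equiv> Num 0"
abbreviation "always \<equiv> Num 1"
abbreviation "nxt \<equiv> Plus vt (Num 1)"
abbreviation "early \<equiv> Less nxt Size"

definition c_start :: "kind clause list" where
  "c_start = [(always, [(True, St (start_state M), z, z)])]"
definition c_heads :: "kind clause list" where
  "c_heads = map (\<lambda>h. (always, [(True, Hd h, z, Mid)])) [0..<tapes]"
text \<open>Left of \<open>Mid\<close> the truncated difference is 0 and would read the first
  letter; the first factor makes these cells blank.\<close>

definition Input :: aexp where
  "Input = Times (Less Mid (Plus vi (Num 1))) (Sym (Minus vi Mid))"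
definition c_input :: "kind clause list" where
  "c_input = map (\<lambda>s. (Eq Input (Num s),
     [(True, Ce 0 s, z, vi)])) [0, 1, 2]"
definition c_blank :: "kind clause list" where
  "c_blank = map (\<lambda>h. (always, [(True, Ce h 0, z, vi)])) [1..<tapes]"
definition c_read :: "kind clause list" where
  "c_read = map (\<lambda>(h, s). (always, [(False, Hd h, vt, vi), (False, Ce h s, vt, vi), (True, Rd h s, vt, z)]))
     (List.product [0..<tapes] symbols)"
definition c_choice :: "kind clause list" where
  "c_choice = [(always, (True, Stop, vt, z) # map (\<lambda>d. (True, Tr d, vt, z)) trs)]"
definition c_source :: "kind clause list" where
  "c_source = map (\<lambda>(d, q). (always, [(False, Tr d, vt, z), (False, St q, vt, z)]))
     (filter (\<lambda>(d, q). q \<noteq> fst d) (List.product trs states))"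
definition c_match :: "kind clause list" where
  "c_match = map (\<lambda>(d, h, s). (always, [(False, Tr d, vt, z), (False, Rd h s, vt, z)]))
     (filter (\<lambda>((q, rs, q', as), h, s). s \<noteq> rs ! h) (List.product trs (List.product [0..<tapes] symbols)))"
definition c_target :: "kind clause list" where
  "c_target = map (\<lambda>(q, rs, q', as). (early, [(False, Tr (q, rs, q', as), vt, z), (True, St q', nxt, z)])) trs"
text \<open>\<open>shift\<close> is the offset plus 1, which avoids negative numbers: the new
  position is \<open>vi + shift - 1\<close>, and the guard says that it is neither negative nor
  beyond the tableau.\<close>

definition c_move :: "kind clause list" where
  "c_move = map (\<lambda>((q, rs, q', as), h).
     (Times early (Times (Less z (Plus vi (Num (shift (snd (as ! h))))))
        (Less (Plus vi (Num (shift (snd (as ! h))))) (Plus Size (Num 1)))),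
      [(False, Tr (q, rs, q', as), vt, z), (False, Hd h, vt, vi),
       (True, Hd h, nxt, Minus (Plus vi (Num (shift (snd (as ! h))))) (Num 1))]))
     (List.product trs [0..<tapes])"
definition c_write :: "kind clause list" where
  "c_write = map (\<lambda>((q, rs, q', as), h).
     (early, [(False, Tr (q, rs, q', as), vt, z), (False, Hd h, vt, vi), (True, Ce h (fst (as ! h)), nxt, vi)]))
     (List.product trs [0..<tapes])"
definition c_frame :: "kind clause list" where
  "c_frame = map (\<lambda>(h, s). (Times early (Neq vi vj),
      [(False, Hd h, vt, vj), (False, Ce h s, vt, vi), (True, Ce h s, nxt, vi)]))
     (List.product [0..<tapes] symbols)"
definition c_accept :: "kind clause list" where
  "c_accept = map (\<lambda>q. (always, [(False, Stop, vt, z), (False, St q, vt, z)]))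
     (filter (\<lambda>q. q \<noteq> accept_state M) states)"
definition c_halted :: "kind clause list" where
  "c_halted = map (\<lambda>(q, rs, q', as).
       (always, (False, Stop, vt, z) # map (\<lambda>h. (False, Rd h (rs ! h), vt, z)) [0..<tapes]))
     (filter (\<lambda>d. fst d = accept_state M) trs)"

definition clauses :: "kind clause list" where
  "clauses = c_start @ c_heads @ c_input @ c_blank @ c_read @ c_choice @ c_source @ c_match @
     c_target @ c_move @ c_write @ c_frame @ c_accept @ c_halted"

lemmas clause_defs = c_start_def c_heads_def c_input_def c_blank_def c_read_def c_choice_def
  c_source_def c_match_def c_target_def c_move_def c_write_def c_frame_def c_accept_def c_halted_def

lemma set_trs: "set trs = transitions M"
proof -
  have "finite (transitions M)" using wf by (simp add: wf_machine_def)
  then have "\<exists>l. set l = transitions M" by (rule finite_list)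
  then show ?thesis unfolding trs_def by (rule someI_ex)
qed

lemma tapes_pos: "0 < tapes"
  using wf by (auto simp: tapes_def wf_machine_def)

lemma tr_lengths: "(q, rs, q', as) \<in> transitions M \<Longrightarrow> length rs = tapes \<and> length as = tapes"
  using wf by (auto simp: tapes_def wf_machine_def)

lemma size_pos: "0 < size w" "mid w < size w" "tm w + 1 < size w"
  by (simp_all add: size_def mid_def)

lemma env_simps [simp]:
  "env w t i j 1 = length w" "env w t i j (Suc 0) = length w"
  "env w t i j 4 = t" "env w t i j 6 = i" "env w t i j 8 = j"
  by (simp_all add: env_def)

lemma eval_Size [simp]: "eval w (env w t i j) Size = size w"
  by (simp add: Size_def size_def tm_def)

lemma eval_Mid [simp]: "eval w (env w t i j) Mid = mid w"
  by (simp add: Mid_def mid_def tm_def)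

lemma eval_Input [simp]: "eval w (env w t i j) Input = word_contents w (int i - int (mid w))"
  by (auto simp: Input_def word_contents_def of_nat_diff)

lemma vars_Size: "vars Size \<subseteq> {1}"
  using vars_Poly[of p] by (auto simp: Size_def)

lemma vars_Mid: "vars Mid \<subseteq> {1}"
  using vars_Poly[of p] by (auto simp: Mid_def)

lemma vars_Input: "vars Input \<subseteq> {1, 6}"
  using vars_Mid by (auto simp: Input_def)

lemma clauses_wf: "c \<in> set clauses \<Longrightarrow> clause_wf Size c"
proof -
  have v: "vars Size \<subseteq> {1, 4, 6, 8}" "vars Mid \<subseteq> {1, 4, 6, 8}" using vars_Size vars_Mid by auto
  have "vars Input \<subseteq> {1, 4, 6, 8}" using vars_Input by auto
  note v = v this
  have c: "clause_wf Size (g, ls)" if "vars g \<subseteq> {1, 4, 6, 8}"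
    "\<forall>(b, k, x, y)\<in>set ls. vars x \<subseteq> {1, 4, 6, 8} \<and> vars y \<subseteq> {1, 4, 6, 8}"
    "\<And>w t i j. t < size w \<Longrightarrow> i < size w \<Longrightarrow> j < size w \<Longrightarrow> eval w (env w t i j) g \<noteq> 0 \<Longrightarrow>
       \<forall>(b, k, x, y)\<in>set ls. eval w (env w t i j) x < size w \<and> eval w (env w t i j) y < size w"
    for g and ls :: "(bool \<times> kind \<times> aexp \<times> aexp) list"
    using that unfolding clause_wf_def Let_def by (simp add: case_prod_unfold)
  assume "c \<in> set clauses"
  then consider "c \<in> set c_start" | "c \<in> set c_heads" | "c \<in> set c_input" | "c \<in> set c_blank"
    | "c \<in> set c_read" | "c \<in> set c_choice" | "c \<in> set c_source" | "c \<in> set c_match"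
    | "c \<in> set c_target" | "c \<in> set c_move" | "c \<in> set c_write" | "c \<in> set c_frame"
    | "c \<in> set c_accept" | "c \<in> set c_halted"
    unfolding clauses_def by auto
  then show ?thesis
    by cases (use v size_pos in \<open>auto simp: clause_defs intro!: c split: if_splits\<close>)
qed

lemma ex_below [simp]: "\<exists>i. i < size w"
  using size_pos by blast

lemma models_append: "models w S A (cs @ ds) \<longleftrightarrow> models w S A cs \<and> models w S A ds"
  by (auto simp: models_def)

context
  fixes w :: "bool list" and A :: "kind \<Rightarrow> nat \<Rightarrow> nat \<Rightarrow> bool"
begin

lemma models_start: "models w (size w) A c_start \<longleftrightarrow> A (St (start_state M)) 0 0"
  using size_pos[of w] by (simp add: models_def clause_holds_def clause_defs; fastforce)

lemma models_heads: "models w (size w) A c_heads \<longleftrightarrow> (\<forall>h<tapes. A (Hd h) 0 (mid w))"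
  using size_pos[of w] by (simp add: models_def clause_holds_def clause_defs; fastforce)

lemma models_input: "models w (size w) A c_input \<longleftrightarrow>
    (\<forall>i<size w. A (Ce 0 (word_contents w (int i - int (mid w)))) 0 i)"
proof -
  have "word_contents w x = 0 \<or> word_contents w x = 1 \<or> word_contents w x = 2" for x
    by (auto simp: word_contents_def)
  then have "(\<forall>s\<in>{0, 1, 2}. word_contents w x = s \<longrightarrow> P s) \<longleftrightarrow> P (word_contents w x)" for x P
    by fastforce
  moreover have "models w (size w) A c_input \<longleftrightarrow>
      (\<forall>i<size w. \<forall>s\<in>{0, 1, 2}. word_contents w (int i - int (mid w)) = s \<longrightarrow> A (Ce 0 s) 0 i)"
    using size_pos[of w] by (simp add: models_def clause_holds_def clause_defs; blast)
  ultimately show ?thesis by (simp only:)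
qed

lemma models_blank: "models w (size w) A c_blank \<longleftrightarrow> (\<forall>h<tapes. 0 < h \<longrightarrow> (\<forall>i<size w. A (Ce h 0) 0 i))"
  using size_pos[of w] by (simp add: models_def clause_holds_def clause_defs Suc_le_eq; fastforce)

lemma models_read: "models w (size w) A c_read \<longleftrightarrow> (\<forall>h<tapes. \<forall>s\<in>set symbols. \<forall>t<size w. \<forall>i<size w.
    A (Hd h) t i \<longrightarrow> A (Ce h s) t i \<longrightarrow> A (Rd h s) t 0)"
  using size_pos[of w] by (simp add: models_def clause_holds_def clause_defs ball_simps case_prod_unfold set_trs; fastforce)

lemma models_choice: "models w (size w) A c_choice \<longleftrightarrow>
    (\<forall>t<size w. A Stop t 0 \<or> (\<exists>d\<in>transitions M. A (Tr d) t 0))"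
  using size_pos[of w] by (simp add: models_def clause_holds_def clause_defs ball_simps case_prod_unfold set_trs; fastforce)

lemma models_source: "models w (size w) A c_source \<longleftrightarrow>
    (\<forall>d\<in>transitions M. \<forall>q\<in>set states. q \<noteq> fst d \<longrightarrow> (\<forall>t<size w. A (Tr d) t 0 \<longrightarrow> \<not> A (St q) t 0))"
  using size_pos[of w] by (simp add: models_def clause_holds_def clause_defs ball_simps case_prod_unfold set_trs; fastforce)

lemma models_match: "models w (size w) A c_match \<longleftrightarrow>
    (\<forall>(q, rs, q', as)\<in>transitions M. \<forall>h<tapes. \<forall>s\<in>set symbols. s \<noteq> rs ! h \<longrightarrow>
       (\<forall>t<size w. A (Tr (q, rs, q', as)) t 0 \<longrightarrow> \<not> A (Rd h s) t 0))"
  using size_pos[of w] by (simp add: models_def clause_holds_def clause_defs ball_simps case_prod_unfold set_trs; fastforce)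

lemma models_target: "models w (size w) A c_target \<longleftrightarrow>
    (\<forall>(q, rs, q', as)\<in>transitions M. \<forall>t. t + 1 < size w \<longrightarrow> A (Tr (q, rs, q', as)) t 0 \<longrightarrow> A (St q') (t + 1) 0)"
  using size_pos[of w] by (simp add: models_def clause_holds_def clause_defs ball_simps case_prod_unfold set_trs; fastforce)

lemma models_move: "models w (size w) A c_move \<longleftrightarrow>
    (\<forall>(q, rs, q', as)\<in>transitions M. \<forall>h<tapes. \<forall>t i. t + 1 < size w \<longrightarrow> i < size w \<longrightarrow>
       0 < i + shift (snd (as ! h)) \<longrightarrow> i + shift (snd (as ! h)) < size w + 1 \<longrightarrow>
       A (Tr (q, rs, q', as)) t 0 \<longrightarrow> A (Hd h) t i \<longrightarrow> A (Hd h) (t + 1) (i + shift (snd (as ! h)) - 1))"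
  using size_pos[of w]
  by (simp add: models_def clause_holds_def clause_defs ball_simps case_prod_unfold set_trs del: add_gr_0) (fastforce simp del: add_gr_0)

lemma models_write: "models w (size w) A c_write \<longleftrightarrow>
    (\<forall>(q, rs, q', as)\<in>transitions M. \<forall>h<tapes. \<forall>t i. t + 1 < size w \<longrightarrow> i < size w \<longrightarrow>
       A (Tr (q, rs, q', as)) t 0 \<longrightarrow> A (Hd h) t i \<longrightarrow> A (Ce h (fst (as ! h))) (t + 1) i)"
  using size_pos[of w] by (simp add: models_def clause_holds_def clause_defs ball_simps case_prod_unfold set_trs; fastforce)

lemma models_frame: "models w (size w) A c_frame \<longleftrightarrow>
    (\<forall>h<tapes. \<forall>s\<in>set symbols. \<forall>t i j. t + 1 < size w \<longrightarrow> i < size w \<longrightarrow> j < size w \<longrightarrow> i \<noteq> j \<longrightarrow>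
       A (Hd h) t j \<longrightarrow> A (Ce h s) t i \<longrightarrow> A (Ce h s) (t + 1) i)"
  using size_pos[of w]
  by (simp add: models_def clause_holds_def clause_defs ball_simps case_prod_unfold set_trs; fastforce)

lemma models_accept: "models w (size w) A c_accept \<longleftrightarrow>
    (\<forall>q\<in>set states. q \<noteq> accept_state M \<longrightarrow> (\<forall>t<size w. A Stop t 0 \<longrightarrow> \<not> A (St q) t 0))"
  using size_pos[of w] by (simp add: models_def clause_holds_def clause_defs ball_simps case_prod_unfold set_trs; fastforce)

lemma models_halted: "models w (size w) A c_halted \<longleftrightarrow>
    (\<forall>(q, rs, q', as)\<in>transitions M. q = accept_state M \<longrightarrow>
      (\<forall>t<size w. A Stop t 0 \<longrightarrow> (\<exists>h<tapes. \<not> A (Rd h (rs ! h)) t 0)))"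
  using size_pos[of w] by (simp add: models_def clause_holds_def clause_defs ball_simps case_prod_unfold set_trs; fastforce)

end

lemmas models_iff = clauses_def models_append models_start models_heads models_input models_blank models_read models_choice
  models_source models_match models_target models_move models_write models_frame models_accept models_halted

end

section \<open>Models of the clauses are accepting runs\<close>

context tableau begin

lemma models_parts:
  assumes "models w (size w) A clauses"
  shows "models w (size w) A c_start"
    "models w (size w) A c_heads"
    "models w (size w) A c_input"
    "models w (size w) A c_blank"
    "models w (size w) A c_read"
    "models w (size w) A c_choice"
    "models w (size w) A c_source"
    "models w (size w) A c_match"
    "models w (size w) A c_target"
    "models w (size w) A c_move"
    "models w (size w) A c_write"
    "models w (size w) A c_frame"
    "models w (size w) A c_accept"
    "models w (size w) A c_halted"
  using assms by (simp_all add: clauses_def models_append)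

lemmas models_startD = iffD1[OF models_start models_parts(1)]
lemmas models_headsD = iffD1[OF models_heads models_parts(2)]
lemmas models_inputD = iffD1[OF models_input models_parts(3)]
lemmas models_blankD = iffD1[OF models_blank models_parts(4)]
lemmas models_readD = iffD1[OF models_read models_parts(5)]
lemmas models_choiceD = iffD1[OF models_choice models_parts(6)]
lemmas models_sourceD = iffD1[OF models_source models_parts(7)]
lemmas models_matchD = iffD1[OF models_match models_parts(8)]
lemmas models_targetD = iffD1[OF models_target models_parts(9)]
lemmas models_moveD = iffD1[OF models_move models_parts(10)]
lemmas models_writeD = iffD1[OF models_write models_parts(11)]
lemmas models_frameD = iffD1[OF models_frame models_parts(12)]
lemmas models_acceptD = iffD1[OF models_accept models_parts(13)]
lemmas models_haltedD = iffD1[OF models_halted models_parts(14)]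

text \<open>Only one inclusion is demanded: the atoms that describe the configuration are true.
  Other atoms may be true too, and no argument below needs them to be false.\<close>

definition tracks :: "bool list \<Rightarrow> (kind \<Rightarrow> nat \<Rightarrow> nat \<Rightarrow> bool) \<Rightarrow> nat \<Rightarrow> config \<Rightarrow> bool" where
  "tracks w A t c \<longleftrightarrow> fst c \<in> set states \<and> A (St (fst c)) t 0 \<and> length (snd c) = tapes \<and>
     (\<forall>h<tapes. \<bar>snd (snd c ! h)\<bar> \<le> int t \<and> A (Hd h) t (nat (snd (snd c ! h) + int (mid w))) \<and>
        (\<forall>y. fst (snd c ! h) y \<in> set symbols) \<and>
        (\<forall>i<size w. A (Ce h (fst (snd c ! h) (int i - int (mid w)))) t i))"

lemma read_tape_eq: "read_tape T = fst T (snd T)"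
  by (cases T) simp

lemma act_tape_eq: "act_tape a T = ((fst T)(snd T := fst a), snd T + offset (snd a))"
  by (cases T; cases a) simp

lemma symbols_basic: "0 \<in> set symbols" "word_contents w x \<in> set symbols"
  by (auto simp: symbols_def word_contents_def)

lemma initial_tape:
  "h < tapes \<Longrightarrow> snd (initial M w) ! h = ((if h = 0 then word_contents w else (\<lambda>_. 0)), 0)"
  by (cases h) (auto simp: initial_def tapes_def word_contents_def fun_eq_iff)

lemma tracks_initial:
  assumes "models w (size w) A clauses"
  shows "tracks w A 0 (initial M w)"
proof -
  have "A (St (start_state M)) 0 0" "\<forall>h<tapes. A (Hd h) 0 (mid w)"
    "\<forall>i<size w. A (Ce 0 (word_contents w (int i - int (mid w)))) 0 i"
    "\<forall>h<tapes. 0 < h \<longrightarrow> (\<forall>i<size w. A (Ce h 0) 0 i)"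
    by (rule models_startD[OF assms] models_headsD[OF assms] models_inputD[OF assms] models_blankD[OF assms])+
  moreover have "length (snd (initial M w)) = tapes" using tapes_pos by (simp add: initial_def tapes_def)
  moreover have "fst (initial M w) = start_state M" by (simp add: initial_def)
  ultimately show ?thesis
    unfolding tracks_def using initial_tape symbols_basic by (simp add: states_def)
qed

lemma tracks_pos:
  assumes "tracks w A t c" "t \<le> tm w" "h < tapes"
  shows "nat (snd (snd c ! h) + int (mid w)) < size w"
    "int (nat (snd (snd c ! h) + int (mid w))) = snd (snd c ! h) + int (mid w)"
    "0 < nat (snd (snd c ! h) + int (mid w))" "nat (snd (snd c ! h) + int (mid w)) + 1 < size w"
proof -
  have "\<bar>snd (snd c ! h)\<bar> \<le> int (tm w)" using assms unfolding tracks_def by force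
  then show "nat (snd (snd c ! h) + int (mid w)) < size w"
    "int (nat (snd (snd c ! h) + int (mid w))) = snd (snd c ! h) + int (mid w)"
    "0 < nat (snd (snd c ! h) + int (mid w))" "nat (snd (snd c ! h) + int (mid w)) + 1 < size w"
    by (auto simp: size_def mid_def)
qed

lemma tracks_read:
  assumes m: "models w (size w) A clauses" and tr: "tracks w A t c" and t: "t \<le> tm w" and h: "h < tapes"
  shows "A (Rd h (read_tape (snd c ! h))) t 0" "read_tape (snd c ! h) \<in> set symbols"
proof -
  let ?x = "snd (snd c ! h)"
  note pos = tracks_pos[OF tr t h]
  have hd: "A (Hd h) t (nat (?x + int (mid w)))" and s: "fst (snd c ! h) ?x \<in> set symbols"
    using tr h unfolding tracks_def by blast+
  have "A (Ce h (fst (snd c ! h) (int (nat (?x + int (mid w))) - int (mid w)))) t (nat (?x + int (mid w)))"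
    using tr h pos(1) unfolding tracks_def by blast
  then have ce: "A (Ce h (fst (snd c ! h) ?x)) t (nat (?x + int (mid w)))" using pos(2) by simp
  have ts: "t < size w" using t size_pos(3)[of w] by simp
  have "\<forall>h<tapes. \<forall>s\<in>set symbols. \<forall>t<size w. \<forall>i<size w.
      A (Hd h) t i \<longrightarrow> A (Ce h s) t i \<longrightarrow> A (Rd h s) t 0"
    by (rule models_readD[OF m])
  then show "A (Rd h (read_tape (snd c ! h))) t 0"
    using h s ts pos(1) hd ce by (simp add: read_tape_eq)
  show "read_tape (snd c ! h) \<in> set symbols" using s by (simp add: read_tape_eq)
qed

lemma tracks_step:
  assumes m: "models w (size w) A clauses" and tr: "tracks w A t (q, ts)" and t: "t \<le> tm w"
    and d: "(q, rs, q', as) \<in> transitions M" "A (Tr (q, rs, q', as)) t 0"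
  shows "tracks w A (t + 1) (q', map2 act_tape as ts)"
proof -
  have t1: "t + 1 < size w" "t < size w" using t size_pos(3)[of w] by simp_all
  have len: "length as = tapes" "length ts = tapes"
    using tr_lengths[OF d(1)] tr by (auto simp: tracks_def)
  have q': "q' \<in> set states" using d(1) set_trs by (force simp: states_def)
  have "A (St q') (t + 1) 0" using bspec[OF models_targetD[OF m] d(1)] d(2) t1 by simp
  moreover have "\<bar>snd (map2 act_tape as ts ! h)\<bar> \<le> int (t + 1) \<and>
      A (Hd h) (t + 1) (nat (snd (map2 act_tape as ts ! h) + int (mid w))) \<and>
      (\<forall>y. fst (map2 act_tape as ts ! h) y \<in> set symbols) \<and>
      (\<forall>i<size w. A (Ce h (fst (map2 act_tape as ts ! h) (int i - int (mid w)))) (t + 1) i)"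
    if h: "h < tapes" for h
  proof -
    let ?T = "fst (ts ! h)" and ?x = "snd (ts ! h)" and ?a = "as ! h"
    let ?p = "nat (?x + int (mid w))"
    have new: "map2 act_tape as ts ! h = (?T(?x := fst ?a), ?x + offset (snd ?a))"
      using h len by (simp add: act_tape_eq)
    note pos = tracks_pos[OF tr t h, simplified]
    have old: "\<bar>?x\<bar> \<le> int t" "A (Hd h) t ?p" "\<And>y. ?T y \<in> set symbols"
      "\<And>i. i < size w \<Longrightarrow> A (Ce h (?T (int i - int (mid w)))) t i"
      using tr h unfolding tracks_def by auto
    have "\<bar>?x + offset (snd ?a)\<bar> \<le> int (t + 1)" using old(1) by (cases "snd ?a") auto
    moreover have "A (Hd h) (t + 1) (nat (?x + offset (snd ?a) + int (mid w)))"
    proof -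
      have mv: "A (Hd h) (t + 1) (i + shift (snd ?a) - 1)" if "i < size w" "0 < i + shift (snd ?a)"
        "i + shift (snd ?a) < size w + 1" "A (Hd h) t i" for i
        using bspec[OF models_moveD[OF m] d(1)] d(2) h t1 that by (simp del: add_gr_0)
      have "0 < ?p + shift (snd ?a)" "?p + shift (snd ?a) < size w + 1"
        using pos by (cases "snd ?a"; simp)+
      then have "A (Hd h) (t + 1) (?p + shift (snd ?a) - 1)" using old(2) pos(1) by (intro mv)
      moreover have "nat (?x + offset (snd ?a) + int (mid w)) = ?p + shift (snd ?a) - 1"
        using pos by (simp add: offset_shift)
      ultimately show ?thesis by simp
    qed
    moreover have "fst ?a \<in> set symbols"
      using d(1) set_trs h len by (force simp: symbols_def)
    then have "(?T(?x := fst ?a)) y \<in> set symbols" for y using old(3) by simp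
    moreover have "A (Ce h ((?T(?x := fst ?a)) (int i - int (mid w)))) (t + 1) i" if i: "i < size w" for i
    proof (cases "i = ?p")
      case True
      have "A (Ce h (fst ?a)) (t + 1) i"
        using bspec[OF models_writeD[OF m] d(1)] d(2) h t1 i old(2) True by simp
      moreover have "int i - int (mid w) = ?x" using True pos by simp
      ultimately show ?thesis by simp
    next
      case False
      have "\<forall>s\<in>set symbols. \<forall>i j. i < size w \<longrightarrow> j < size w \<longrightarrow> i \<noteq> j \<longrightarrow>
          A (Hd h) t j \<longrightarrow> A (Ce h s) t i \<longrightarrow> A (Ce h s) (t + 1) i"
        using models_frameD[OF m] h t1 by blast
      then have "A (Ce h (?T (int i - int (mid w)))) (t + 1) i"
        using old i pos(1) False by blast
      moreover have "int i - int (mid w) \<noteq> ?x" using False pos by auto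
      ultimately show ?thesis by simp
    qed
    ultimately show ?thesis unfolding new by simp
  qed
  ultimately show ?thesis using q' len by (simp add: tracks_def)
qed

text \<open>The transitions selected by \<open>c_choice\<close> are followed from the initial
  configuration. Each one extends a genuine run, and runs have at most \<open>tm w\<close> steps, so
  \<open>Stop\<close> must be selected by time \<open>tm w\<close>; the last two families then make
  the configuration accepting and halted.\<close>

lemma models_imp_accepts:
  assumes m: "models w (size w) A clauses"
  shows "accepts M w"
proof -
  have "\<exists>c'. (c, c') \<in> (step M)\<^sup>* \<and> halted M c' \<and> fst c' = accept_state M"
    if "tracks w A t c" "(initial M w, c) \<in> step M ^^ t" for t c
    using that
  proof (induction "tm w - t" arbitrary: t c rule: less_induct)
    case less
    obtain q ts where c: "c = (q, ts)" by (cases c)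
    have t: "t \<le> tm w" using time less.prems(2) unfolding runs_in_time_def tm_def by blast
    have ts: "t < size w" using t size_pos(3)[of w] by simp
    have st: "q \<in> set states" "A (St q) t 0" "length ts = tapes" using less.prems(1) by (auto simp: tracks_def c)
    have rd: "A (Rd h (read_tape (ts ! h))) t 0" "read_tape (ts ! h) \<in> set symbols" if "h < tapes" for h
      using tracks_read[OF m less.prems(1) t that] by (auto simp: c)
    have "A Stop t 0 \<or> (\<exists>d\<in>transitions M. A (Tr d) t 0)"
      using models_choiceD[OF m] ts by blast
    then show ?case
    proof
      assume stop: "A Stop t 0"
      have acc: "q = accept_state M" using models_acceptD[OF m] ts st stop by blast
      have "halted M c" unfolding halted_def
      proof
        assume "c \<in> Domain (step M)"
        then obtain q' as where d: "(q, map read_tape ts, q', as) \<in> transitions M"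
          by (auto simp: step_def c)
        then obtain h where h: "h < tapes" "\<not> A (Rd h (map read_tape ts ! h)) t 0"
          using bspec[OF models_haltedD[OF m] d] ts acc stop by auto
        then show False using rd(1)[of h] st(3) by simp
      qed
      then show ?thesis using acc by (auto simp: c)
    next
      assume "\<exists>d\<in>transitions M. A (Tr d) t 0"
      then obtain q0 rs q' as where d: "(q0, rs, q', as) \<in> transitions M" "A (Tr (q0, rs, q', as)) t 0"
        by auto
      have "\<forall>d\<in>transitions M. \<forall>q\<in>set states. q \<noteq> fst d \<longrightarrow> A (Tr d) t 0 \<longrightarrow> \<not> A (St q) t 0"
        using models_sourceD[OF m] ts by blast
      then have q0: "q0 = q" using d st by fastforce
      have "\<forall>h<tapes. \<forall>s\<in>set symbols. s \<noteq> rs ! h \<longrightarrow> \<not> A (Rd h s) t 0"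
        using bspec[OF models_matchD[OF m] d(1)] d(2) ts by simp
      then have rs: "rs = map read_tape ts"
        using rd st(3) tr_lengths[OF d(1)] by (intro nth_equalityI) (auto, metis)
      have s: "(c, (q', map2 act_tape as ts)) \<in> step M"
        using d(1) unfolding step_def c q0 rs by blast
      then have r: "(initial M w, (q', map2 act_tape as ts)) \<in> step M ^^ (t + 1)"
        using less.prems(2) by auto
      then have "t + 1 \<le> tm w" using time unfolding runs_in_time_def tm_def by blast
      then have "tm w - (t + 1) < tm w - t" by simp
      moreover have "tracks w A (t + 1) (q', map2 act_tape as ts)"
        using tracks_step[OF m _ t] less.prems(1) d by (auto simp: c q0)
      ultimately obtain c' where "((q', map2 act_tape as ts), c') \<in> (step M)\<^sup>*" "halted M c'"
        "fst c' = accept_state M"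
        using less.hyps r by blast
      then show ?thesis using s by (meson converse_rtrancl_into_rtrancl)
    qed
  qed
  from this[OF tracks_initial[OF m]] show ?thesis unfolding accepts_def by auto
qed

lemma accepts_imp_models:
  assumes "accepts M w"
  shows "\<exists>A. models w (size w) A clauses"
proof -
  obtain e where e: "(initial M w, e) \<in> (step M)\<^sup>*" "halted M e" "fst e = accept_state M"
    using assms unfolding accepts_def by blast
  obtain m where "(initial M w, e) \<in> step M ^^ m" using e(1) rtrancl_imp_relpow by blast
  then obtain F where F: "F 0 = initial M w" "F m = e" "\<And>t. t < m \<Longrightarrow> (F t, F (Suc t)) \<in> step M"
    unfolding relpow_fun_conv by blast
  have "\<forall>t. \<exists>d. t < m \<longrightarrow> (case d of (q, rs, q', as) \<Rightarrow> (q, rs, q', as) \<in> transitions M \<and>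
      F t = (q, snd (F t)) \<and> rs = map read_tape (snd (F t)) \<and> F (Suc t) = (q', map2 act_tape as (snd (F t))))"
    using F(3) unfolding step_def by fastforce
  then obtain D where D: "\<And>t q rs q' as. t < m \<Longrightarrow> D t = (q, rs, q', as) \<Longrightarrow> (q, rs, q', as) \<in> transitions M \<and>
      F t = (q, snd (F t)) \<and> rs = map read_tape (snd (F t)) \<and> F (Suc t) = (q', map2 act_tape as (snd (F t)))"
    by (metis (mono_tags, lifting) case_prod_conv)
  \<comment> \<open>The tableau is longer than the run, so the final configuration is repeated after
    time \<open>m\<close>.\<close>
  define C where "C t = F (min t m)" for t
  have C0: "C 0 = initial M w" by (simp add: C_def F)
  have stop: "C t = e" if "m \<le> t" for t using that F(2) by (simp add: C_def min_def)
  have step: "(q, rs, q', as) \<in> transitions M \<and> fst (C t) = q \<and> rs = map read_tape (snd (C t)) \<and>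
      C (t + 1) = (q', map2 act_tape as (snd (C t)))" if "t < m" "D t = (q, rs, q', as)" for t q rs q' as
    using D[OF that] that by (simp add: C_def min_def) (metis fst_conv)
  have len: "length (snd (C t)) = tapes" for t
  proof (induction t)
    case 0
    then show ?case using tapes_pos by (simp add: C0 initial_def tapes_def)
  next
    case (Suc t)
    show ?case
    proof (cases "t < m")
      case True
      obtain q rs q' as where d: "D t = (q, rs, q', as)" by (metis prod_cases4)
      have "length as = tapes" using step[OF True d] tr_lengths by blast
      then show ?thesis using step[OF True d] Suc by simp
    next
      case False
      then show ?thesis using Suc stop by simp
    qed
  qed
  have tape_step: "snd (C (t + 1)) ! h = act_tape (as ! h) (snd (C t) ! h)"
    if "t < m" "D t = (q, rs, q', as)" "h < tapes" for t q rs q' as h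
  proof -
    have "length as = tapes" using step[OF that(1,2)] tr_lengths by blast
    then show ?thesis using step[OF that(1,2)] len[of t] that(3) by simp
  qed
  define A where "A k t i = (case k of
      St q \<Rightarrow> fst (C t) = q
    | Rd h s \<Rightarrow> read_tape (snd (C t) ! h) = s
    | Tr d \<Rightarrow> t < m \<and> D t = d
    | Stop \<Rightarrow> m \<le> t
    | Hd h \<Rightarrow> snd (snd (C t) ! h) = int i - int (mid w)
    | Ce h s \<Rightarrow> fst (snd (C t) ! h) (int i - int (mid w)) = s)" for k t i
  have A [simp]: "A (St q) t i \<longleftrightarrow> fst (C t) = q" "A (Rd h s) t i \<longleftrightarrow> read_tape (snd (C t) ! h) = s"
    "A (Tr d) t i \<longleftrightarrow> t < m \<and> D t = d" "A Stop t i \<longleftrightarrow> m \<le> t"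
    "A (Hd h) t i \<longleftrightarrow> snd (snd (C t) ! h) = int i - int (mid w)"
    "A (Ce h s) t i \<longleftrightarrow> fst (snd (C t) ! h) (int i - int (mid w)) = s" for q h s d t i
    by (simp_all add: A_def)
  have "models w (size w) A clauses" unfolding models_iff
  proof (intro conjI)
    show "A (St (start_state M)) 0 0" by (simp add: C0 initial_def)
    show "\<forall>h<tapes. A (Hd h) 0 (mid w)" by (simp add: C0 initial_tape)
    show "\<forall>i<size w. A (Ce 0 (word_contents w (int i - int (mid w)))) 0 i"
      using tapes_pos by (simp add: C0 initial_tape)
    show "\<forall>h<tapes. 0 < h \<longrightarrow> (\<forall>i<size w. A (Ce h 0) 0 i)" by (simp add: C0 initial_tape)
    show "\<forall>h<tapes. \<forall>s\<in>set symbols. \<forall>t<size w. \<forall>i<size w.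
        A (Hd h) t i \<longrightarrow> A (Ce h s) t i \<longrightarrow> A (Rd h s) t 0"
      by (simp add: read_tape_eq)
    show "\<forall>t<size w. A Stop t 0 \<or> (\<exists>d\<in>transitions M. A (Tr d) t 0)"
    proof (intro allI impI)
      fix t
      obtain q rs q' as where d: "D t = (q, rs, q', as)" by (metis prod_cases4)
      show "A Stop t 0 \<or> (\<exists>d\<in>transitions M. A (Tr d) t 0)"
        using step[of t, OF _ d] d by (cases "t < m") auto
    qed
    show "\<forall>d\<in>transitions M. \<forall>q\<in>set states. q \<noteq> fst d \<longrightarrow> (\<forall>t<size w. A (Tr d) t 0 \<longrightarrow> \<not> A (St q) t 0)"
      using step by fastforce
    show "\<forall>(q, rs, q', as)\<in>transitions M. \<forall>h<tapes. \<forall>s\<in>set symbols. s \<noteq> rs ! h \<longrightarrow>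
       (\<forall>t<size w. A (Tr (q, rs, q', as)) t 0 \<longrightarrow> \<not> A (Rd h s) t 0)"
      using step len by fastforce
    show "\<forall>(q, rs, q', as)\<in>transitions M. \<forall>t. t + 1 < size w \<longrightarrow> A (Tr (q, rs, q', as)) t 0 \<longrightarrow> A (St q') (t + 1) 0"
      using step by fastforce
    show "\<forall>(q, rs, q', as)\<in>transitions M. \<forall>h<tapes. \<forall>t i. t + 1 < size w \<longrightarrow> i < size w \<longrightarrow>
       0 < i + shift (snd (as ! h)) \<longrightarrow> i + shift (snd (as ! h)) < size w + 1 \<longrightarrow>
       A (Tr (q, rs, q', as)) t 0 \<longrightarrow> A (Hd h) t i \<longrightarrow> A (Hd h) (t + 1) (i + shift (snd (as ! h)) - 1)"
    proof (intro ballI, unfold split_paired_all prod.case, intro allI impI)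
      fix q rs q' as h t i
      assume "h < tapes" "0 < i + shift (snd (as ! h))" "A (Tr (q, rs, q', as)) t 0" "A (Hd h) t i"
      then show "A (Hd h) (t + 1) (i + shift (snd (as ! h)) - 1)"
        using tape_step[of t q rs q' as h] by (simp add: act_tape_eq offset_shift of_nat_diff Suc_leI del: add_gr_0)
    qed
    show "\<forall>(q, rs, q', as)\<in>transitions M. \<forall>h<tapes. \<forall>t i. t + 1 < size w \<longrightarrow> i < size w \<longrightarrow>
       A (Tr (q, rs, q', as)) t 0 \<longrightarrow> A (Hd h) t i \<longrightarrow> A (Ce h (fst (as ! h))) (t + 1) i"
    proof (intro ballI, unfold split_paired_all prod.case, intro allI impI)
      fix q rs q' as h t i
      assume "h < tapes" "A (Tr (q, rs, q', as)) t 0" "A (Hd h) t i"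
      then show "A (Ce h (fst (as ! h))) (t + 1) i"
        using tape_step[of t q rs q' as h] by (simp add: act_tape_eq)
    qed
    show "\<forall>h<tapes. \<forall>s\<in>set symbols. \<forall>t i j. t + 1 < size w \<longrightarrow> i < size w \<longrightarrow> j < size w \<longrightarrow> i \<noteq> j \<longrightarrow>
       A (Hd h) t j \<longrightarrow> A (Ce h s) t i \<longrightarrow> A (Ce h s) (t + 1) i"
    proof (intro ballI allI impI)
      fix h s t i j
      assume a: "h < tapes" "i \<noteq> j" "A (Hd h) t j" "A (Ce h s) t i"
      obtain q rs q' as where d: "D t = (q, rs, q', as)" by (metis prod_cases4)
      show "A (Ce h s) (t + 1) i"
      proof (cases "t < m")
        case True
        then show ?thesis using tape_step[OF True d a(1)] a by (simp add: act_tape_eq)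
      next
        case False
        then show ?thesis using stop[of t] stop[of "t + 1"] a by simp
      qed
    qed
    show "\<forall>q\<in>set states. q \<noteq> accept_state M \<longrightarrow> (\<forall>t<size w. A Stop t 0 \<longrightarrow> \<not> A (St q) t 0)"
      using stop e(3) by simp
    show "\<forall>(q, rs, q', as)\<in>transitions M. q = accept_state M \<longrightarrow>
      (\<forall>t<size w. A Stop t 0 \<longrightarrow> (\<exists>h<tapes. \<not> A (Rd h (rs ! h)) t 0))"
    proof (intro ballI, unfold split_paired_all prod.case, intro allI impI)
      fix q rs q' as t
      assume d: "(q, rs, q', as) \<in> transitions M" and q: "q = accept_state M" and "A Stop t 0"
      then have t: "C t = e" using stop by simp
      show "\<exists>h<tapes. \<not> A (Rd h (rs ! h)) t 0"
      proof (rule ccontr)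
        assume "\<not> (\<exists>h<tapes. \<not> A (Rd h (rs ! h)) t 0)"
        then have "rs = map read_tape (snd e)"
          using len[of t] tr_lengths[OF d] t by (intro nth_equalityI) auto
        then have "(e, (q', map2 act_tape as (snd e))) \<in> step M"
          using d e(3) q unfolding step_def by (cases e) auto
        then show False using e(2) unfolding halted_def by blast
      qed
    qed
  qed
  then show ?thesis by blast
qed

theorem accepts_iff_models: "accepts M w \<longleftrightarrow> (\<exists>A. models w (size w) A clauses)"
  using models_imp_accepts accepts_imp_models by blast

end

section \<open>The interval gadget\<close>

text \<open>
  The gadget for \<open>N\<close> variables and \<open>K\<close> clauses; literal \<open>2 * j\<close> is variable \<open>j\<close> and
  literal \<open>2 * j + 1\<close> its negation. Literal \<open>l\<close> owns the colors \<open>col l i s\<close>: those with \<open>s = 0\<close> are its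
  levels \<open>0, \<dots>, K + 1\<close>, the others separate consecutive levels. A \<open>Pin\<close> is forced to its color by
  the nested intervals \<open>Pad\<close>. The pins of the levels of \<open>l\<close> end together, and the levels are taken over
  by the nested intervals \<open>Lit l 0, \<dots>, Lit l K\<close> and by \<open>Hole l\<close>, so \<open>Lit l i\<close> has level \<open>i\<close> or
  \<open>i + 1\<close> and the choice is monotone in \<open>i\<close>. Level \<open>i + 1\<close> stands for true. The pair items at the
  end of \<open>Lit l K\<close> exclude that both literals of a variable are true, and the items of clause \<open>q\<close> at
  the end of the intervals \<open>Lit l q\<close> require that some literal of \<open>q\<close> is true; membership of \<open>l\<close> in \<open>q\<close>
  moves the right end of \<open>Lit l q\<close> by one.
\<close>

datatype item =
    Pin nat nat nat | Pad nat nat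
  | Low nat nat | High nat nat | Lit nat nat | Hole nat
  | PairE nat | PairC2 nat | PairF2 nat | PairC1 nat | PairD nat | PairF1 nat
  | Guard nat nat | Slot nat nat | Rest nat nat

locale gadget =
  fixes N K :: nat and inc :: "nat \<Rightarrow> nat \<Rightarrow> bool"
begin

definition lits :: nat where "lits = 2 * N"
text \<open>A literal has three colors for each \<open>i \<le> K\<close> and the single level
  \<open>K + 1\<close>. The same number of time units is enough for its block of left ends.\<close>

definition bsize :: nat where "bsize = 3 * K + 4"
definition ncol :: nat where "ncol = lits * bsize"
definition col :: "nat \<Rightarrow> nat \<Rightarrow> nat \<Rightarrow> nat" where "col l i s = l * bsize + 3 * i + s"
text \<open>Each color has a window on the time axis, wide enough for a nest of up to
  \<open>ncol - 1\<close> pads with a nonempty innermost one.\<close>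

definition wid :: nat where "wid = 2 * ncol + 2"
definition tA :: nat where "tA = ncol * wid"
definition blk :: "nat \<Rightarrow> nat" where "blk l = tA + l * bsize"
definition tB :: nat where "tB = tA + ncol"
definition tC :: nat where "tC = tB + 6 * N"
text \<open>\<open>Lit l i\<close> encloses \<open>Lit l (Suc i)\<close> and so ends later: the
  clauses are visited in decreasing order, after the pairs.\<close>

definition cst :: "nat \<Rightarrow> nat" where "cst i = tC + 3 * lits * (K - Suc i)"
text \<open>The added 1 places \<open>tD\<close> behind every left end. From then on intervals only
  end: holes, pair items and clause items, in the order of their starts.\<close>

definition tD :: nat where "tD = tC + 3 * lits * K + 1"
definition tE :: nat where "tE = tD + lits"
definition tF :: nat where "tF = tE + 6 * N"
definition cen :: "nat \<Rightarrow> nat" where "cen i = tF + 3 * lits * (K - Suc i)"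

fun lft :: "item \<Rightarrow> nat" where
  "lft (Pin l i s) = col l i s * wid"
| "lft (Pad c j) = c * wid + j"
| "lft (Low l i) = blk l + 2 * i"
| "lft (High l i) = blk l + (if i < K then 2 * i + 1 else 3 * K + 2)"
| "lft (Lit l i) = blk l + 2 * K + 1 + i"
| "lft (Hole l) = blk l + 3 * K + 3"
| "lft (PairE j) = tB + 6 * j + 1"
| "lft (PairC2 j) = tB + 6 * j + 2"
| "lft (PairF2 j) = tB + 6 * j + 3"
| "lft (PairC1 j) = tB + 6 * j + 4"
| "lft (PairD j) = tB + 6 * j + 5"
| "lft (PairF1 j) = tB + 6 * j + 6"
| "lft (Guard q l) = cst q + 1 + l"
| "lft (Slot q m) = cst q + lits + 1 + m"
| "lft (Rest q j) = cst q + 2 * lits + 2 + j"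

text \<open>Closed intervals that touch do intersect. A color is therefore inherited only if the new
  interval starts strictly later, and endpoints coincide where inheritance must be
  prevented.\<close>

fun rgt :: "item \<Rightarrow> nat" where
  "rgt (Pin l i s) =
     (if s = 0 then blk l + 2 * K
      else if s = 1 then blk l + 2 * i - 1
      else if i < K then blk l + 2 * i else blk l + 3 * K + 1)"
| "rgt (Pad c j) = c * wid + 2 * ncol + 1 - j"
| "rgt (Low l i) = (if i < K then cst i + l else tB + 6 * (l div 2))"
| "rgt (High l i) =
     (if i < K then cst i + lits else tB + 6 * (l div 2) + (if even l then 5 else 2))"
| "rgt (Lit l i) =
     (if i < K then cst i + lits + 1 + l + (if inc i l then 0 else 1)
      else tB + 6 * (l div 2) + (if even l then 3 else 1))"
| "rgt (Hole l) = tD + l"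
| "rgt (PairE j) = tE + 6 * j"
| "rgt (PairC2 j) = tE + 6 * j + 2"
| "rgt (PairF2 j) = tE + 6 * j + 1"
| "rgt (PairC1 j) = tE + 6 * j + 5"
| "rgt (PairD j) = tE + 6 * j + 3"
| "rgt (PairF1 j) = tE + 6 * j + 4"
| "rgt (Guard q l) = cen q + 2 * (lits - l) - 1"
| "rgt (Slot q m) = cen q + 2 * (lits - m)"
| "rgt (Rest q j) = cen q + 2 * lits + 1 + j"

definition meets :: "item \<Rightarrow> item \<Rightarrow> bool" where
  "meets v w \<longleftrightarrow> lft v \<le> rgt w \<and> lft w \<le> rgt v"

definition conts :: "item \<Rightarrow> item \<Rightarrow> bool" where
  "conts v w \<longleftrightarrow> lft v \<le> lft w \<and> rgt w \<le> rgt v"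

fun valid :: "item \<Rightarrow> bool" where
  "valid (Pin l i s) \<longleftrightarrow> l < lits \<and> s \<le> 2 \<and> i \<le> Suc K \<and> (i = Suc K \<longrightarrow> s = 0)"
| "valid (Pad c j) \<longleftrightarrow> c < j \<and> j < ncol"
| "valid (Low l i) \<longleftrightarrow> l < lits \<and> i \<le> K"
| "valid (High l i) \<longleftrightarrow> l < lits \<and> i \<le> K"
| "valid (Lit l i) \<longleftrightarrow> l < lits \<and> i \<le> K"
| "valid (Hole l) \<longleftrightarrow> l < lits"
| "valid (PairE j) \<longleftrightarrow> j < N"
| "valid (PairC2 j) \<longleftrightarrow> j < N"
| "valid (PairF2 j) \<longleftrightarrow> j < N"
| "valid (PairC1 j) \<longleftrightarrow> j < N"
| "valid (PairD j) \<longleftrightarrow> j < N"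
| "valid (PairF1 j) \<longleftrightarrow> j < N"
| "valid (Guard q l) \<longleftrightarrow> q < K \<and> l < lits"
| "valid (Slot q m) \<longleftrightarrow> q < K \<and> m \<le> lits"
| "valid (Rest q j) \<longleftrightarrow> q < K \<and> j < lits - 1"

definition proper :: "(item \<Rightarrow> nat) \<Rightarrow> bool" where
  "proper f \<longleftrightarrow> (\<forall>v w. valid v \<longrightarrow> valid w \<longrightarrow> v \<noteq> w \<longrightarrow> meets v w \<longrightarrow>
     f v \<noteq> f w \<and> (conts v w \<longrightarrow> f v < f w))"

definition sat :: bool where
  "sat \<longleftrightarrow> (\<exists>a :: nat \<Rightarrow> bool. \<forall>q<K. \<exists>l<lits. inc q l \<and> a (l div 2) = even l)"

section \<open>Order of the time zones\<close>

lemma mult_less_step: "(a::nat) < b \<Longrightarrow> a * c + c \<le> b * c"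
  by (metis Suc_leI add.commute mult_Suc mult_le_mono1)

lemma blk_less: "l < l' \<Longrightarrow> blk l + bsize \<le> blk l'"
  using mult_less_step[of l l' bsize] by (simp add: blk_def)

lemma blk_lower: "tA \<le> blk l"
  by (simp add: blk_def)

lemma blk_upper: "l < lits \<Longrightarrow> blk l + bsize \<le> tB"
  using mult_less_step[of l lits bsize] by (simp add: blk_def tB_def ncol_def)

lemma cst_less: "i < i' \<Longrightarrow> i' < K \<Longrightarrow> cst i' + 3 * lits \<le> cst i"
  using mult_less_step[of "K - Suc i'" "K - Suc i" "3 * lits"]
  by (simp add: cst_def mult.commute)

lemma cst_lower: "tC \<le> cst i"
  by (simp add: cst_def)

lemma cst_upper: "i < K \<Longrightarrow> cst i + 3 * lits < tD"
  using mult_less_step[of "K - Suc i" K "3 * lits"] by (simp add: cst_def tD_def mult.commute)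

lemma cen_less: "i < i' \<Longrightarrow> i' < K \<Longrightarrow> cen i' + 3 * lits \<le> cen i"
  using mult_less_step[of "K - Suc i'" "K - Suc i" "3 * lits"]
  by (simp add: cen_def mult.commute)

lemma cen_lower: "tF \<le> cen i"
  by (simp add: cen_def)

lemma col_less_ncol: "l < lits \<Longrightarrow> 3 * i + s < bsize \<Longrightarrow> col l i s < ncol"
  using mult_less_step[of l lits bsize] by (simp add: col_def ncol_def)

lemma col_block: "l < l' \<Longrightarrow> 3 * i + s < bsize \<Longrightarrow> col l i s < col l' i' s'"
  using mult_less_step[of l l' bsize] by (simp add: col_def)

lemma col_same: "col l i s < col l i' s' \<longleftrightarrow> 3 * i + s < 3 * i' + s'"
  by (simp add: col_def)

lemma col_inject:
  assumes "col l i s = col l' i' s'" "3 * i + s < bsize" "3 * i' + s' < bsize" "s \<le> 2" "s' \<le> 2"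
  shows "l = l' \<and> i = i' \<and> s = s'"
proof -
  have "l = l'"
    using assms col_block[of l l' i s i' s'] col_block[of l' l i' s' i s]
    by (metis less_irrefl linorder_neqE_nat)
  then have "3 * i + s = 3 * i' + s'" using assms by (simp add: col_def)
  then show ?thesis using \<open>l = l'\<close> assms(4,5) by presburger
qed

lemma times_chain: "tB = tA + ncol" "tC = tB + 6 * N" "tE = tD + lits" "tF = tE + 6 * N" "tC < tD"
  by (simp_all add: tB_def tC_def tD_def tE_def tF_def)

lemma pair_upper: "j < N \<Longrightarrow> tB + 6 * j + 6 \<le> tC"
  by (simp add: tC_def)

lemma lit_pair_upper: "l < lits \<Longrightarrow> tB + 6 * (l div 2) + 6 \<le> tC"
  by (rule pair_upper) (simp add: lits_def less_mult_imp_div_less mult.commute)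

subsection \<open>Colorings force assignments\<close>

text \<open>
  If the intervals \<open>g x\<close> use all colors and each \<open>h x\<close> starts before the \<open>g y\<close> of later events end,
  then the \<open>h x\<close> of an event permute the colors released in that event.
\<close>

lemma generation:
  fixes f :: "'b \<Rightarrow> nat" and e :: "'a \<Rightarrow> nat"
  assumes fin: "finite X"
    and g: "inj_on (\<lambda>x. f (g x)) X" "(\<lambda>x. f (g x)) ` X = {..<n}"
    and h: "inj_on (\<lambda>x. f (h x)) X" "\<And>x. x \<in> X \<Longrightarrow> f (h x) < n"
    and later: "\<And>x y. x \<in> X \<Longrightarrow> y \<in> X \<Longrightarrow> e x < e y \<Longrightarrow> f (h x) \<noteq> f (g y)"
    and x: "x \<in> X"
  shows "\<exists>y\<in>X. e y = e x \<and> f (h x) = f (g y)"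
proof -
  have eq: "(\<lambda>x. f (h x)) ` {x \<in> X. e x = m} = (\<lambda>x. f (g x)) ` {x \<in> X. e x = m}" for m
  proof (induction m rule: less_induct)
    case (less m)
    have sub: "(\<lambda>x. f (h x)) ` {x \<in> X. e x = m} \<subseteq> (\<lambda>x. f (g x)) ` {x \<in> X. e x = m}"
    proof
      fix c assume "c \<in> (\<lambda>x. f (h x)) ` {x \<in> X. e x = m}"
      then obtain x where x: "x \<in> X" "e x = m" "c = f (h x)" by auto
      then have "c \<in> (\<lambda>x. f (g x)) ` X" using g(2) h(2) by auto
      then obtain y where y: "y \<in> X" "c = f (g y)" by auto
      have "\<not> m < e y" using later x y by metis
      moreover have "\<not> e y < m"
      proof
        assume lt: "e y < m"
        then have "c \<in> (\<lambda>x. f (h x)) ` {x \<in> X. e x = e y}" using less y by auto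
        then obtain z where "z \<in> X" "e z = e y" "c = f (h z)" by auto
        then show False using x lt h(1) by (metis inj_onD less_irrefl)
      qed
      ultimately show "c \<in> (\<lambda>x. f (g x)) ` {x \<in> X. e x = m}" using y by auto
    qed
    have "inj_on (\<lambda>x. f (h x)) {x \<in> X. e x = m}" "inj_on (\<lambda>x. f (g x)) {x \<in> X. e x = m}"
      using g(1) h(1) by (auto intro: inj_on_subset)
    then have "card ((\<lambda>x. f (h x)) ` {x \<in> X. e x = m}) = card ((\<lambda>x. f (g x)) ` {x \<in> X. e x = m})"
      by (simp add: card_image)
    then show ?case using sub fin by (intro card_subset_eq) auto
  qed
  have "f (h x) \<in> (\<lambda>y. f (g y)) ` {y \<in> X. e y = e x}" using eq[of "e x"] x by auto
  then show ?thesis by auto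
qed

section \<open>Three generations of intervals, each using all colors\<close>

definition slots :: "(nat \<times> nat \<times> nat) set" where
  "slots = {(l, i, s). l < lits \<and> s \<le> 2 \<and> i \<le> Suc K \<and> (i = Suc K \<longrightarrow> s = 0)}"

text \<open>The slots name the colors and index three cliques of \<open>ncol\<close> intervals,
  which share the points \<open>tA - 1\<close>, \<open>tB\<close> and \<open>tD\<close>
  respectively. Within one event the matching of slots with intervals is arbitrary, since
  \<open>generation\<close> looks at events only.\<close>

fun pin_of :: "nat \<times> nat \<times> nat \<Rightarrow> item" where
  "pin_of (l, i, s) = Pin l i s"

fun mid_of :: "nat \<times> nat \<times> nat \<Rightarrow> item" where
  "mid_of (l, i, s) =
     (if s = 0 then (if i \<le> K then Lit l i else Hole l) else if s = 1 then Low l i else High l i)"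

fun last_of :: "nat \<times> nat \<times> nat \<Rightarrow> item" where
  "last_of (l, i, s) =
     (if i = Suc K then Hole l
      else if i = K then
        (if even l then (if s = 0 then PairC1 (l div 2) else if s = 1 then PairE (l div 2) else PairF1 (l div 2))
         else (if s = 0 then PairD (l div 2) else if s = 1 then PairC2 (l div 2) else PairF2 (l div 2)))
      else if s = 1 then Guard i l
      else if s = 2 then Slot i l
      else if l = 0 then Slot i lits else Rest i (l - 1))"

text \<open>Equal values mark colors that may be permuted. The only larger group consists of the
  levels of \<open>l\<close> and \<open>col l K 2\<close>, taken over by the copies of the literal,
  \<open>High l K\<close> and \<open>Hole l\<close>.\<close>

fun ev_mid :: "nat \<times> nat \<times> nat \<Rightarrow> nat" where
  "ev_mid (l, i, s) =
     blk l + (if s = 0 \<or> s = 2 \<and> i = K then 2 * K + 1 else if s = 1 then 2 * i else 2 * i + 1)"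

text \<open>\<open>High (2 * j) K\<close> is still present when the first five items of pair
  \<open>j\<close> start, so these share the other five colors and it forms an event of its own. In
  a clause each low is an event, and all highs and copies together are another.\<close>

fun ev_last :: "nat \<times> nat \<times> nat \<Rightarrow> nat" where
  "ev_last (l, i, s) =
     (if i = Suc K then tD
      else if i = K then tB + 6 * (l div 2) + (if even l \<and> s = 2 then 5 else 0)
      else cst i + (if s = 1 then l else lits))"

lemma finite_slots: "finite slots"
proof (rule finite_subset)
  show "slots \<subseteq> {..<lits} \<times> {..Suc K} \<times> {..2}" by (auto simp: slots_def)
qed simp

lemma slot_bound: "(l, i, s) \<in> slots \<Longrightarrow> 3 * i + s < bsize"
  by (cases "i = Suc K") (auto simp: slots_def bsize_def)

lemma slot_col_inj: "inj_on (\<lambda>(l, i, s). col l i s) slots"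
proof (rule inj_onI)
  fix x y
  assume "x \<in> slots" "y \<in> slots"
    "(\<lambda>(l, i, s). col l i s) x = (\<lambda>(l, i, s). col l i s) y"
  moreover obtain l i s l' i' s' where "x = (l, i, s)" "y = (l', i', s')" by (metis prod_cases3)
  ultimately show "x = y"
    using slot_bound col_inject[of l i s l' i' s'] by (auto simp: slots_def)
qed

lemma slot_col_image: "(\<lambda>(l, i, s). col l i s) ` slots = {..<ncol}"
proof (intro equalityI subsetI)
  fix c assume "c \<in> (\<lambda>(l, i, s). col l i s) ` slots"
  then show "c \<in> {..<ncol}" using slot_bound by (auto simp: slots_def intro!: col_less_ncol)
next
  fix c assume c: "c \<in> {..<ncol}"
  define l r where "l = c div bsize" and "r = c mod bsize"
  have b: "bsize > 0" by (simp add: bsize_def)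
  have "l < lits" using c by (simp add: l_def ncol_def less_mult_imp_div_less)
  have r: "r < 3 * K + 4" using b by (simp add: r_def bsize_def)
  have "c = col l (r div 3) (r mod 3)"
    by (simp add: col_def l_def r_def)
  moreover have "(l, r div 3, r mod 3) \<in> slots"
    using \<open>l < lits\<close> r unfolding slots_def by auto presburger+
  ultimately show "c \<in> (\<lambda>(l, i, s). col l i s) ` slots" by force
qed

lemma valid_slots:
  assumes "x \<in> slots"
  shows "valid (pin_of x)" "valid (mid_of x)" "valid (last_of x)"
  using assms less_mult_imp_div_less[of "fst x" N 2]
  by (cases x; auto simp: slots_def lits_def)+

lemma pin_of_inj: "inj_on pin_of slots"
  by (auto intro!: inj_onI)

lemma mid_of_inj: "inj_on mid_of slots"
proof (rule inj_on_inverseI)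
  fix x assume "x \<in> slots"
  then show "(case mid_of x of Lit l i \<Rightarrow> (l, i, 0) | Hole l \<Rightarrow> (l, Suc K, 0) | Low l i \<Rightarrow> (l, i, 1)
      | High l i \<Rightarrow> (l, i, 2)) = x"
    by (cases x) (auto simp: slots_def)
qed

lemma last_of_inj: "inj_on last_of slots"
proof (rule inj_on_inverseI)
  fix x assume "x \<in> slots"
  then show "(case last_of x of Hole l \<Rightarrow> (l, Suc K, 0)
      | PairC1 j \<Rightarrow> (2 * j, K, 0) | PairE j \<Rightarrow> (2 * j, K, 1) | PairF1 j \<Rightarrow> (2 * j, K, 2)
      | PairD j \<Rightarrow> (Suc (2 * j), K, 0) | PairC2 j \<Rightarrow> (Suc (2 * j), K, 1)
      | PairF2 j \<Rightarrow> (Suc (2 * j), K, 2)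
      | Guard i l \<Rightarrow> (l, i, 1) | Slot i l \<Rightarrow> if l = lits then (0, i, 0) else (l, i, 2)
      | Rest i l \<Rightarrow> (Suc l, i, 0)) = x"
    by (cases x) (auto simp: slots_def)
qed

lemma mid_lft: "x \<in> slots \<Longrightarrow> tA \<le> lft (mid_of x) \<and> lft (mid_of x) < tB"
  using blk_lower[of "fst x"] blk_upper[of "fst x"]
  by (cases x) (auto simp: slots_def bsize_def)

lemma mid_rgt: "x \<in> slots \<Longrightarrow> tB \<le> rgt (mid_of x)"
  using cst_lower[of "fst (snd x)"] times_chain
  by (cases x) (auto simp: slots_def)

lemma last_lft: "x \<in> slots \<Longrightarrow> snd x \<noteq> (Suc K, 0) \<Longrightarrow> tB < lft (last_of x) \<and> lft (last_of x) < tD"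
  using cst_lower[of "fst (snd x)"] cst_upper[of "fst (snd x)"] times_chain lit_pair_upper[of "fst x"]
  by (cases x) (auto simp: slots_def)

lemma last_rgt: "x \<in> slots \<Longrightarrow> tD \<le> rgt (last_of x)"
  using cen_lower[of "fst (snd x)"] times_chain
  by (cases x) (auto simp: slots_def)

lemma pin_lft: "x \<in> slots \<Longrightarrow> lft (pin_of x) < tA"
proof (cases x)
  case (fields l i s)
  assume "x \<in> slots"
  then have "col l i s < ncol" using fields slot_bound by (auto simp: slots_def intro!: col_less_ncol)
  then have "col l i s * wid < ncol * wid" by (intro mult_strict_right_mono) (simp_all add: wid_def)
  then show ?thesis using fields by (simp add: tA_def)
qed

lemma pin_rgt: "x \<in> slots \<Longrightarrow> tA \<le> Suc (rgt (pin_of x))"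
  using blk_lower[of "fst x"] by (cases x) auto

lemma mid_event:
  assumes "x \<in> slots" "y \<in> slots" "ev_mid x < ev_mid y"
  shows "meets (mid_of x) (pin_of y)"
proof -
  obtain l i s l' i' s' where xy: "x = (l, i, s)" "y = (l', i', s')" by (metis prod_cases3)
  have "lft (mid_of x) \<le> rgt (pin_of y)"
  proof (cases "l = l'")
    case True
    then show ?thesis using assms by (auto simp: xy slots_def split: if_splits)
  next
    case False
    have "l < l'"
    proof (rule ccontr)
      assume "\<not> l < l'"
      then have "blk l' + bsize \<le> blk l" using False blk_less by simp
      then show False using assms by (auto simp: xy slots_def bsize_def split: if_splits)
    qed
    then have "blk l + bsize \<le> blk l'" using blk_less by simp
    then show ?thesis using assms by (auto simp: xy slots_def bsize_def split: if_splits)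
  qed
  moreover have "lft (pin_of y) \<le> rgt (mid_of x)"
    using pin_lft[OF assms(2)] mid_rgt[OF assms(1)] times_chain by linarith
  ultimately show ?thesis by (simp add: meets_def)
qed

lemma last_event:
  assumes "x \<in> slots" "y \<in> slots" "ev_last x < ev_last y"
  shows "meets (last_of x) (mid_of y)"
proof -
  obtain l i s l' i' s' where xy: "x = (l, i, s)" "y = (l', i', s')" by (metis prod_cases3)
  note bnd = lit_pair_upper[of l] lit_pair_upper[of l'] cst_lower[of i] cst_lower[of i']
    cst_upper[of i] cst_upper[of i'] times_chain
  have ne: "i \<noteq> Suc K"
    using assms bnd by (auto simp: xy slots_def split: if_splits)
  have "lft (last_of x) \<le> rgt (mid_of y)"
  proof (cases "i' = Suc K")
    case True
    then show ?thesis using last_lft[OF assms(1)] ne assms(2) by (auto simp: xy slots_def)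
  next
    case i': False
    show ?thesis
    proof (cases "i < K \<and> i' < K")
      case True
      consider "i < i'" | "i = i'" | "i' < i" by linarith
      then show ?thesis
      proof cases
        case 1
        then show ?thesis using assms True cst_less[of i i'] by (auto simp: xy slots_def split: if_splits)
      next
        case 2
        then show ?thesis using assms True by (auto simp: xy slots_def split: if_splits)
      next
        case 3
        then show ?thesis using assms True cst_less[of i' i] by (auto simp: xy slots_def split: if_splits)
      qed
    next
      case False
      show ?thesis
      proof (cases "i = K \<and> i' = K")
        case True
        consider "l div 2 < l' div 2" | "l div 2 = l' div 2" | "l' div 2 < l div 2" by linarith
        then show ?thesis using assms True by cases (auto simp: xy slots_def split: if_splits)
      next
        case f2: False
        then consider "i < K" "i' = K" | "i = K" "i' < K"
          using False ne i' assms by (auto simp: xy slots_def)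
        then show ?thesis
        proof cases
          case 1
          then show ?thesis using assms bnd by (auto simp: xy slots_def split: if_splits)
        next
          case 2
          then show ?thesis using assms bnd by (auto simp: xy slots_def)
        qed
      qed
    qed
  qed
  moreover have "lft (mid_of y) \<le> rgt (last_of x)"
    using mid_lft[OF assms(2)] last_rgt[OF assms(1)] times_chain by linarith
  ultimately show ?thesis by (simp add: meets_def)
qed

end

section \<open>Colors forced by the gadget\<close>

context gadget
begin

context
  fixes f :: "item \<Rightarrow> nat"
  assumes proper: "proper f" and bound: "\<And>v. valid v \<Longrightarrow> f v < ncol"
begin

lemma f_neq: "valid v \<Longrightarrow> valid w \<Longrightarrow> v \<noteq> w \<Longrightarrow> meets v w \<Longrightarrow> f v \<noteq> f w"
  using proper unfolding proper_def by simp

lemma f_less: "valid v \<Longrightarrow> valid w \<Longrightarrow> v \<noteq> w \<Longrightarrow> meets v w \<Longrightarrow> conts v w \<Longrightarrow> f v < f w"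
  using proper unfolding proper_def by simp

text \<open>Downward induction along the nest: the innermost pad is bounded by the largest color,
  and each step outwards loses at least 1.\<close>

lemma pad_color: "c < j \<Longrightarrow> j < ncol \<Longrightarrow> f (Pad c j) \<le> j"
proof (induction "ncol - Suc j" arbitrary: j)
  case 0
  then show ?case using bound[of "Pad c j"] by simp
next
  case (Suc n)
  then have j: "Suc j < ncol" "c < Suc j" by auto
  then have "f (Pad c (Suc j)) \<le> Suc j" using Suc by auto
  moreover have "f (Pad c j) < f (Pad c (Suc j))"
    using j Suc.prems by (intro f_less) (auto simp: meets_def conts_def)
  ultimately show ?case by simp
qed

text \<open>The pin starts no later than window \<open>c\<close> and reaches beyond it, so it
  contains \<open>Pad c (Suc c)\<close>, whose color is at most \<open>Suc c\<close>.\<close>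

lemma pin_le:
  assumes x: "x \<in> slots" and le: "(\<lambda>(l, i, s). col l i s) x \<le> c" and c: "c < ncol"
  shows "f (pin_of x) \<le> c"
proof (cases "Suc c < ncol")
  case True
  obtain l i s where s: "x = (l, i, s)" by (metis prod_cases3)
  have w: "c * wid + wid \<le> tA" using mult_less_step[OF c, of wid] by (simp add: tA_def)
  have "Suc c \<le> 2 * ncol" using True by simp
  have "lft (pin_of x) \<le> c * wid" using le by (simp add: s)
  moreover have "rgt (Pad c (Suc c)) < tA" using w by (simp add: wid_def)
  ultimately have "meets (pin_of x) (Pad c (Suc c))" "conts (pin_of x) (Pad c (Suc c))"
    using pin_rgt[OF x] True unfolding meets_def conts_def by (auto simp: wid_def)
  then have "f (pin_of x) < f (Pad c (Suc c))"
    using True valid_slots[OF x] by (intro f_less) (auto simp: s)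
  then show ?thesis using pad_color[of c "Suc c"] True by simp
next
  case False
  then show ?thesis using bound[OF valid_slots(1)[OF x]] by simp
qed

text \<open>The upper bound of \<open>pin_le\<close> is attained: all pins meet, and by induction
  every smaller color is already occupied by its own pin.\<close>

lemma pin_color: "x \<in> slots \<Longrightarrow> f (pin_of x) = (\<lambda>(l, i, s). col l i s) x"
proof (induction "(\<lambda>(l, i, s). col l i s) x" arbitrary: x rule: less_induct)
  case less
  let ?c = "\<lambda>(l, i, s). col l i s"
  have "?c x \<in> ?c ` slots" using less.prems by (rule imageI)
  then have n: "?c x < ncol" unfolding slot_col_image by simp
  have le: "f (pin_of x) \<le> ?c x" using pin_le[OF less.prems _ n] by simp
  show ?case
  proof (rule ccontr)
    assume "f (pin_of x) \<noteq> ?c x"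
    then have lt: "f (pin_of x) < ?c x" using le by simp
    then have "f (pin_of x) \<in> ?c ` slots" unfolding slot_col_image using n by simp
    then obtain y where y: "y \<in> slots" "f (pin_of x) = ?c y" by auto
    then have eq: "f (pin_of y) = f (pin_of x)" using less.hyps lt by simp
    have "x \<noteq> y" using y lt by auto
    then have "pin_of x \<noteq> pin_of y" using less.prems y pin_of_inj by (auto dest: inj_onD)
    moreover have "meets (pin_of x) (pin_of y)"
      using pin_lft[OF y(1)] pin_rgt[OF y(1)] pin_lft[OF less.prems] pin_rgt[OF less.prems]
      by (simp add: meets_def)
    ultimately show False using f_neq valid_slots less.prems y eq by metis
  qed
qed

lemma mid_inj: "inj_on (\<lambda>x. f (mid_of x)) slots"
proof (rule inj_onI, rule ccontr)
  fix x y assume xy: "x \<in> slots" "y \<in> slots" "f (mid_of x) = f (mid_of y)" "x \<noteq> y"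
  then have "mid_of x \<noteq> mid_of y" using mid_of_inj by (auto dest: inj_onD)
  moreover have "meets (mid_of x) (mid_of y)"
    using mid_lft[of x] mid_lft[of y] mid_rgt[of x] mid_rgt[of y] xy by (simp add: meets_def)
  ultimately show False using xy f_neq valid_slots by metis
qed

lemma mid_color:
  assumes "x \<in> slots"
  obtains y where "y \<in> slots" "ev_mid y = ev_mid x" "f (mid_of x) = (\<lambda>(l, i, s). col l i s) y"
proof -
  have eq: "f (pin_of y) = (\<lambda>(l, i, s). col l i s) y" if "y \<in> slots" for y
    using that by (rule pin_color)
  have "\<exists>y\<in>slots. ev_mid y = ev_mid x \<and> f (mid_of x) = f (pin_of y)"
  proof (rule generation[where n = ncol])
    show "inj_on (\<lambda>x. f (pin_of x)) slots"
      using slot_col_inj eq by (simp cong: inj_on_cong)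
    show "(\<lambda>x. f (pin_of x)) ` slots = {..<ncol}"
      using slot_col_image eq by (simp cong: image_cong)
    show "f (mid_of y) \<noteq> f (pin_of z)" if "y \<in> slots" "z \<in> slots" "ev_mid y < ev_mid z" for y z
    proof (rule f_neq)
      show "mid_of y \<noteq> pin_of z" by (cases y; cases z) auto
    qed (use that valid_slots mid_event in auto)
    show "f (mid_of y) < ncol" if "y \<in> slots" for y
      by (rule bound[OF valid_slots(2)[OF that]])
  qed (rule finite_slots mid_inj assms)+
  then show ?thesis using eq that by metis
qed

lemma last_color:
  assumes "x \<in> slots"
  obtains y where "y \<in> slots" "ev_last y = ev_last x" "f (last_of x) = f (mid_of y)"
proof -
  have im: "(\<lambda>x. f (mid_of x)) ` slots = {..<ncol}"
  proof (rule card_subset_eq)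
    show "(\<lambda>x. f (mid_of x)) ` slots \<subseteq> {..<ncol}" using bound valid_slots by auto
    have "card slots = ncol" using card_image[OF slot_col_inj] slot_col_image by simp
    then show "card ((\<lambda>x. f (mid_of x)) ` slots) = card {..<ncol}"
      using card_image[OF mid_inj] by simp
  qed simp
  have "\<exists>y\<in>slots. ev_last y = ev_last x \<and> f (last_of x) = f (mid_of y)"
  proof (rule generation[where n = ncol])
    show "inj_on (\<lambda>x. f (last_of x)) slots"
    proof (rule inj_onI, rule ccontr)
      fix x y assume xy: "x \<in> slots" "y \<in> slots" "f (last_of x) = f (last_of y)" "x \<noteq> y"
      then have "last_of x \<noteq> last_of y" using last_of_inj by (auto dest: inj_onD)
      moreover have lt: "lft (last_of z) < tD" if "z \<in> slots" for z
      proof (cases "fst (snd z) = Suc K")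
        case True
        \<comment> \<open>Holes belong to the second and to the third generation.\<close>
        then have "last_of z = mid_of z" using that by (cases z) (auto simp: slots_def)
        then show ?thesis using mid_lft[OF that] times_chain by simp
      next
        case False
        then show ?thesis using last_lft[OF that] by (cases z) auto
      qed
      then have "meets (last_of x) (last_of y)"
        using last_rgt[OF xy(1)] last_rgt[OF xy(2)] lt[OF xy(1)] lt[OF xy(2)] by (simp add: meets_def)
      ultimately show False using xy f_neq valid_slots by metis
    qed
    show "f (last_of y) \<noteq> f (mid_of z)" if "y \<in> slots" "z \<in> slots" "ev_last y < ev_last z" for y z
    proof -
      \<comment> \<open>Holes have the latest event \<open>tD\<close>, so nothing can come after
        them. Hence \<open>last_of y\<close> is new at this point and differs from
        \<open>mid_of z\<close>.\<close>
      have "fst (snd y) \<noteq> Suc K"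
      proof
        assume "fst (snd y) = Suc K"
        then have "tD < ev_last z" using that by (cases y) auto
        then show False using that times_chain lit_pair_upper[of "fst z"] cst_upper[of "fst (snd z)"]
          by (cases z) (auto simp: slots_def split: if_splits)
      qed
      then have "lft (mid_of z) < lft (last_of y)"
        using last_lft[OF that(1)] mid_lft[OF that(2)] by (cases y) auto
      then have "last_of y \<noteq> mid_of z" by auto
      then show ?thesis using that valid_slots last_event by (intro f_neq) auto
    qed
    show "f (last_of y) < ncol" if "y \<in> slots" for y
      by (rule bound[OF valid_slots(3)[OF that]])
  qed (rule finite_slots mid_inj im assms)+
  then show ?thesis using that by metis
qed

lemma ev_mid_block:
  assumes "x \<in> slots" "y \<in> slots" "ev_mid x = ev_mid y"
  shows "fst x = fst y"
proof -
  obtain l i s l' i' s' where xy: "x = (l, i, s)" "y = (l', i', s')" by (metis prod_cases3)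
  have "\<not> l < l'" using blk_less[of l l'] assms by (auto simp: xy slots_def bsize_def split: if_splits)
  moreover have "\<not> l' < l" using blk_less[of l' l] assms by (auto simp: xy slots_def bsize_def split: if_splits)
  ultimately show ?thesis by (simp add: xy)
qed

lemma low_color:
  assumes "l < lits" "i \<le> K"
  shows "f (Low l i) = col l i 1"
proof -
  have x: "(l, i, 1) \<in> slots" using assms by (auto simp: slots_def)
  obtain y where y: "y \<in> slots" "ev_mid y = ev_mid (l, i, 1)"
    "f (mid_of (l, i, 1)) = (\<lambda>(l, i, s). col l i s) y" using mid_color[OF x] .
  then have "fst y = l" using ev_mid_block[OF y(1) x y(2)] by simp
  then have "y = (l, i, 1)" using y(1,2) assms
    by (cases y) (auto simp: slots_def split: if_splits, presburger+)
  then show ?thesis using y(3) by simp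
qed

lemma high_color:
  assumes "l < lits" "i < K"
  shows "f (High l i) = col l i 2"
proof -
  have x: "(l, i, 2) \<in> slots" using assms by (auto simp: slots_def)
  obtain y where y: "y \<in> slots" "ev_mid y = ev_mid (l, i, 2)"
    "f (mid_of (l, i, 2)) = (\<lambda>(l, i, s). col l i s) y" using mid_color[OF x] .
  then have "fst y = l" using ev_mid_block[OF y(1) x y(2)] by simp
  then have "y = (l, i, 2)" using y(1,2) assms
    by (cases y) (auto simp: slots_def split: if_splits, presburger+)
  then show ?thesis using y(3) by simp
qed

lemma group_color:
  assumes "x = (l, i, 0) \<or> x = (l, K, 2)" "x \<in> slots"
  shows "(\<exists>i'\<le>Suc K. f (mid_of x) = col l i' 0) \<or> f (mid_of x) = col l K 2"
proof -
  obtain y where y: "y \<in> slots" "ev_mid y = ev_mid x"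
    "f (mid_of x) = (\<lambda>(l, i, s). col l i s) y" using mid_color[OF assms(2)] .
  then have "fst y = l" using ev_mid_block[OF y(1) assms(2) y(2)] assms(1) by auto
  moreover have "ev_mid x = blk l + (2 * K + 1)" using assms(1) by auto
  ultimately have "snd (snd y) = 0 \<or> snd y = (K, 2)" using y(1,2)
    by (cases y) (auto simp: slots_def split: if_splits; presburger)
  then show ?thesis using y \<open>fst y = l\<close> by (cases y) (auto simp: slots_def)
qed

lemma lit_color:
  assumes "l < lits" "i \<le> K"
  obtains p where "p \<le> Suc K" "f (Lit l i) = col l p 0"
proof -
  have x: "(l, i, 0) \<in> slots" "(l, K, 2) \<in> slots" using assms by (auto simp: slots_def)
  have "meets (Lit l i) (Pin l K 2)"
    using pin_lft[OF x(2)] mid_rgt[OF x(1)] times_chain assms by (auto simp: meets_def)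
  then have "f (Lit l i) \<noteq> f (Pin l K 2)" using assms by (intro f_neq) auto
  then have "f (Lit l i) \<noteq> col l K 2" using pin_color[OF x(2)] by simp
  then show ?thesis using group_color[of "(l, i, 0)" l i] x assms that by auto
qed

lemma lit_mono:
  assumes "l < lits" "i < K"
  shows "f (Lit l i) < f (Lit l (Suc i))"
proof -
  have x: "(l, i, 0) \<in> slots" "(l, Suc i, 0) \<in> slots" using assms by (auto simp: slots_def)
  have "rgt (Lit l (Suc i)) \<le> rgt (Lit l i)"
  proof (cases "Suc i < K")
    case True
    then show ?thesis using cst_less[of i "Suc i"] assms by auto
  next
    case False
    then have "Suc i = K" using assms by simp
    then show ?thesis using cst_lower[of i] lit_pair_upper[of l] assms by auto
  qed
  then have "conts (Lit l i) (Lit l (Suc i))" by (simp add: conts_def)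
  moreover have "meets (Lit l i) (Lit l (Suc i))"
    using mid_lft[OF x(1)] mid_lft[OF x(2)] mid_rgt[OF x(1)] mid_rgt[OF x(2)] assms
    by (simp add: meets_def)
  ultimately show ?thesis using assms by (intro f_less) auto
qed

definition up :: "nat \<Rightarrow> bool" where "up l \<longleftrightarrow> f (Lit l K) = col l (Suc K) 0"

text \<open>A level above the separator \<open>col l q 1\<close> is at least \<open>q + 1\<close>.
  Since colors strictly increase along the nested copies, the lead of one level persists up to copy
  \<open>K\<close>, where it is the top level.\<close>

lemma up_if_above:
  assumes l: "l < lits" and "q \<le> K" and above: "col l q 1 < f (Lit l q)"
  shows "up l"
proof -
  have "col l (Suc i) 0 \<le> f (Lit l i)" if "q \<le> i" "i \<le> K" for i
    using that
  proof (induction i rule: dec_induct)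
    case base
    obtain p where p: "f (Lit l q) = col l p 0" using lit_color[OF l, of q] assms by auto
    then have "Suc q \<le> p" using above by (simp add: col_same)
    then show ?case by (simp add: p col_def)
  next
    case (step i)
    then have "col l (Suc i) 0 < f (Lit l (Suc i))" using lit_mono[OF l, of i] by fastforce
    moreover obtain p where p: "f (Lit l (Suc i)) = col l p 0"
      using lit_color[OF l, of "Suc i"] step by auto
    ultimately have "Suc (Suc i) \<le> p" by (simp add: col_same)
    then show ?case by (simp add: p col_def)
  qed
  then have "col l (Suc K) 0 \<le> f (Lit l K)" using assms by simp
  moreover obtain p where "p \<le> Suc K" "f (Lit l K) = col l p 0" using lit_color[OF l, of K] by auto
  ultimately show ?thesis unfolding up_def by (simp add: col_def)
qed

text \<open>Pair events are 0 or 5 modulo 6, which separates both the pairs and the two kinds of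
  event.\<close>

lemma six_cases:
  fixes a b :: nat
  shows "6 * a + (if Q then 5 else 0) = 6 * b + 5 \<Longrightarrow> Q \<and> a = b"
    and "6 * a + (if Q then 5 else 0) = 6 * b \<Longrightarrow> \<not> Q \<and> a = b"
proof -
  show "Q \<and> a = b" if "6 * a + (if Q then 5 else 0) = 6 * b + 5"
  proof (cases Q)
    case False
    then have "6 * a = 6 * b + 5" using that by simp
    then have False by presburger
    then show ?thesis ..
  qed (use that in simp)
  show "\<not> Q \<and> a = b" if "6 * a + (if Q then 5 else 0) = 6 * b"
  proof (cases Q)
    case True
    then have "6 * a + 5 = 6 * b" using that by simp
    then have False by presburger
    then show ?thesis ..
  qed (use that in simp)
qed

lemma event_last_tokens:
  assumes "y \<in> slots" "l < lits"
  shows "q < K \<Longrightarrow> ev_last y = cst q + lits \<Longrightarrow> \<exists>l'<lits. y = (l', q, 0) \<or> y = (l', q, 2)"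
    and "q < K \<Longrightarrow> ev_last y = cst q + l \<Longrightarrow> y = (l, q, 1)"
    and "ev_last y = tB + 6 * (l div 2) + 5 \<Longrightarrow> y = (2 * (l div 2), K, 2)"
    and "ev_last y = tB + 6 * (l div 2) \<Longrightarrow>
      y \<in> {(2 * (l div 2), K, 0), (2 * (l div 2), K, 1), (Suc (2 * (l div 2)), K, 0),
        (Suc (2 * (l div 2)), K, 1), (Suc (2 * (l div 2)), K, 2)}"
proof -
  obtain l' i s where y: "y = (l', i, s)" by (metis prod_cases3)
  note bnd = lit_pair_upper[of l] lit_pair_upper[of l'] cst_lower[of i] cst_lower[of q]
    cst_upper[of i] cst_upper[of q] times_chain
  have i: "i < K \<Longrightarrow> q < K \<Longrightarrow> ev_last y = cst q + m \<Longrightarrow> m \<le> lits \<Longrightarrow> i = q" for m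
  proof -
    assume a: "i < K" "q < K" "ev_last y = cst q + m" "m \<le> lits"
    have "\<not> i < q" using cst_less[of i q] a assms by (auto simp: y slots_def split: if_splits)
    moreover have "\<not> q < i" using cst_less[of q i] a assms by (auto simp: y slots_def split: if_splits)
    ultimately show "i = q" by simp
  qed
  show "\<exists>l'<lits. y = (l', q, 0) \<or> y = (l', q, 2)" if "q < K" "ev_last y = cst q + lits"
  proof -
    have "i < K" using that assms bnd by (auto simp: y slots_def split: if_splits)
    then have "i = q" using i that by blast
    then show ?thesis using that assms by (auto simp: y slots_def split: if_splits)
  qed
  show "y = (l, q, 1)" if "q < K" "ev_last y = cst q + l"
  proof -
    have "i < K" using that assms bnd by (auto simp: y slots_def split: if_splits)
    then have "i = q" using i that assms by auto
    then show ?thesis using that assms by (auto simp: y slots_def split: if_splits)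
  qed
  show "y = (2 * (l div 2), K, 2)" if "ev_last y = tB + 6 * (l div 2) + 5"
  proof -
    have "i = K" using that assms bnd by (auto simp: y slots_def split: if_splits)
    moreover have "(even l' \<and> s = 2) \<and> l' div 2 = l div 2"
      using that \<open>i = K\<close> by (intro six_cases) (simp add: y)
    ultimately show ?thesis by (auto simp: y)
  qed
  show "y \<in> {(2 * (l div 2), K, 0), (2 * (l div 2), K, 1), (Suc (2 * (l div 2)), K, 0),
        (Suc (2 * (l div 2)), K, 1), (Suc (2 * (l div 2)), K, 2)}"
    if "ev_last y = tB + 6 * (l div 2)"
  proof -
    have "i = K" using that assms bnd by (auto simp: y slots_def split: if_splits)
    moreover have "\<not> (even l' \<and> s = 2) \<and> l' div 2 = l div 2"
      using that \<open>i = K\<close> by (intro six_cases) (simp add: y)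
    moreover have "s = 0 \<or> s = 1 \<or> s = 2" using assms by (auto simp: y slots_def)
    ultimately show ?thesis by (cases "even l'") (auto simp: y elim!: evenE oddE)
  qed
qed

lemma guard_color:
  assumes "q < K" "l < lits"
  shows "f (Guard q l) = col l q 1"
proof -
  have x: "(l, q, 1) \<in> slots" "last_of (l, q, 1) = Guard q l" "ev_last (l, q, 1) = cst q + l"
    using assms by (auto simp: slots_def)
  obtain y where y: "y \<in> slots" "ev_last y = ev_last (l, q, 1)" "f (last_of (l, q, 1)) = f (mid_of y)"
    using last_color[OF x(1)] .
  have "y = (l, q, 1)" by (rule event_last_tokens(2)[OF y(1) assms(2,1)]) (use y(2) x(3) in simp)
  then have "f (Guard q l) = f (Low l q)" using y(3) x(2) by simp
  then show ?thesis using low_color assms by simp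
qed

lemma slot_color:
  assumes "q < K" "m \<le> lits" "0 < lits"
  shows "\<exists>l<lits. f (Slot q m) = f (Lit l q) \<or> f (Slot q m) = col l q 2"
proof -
  define x :: "nat \<times> nat \<times> nat" where "x = (if m = lits then (0, q, 0) else (m, q, 2))"
  have x: "x \<in> slots" "last_of x = Slot q m" "ev_last x = cst q + lits"
    using assms by (auto simp: x_def slots_def)
  obtain y where y: "y \<in> slots" "ev_last y = ev_last x" "f (last_of x) = f (mid_of y)"
    using last_color[OF x(1)] .
  obtain l where "l < lits" "y = (l, q, 0) \<or> y = (l, q, 2)"
    using event_last_tokens(1)[OF y(1) assms(3,1)] y(2) x by auto
  then show ?thesis using y x high_color[of l q] assms by auto
qed

text \<open>The single time unit by which \<open>inc q l\<close> shortens \<open>Lit l q\<close>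
  decides whether \<open>Slot q (Suc l)\<close> can inherit its color; no earlier slot can.\<close>

lemma lit_slot_meets:
  assumes "q < K" "l < lits" "m \<le> l \<or> m = Suc l \<and> \<not> inc q l"
  shows "f (Slot q m) \<noteq> f (Lit l q)"
proof (rule f_neq)
  have "(l, q, 0) \<in> slots" using assms by (auto simp: slots_def)
  then have "lft (Lit l q) < tB" using mid_lft[of "(l, q, 0)"] assms by simp
  moreover have "tB \<le> rgt (Slot q m)" using cen_lower[of q] times_chain by simp
  ultimately show "meets (Slot q m) (Lit l q)" using assms by (auto simp: meets_def)
qed (use assms in auto)

text \<open>Pigeonhole: the \<open>lits + 1\<close> slots meet pairwise, but the highs release only
  \<open>lits\<close> colors, so some \<open>Slot q m\<close> takes the color of a copy
  \<open>Lit l q\<close>. Timing gives \<open>l < m\<close>. The slot lies inside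
  \<open>Guard q (m - 1)\<close> and so exceeds \<open>col (m - 1) q 1\<close>, which rules out all
  literals before \<open>m - 1\<close>. Thus \<open>l = m - 1\<close>; timing now yields membership,
  and being above the guard yields truth.\<close>

lemma clause_up:
  assumes q: "q < K" and pos: "0 < lits"
  shows "\<exists>l<lits. inc q l \<and> up l"
proof (rule ccontr)
  assume no: "\<not> ?thesis"
  have "f (Slot q m) \<in> (\<lambda>l. col l q 2) ` {..<lits}" if m: "m \<le> lits" for m
  proof (rule ccontr)
    assume nin: "f (Slot q m) \<notin> (\<lambda>l. col l q 2) ` {..<lits}"
    then obtain l where l: "l < lits" "f (Slot q m) = f (Lit l q)"
      using slot_color[OF q m pos] by auto
    then have "\<not> (m \<le> l \<or> m = Suc l \<and> \<not> inc q l)" using lit_slot_meets[OF q l(1)] by metis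
    then have lt: "l < m" "m = Suc l \<Longrightarrow> inc q l" by auto
    then obtain m' where m': "m = Suc m'" by (cases m) auto
    have g: "f (Guard q m') < f (Slot q (Suc m'))"
    proof (rule f_less)
      show "meets (Guard q m') (Slot q (Suc m'))" "conts (Guard q m') (Slot q (Suc m'))"
        using m m' cst_upper[OF q] cen_lower[of q] times_chain by (auto simp: meets_def conts_def)
    qed (use q m m' in auto)
    obtain p where p: "p \<le> Suc K" "f (Lit l q) = col l p 0" using lit_color[OF l(1), of q] q by auto
    have "col m' q 1 < col l p 0" using g l p m' m q guard_color[of q m'] by simp
    moreover have "l < m' \<Longrightarrow> col l p 0 < col m' q 1"
      using p by (intro col_block) (auto simp: bsize_def)
    ultimately have "l = m'" using lt m' by (metis less_antisym less_asym')
    then show False using up_if_above[OF l(1), of q] no lt m' l p \<open>col m' q 1 < col l p 0\<close> q by auto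
  qed
  then have "(\<lambda>m. f (Slot q m)) ` {..lits} \<subseteq> (\<lambda>l. col l q 2) ` {..<lits}" by auto
  then have "card ((\<lambda>m. f (Slot q m)) ` {..lits}) \<le> card ((\<lambda>l. col l q 2) ` {..<lits})"
    by (intro card_mono) auto
  also have "\<dots> \<le> lits" using card_image_le[of "{..<lits}" "\<lambda>l. col l q 2"] by simp
  finally have "card ((\<lambda>m. f (Slot q m)) ` {..lits}) \<le> lits" .
  moreover have "inj_on (\<lambda>m. f (Slot q m)) {..lits}"
  proof (rule inj_onI, rule ccontr)
    fix m m' assume mm: "m \<in> {..lits}" "m' \<in> {..lits}" "f (Slot q m) = f (Slot q m')" "m \<noteq> m'"
    then have "meets (Slot q m) (Slot q m')"
      using cst_upper[OF q] cen_lower[of q] times_chain by (auto simp: meets_def)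
    then show False using f_neq[of "Slot q m" "Slot q m'"] mm q by auto
  qed
  ultimately show False by (simp add: card_image)
qed

text \<open>The colors \<open>q0\<close> and \<open>q1\<close> of the two lows are the scarce
  resource. \<open>PairE\<close> starts when only these are free and uses up one. If both literals
  are up, \<open>o1\<close> is the largest color of the event, so \<open>PairC2\<close>, which
  contains \<open>PairF2\<close>, cannot have it and takes the other low color. Everything left for
  \<open>PairC1\<close> is above \<open>c0\<close>, although it contains \<open>PairF1\<close> of
  color \<open>c0\<close>.\<close>

lemma pair_not_both:
  assumes j: "j < N"
  shows "\<not> (up (2 * j) \<and> up (Suc (2 * j)))"
proof
  assume up: "up (2 * j) \<and> up (Suc (2 * j))"
  let ?a = "2 * j" and ?b = "Suc (2 * j)"
  have l: "?a < lits" "?b < lits" using j by (auto simp: lits_def)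
  have sl: "(?a, K, 0) \<in> slots" "(?a, K, 1) \<in> slots" "(?a, K, 2) \<in> slots"
    "(?b, K, 0) \<in> slots" "(?b, K, 1) \<in> slots" "(?b, K, 2) \<in> slots"
    using l by (auto simp: slots_def)
  have early: "lft (Lit ?a K) < tB" "lft (Lit ?b K) < tB" "lft (High ?a K) < tB" "lft (High ?b K) < tB"
    using mid_lft[OF sl(1)] mid_lft[OF sl(3)] mid_lft[OF sl(4)] mid_lft[OF sl(6)] by auto
  note bnd = times_chain pair_upper[OF j]
  define o0 o1 q0 q1 c0 c1 where col_defs: "o0 = f (Lit ?a K)" "o1 = f (Lit ?b K)" "q0 = f (Low ?a K)"
    "q1 = f (Low ?b K)" "c0 = f (High ?a K)" "c1 = f (High ?b K)"
  have o: "o0 = col ?a (Suc K) 0" "o1 = col ?b (Suc K) 0" using up by (auto simp: up_def col_defs)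
  have q: "q0 = col ?a K 1" "q1 = col ?b K 1" using l low_color by (auto simp: col_defs)
  have c_tok: "(\<exists>i\<le>Suc K. c0 = col ?a i 0) \<or> c0 = col ?a K 2"
    "(\<exists>i\<le>Suc K. c1 = col ?b i 0) \<or> c1 = col ?b K 2"
    using group_color[of "(?a, K, 2)" ?a] group_color[of "(?b, K, 2)" ?b] sl
    by (auto simp: col_defs(5,6))
  \<comment> \<open>Level \<open>K + 1\<close> is the largest color of a literal.\<close>
  then have c: "c0 \<le> o0" "c1 \<le> o1" by (auto simp: o col_def)
  have neq: "o0 \<noteq> c0" "o1 \<noteq> c1"
    unfolding col_defs using mid_rgt[OF sl(1)] mid_rgt[OF sl(3)] mid_rgt[OF sl(4)] mid_rgt[OF sl(6)] early l
    by (intro f_neq; simp add: meets_def)+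
  have "col ?a (Suc K) 0 < col ?b i s" for i s by (rule col_block) (auto simp: bsize_def)
  then have "o0 < o1" "o0 < c1" using c_tok(2) by (auto simp: o)
  moreover have "q1 < o1" by (simp add: o q col_same)
  ultimately have ord: "c0 < o0" "c1 < o1" "q1 < o1" "o0 < o1" "o0 < c1"
    using c neq by auto
  have main: "f v \<in> {o0, o1, q0, q1, c1}" if v: "v = last_of x" "x \<in> slots" "ev_last x = tB + 6 * j" for v x
  proof -
    obtain y where y: "y \<in> slots" "ev_last y = ev_last x" "f (last_of x) = f (mid_of y)"
      using last_color[OF v(2)] .
    then show ?thesis using event_last_tokens(4)[OF y(1) l(1)] v by (auto simp: col_defs)
  qed
  have mE: "f (PairE j) \<in> {o0, o1, q0, q1, c1}" using main[of _ "(?a, K, 1)"] sl by simp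
  have mC2: "f (PairC2 j) \<in> {o0, o1, q0, q1, c1}" using main[of _ "(?b, K, 1)"] sl by simp
  have mF2: "f (PairF2 j) \<in> {o0, o1, q0, q1, c1}" using main[of _ "(?b, K, 2)"] sl by simp
  have mC1: "f (PairC1 j) \<in> {o0, o1, q0, q1, c1}" using main[of _ "(?a, K, 0)"] sl by simp
  have F1: "f (PairF1 j) = c0"
  proof -
    obtain y where y: "y \<in> slots" "ev_last y = ev_last (?a, K, 2)" "f (last_of (?a, K, 2)) = f (mid_of y)"
      using last_color[OF sl(3)] .
    then have "y = (?a, K, 2)" using event_last_tokens(3)[OF y(1) l(1)] by simp
    then show ?thesis using y(3) by (simp add: col_defs)
  qed
  have E: "f (PairE j) \<noteq> o0" "f (PairE j) \<noteq> o1" "f (PairE j) \<noteq> c1"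
    unfolding col_defs using early bnd l j by (intro f_neq; simp add: meets_def)+
  have C2: "f (PairC2 j) \<noteq> o0" "f (PairC2 j) \<noteq> c1" "f (PairC2 j) \<noteq> f (PairE j)"
    "f (PairC2 j) < f (PairF2 j)"
    unfolding col_defs using early bnd l j by (intro f_neq f_less; simp add: meets_def conts_def)+
  have C1: "f (PairC1 j) \<noteq> f (PairE j)" "f (PairC1 j) \<noteq> f (PairC2 j)" "f (PairC1 j) < f (PairF1 j)"
    using early bnd l j by (intro f_neq f_less; simp add: meets_def conts_def)+
  have F2: "f (PairF2 j) \<noteq> o0"
    unfolding col_defs using early bnd l j by (intro f_neq; simp add: meets_def)
  have "q0 < o0" by (simp add: o q col_same)
  have "f (PairF2 j) \<le> o1" using mF2 ord \<open>q0 < o0\<close> by auto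
  then have "f (PairC2 j) \<noteq> o1" using C2 by auto
  then have "{f (PairE j), f (PairC2 j)} = {q0, q1}" using mE mC2 E C2 by auto
  then have "f (PairC1 j) \<in> {o0, o1, c1}" using mC1 C1 by (auto simp: doubleton_eq_iff)
  then show False using C1(3) F1 ord by auto
qed

lemma proper_imp_sat: "sat"
proof (cases "K = 0")
  case False
  have ex: "\<exists>l<lits. inc q l \<and> up l" if "q < K" for q
  proof (rule clause_up[OF that])
    show "0 < lits"
    proof (rule ccontr)
      assume "\<not> 0 < lits"
      then have "ncol = 0" by (simp add: ncol_def)
      then show False using bound[of "Slot q 0"] that by simp
    qed
  qed
  show ?thesis unfolding sat_def
  proof (rule exI[of _ "\<lambda>i. up (2 * i)"], intro allI impI)
    fix q assume "q < K"
    then obtain l where l: "l < lits" "inc q l" "up l" using ex by blast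
    have "up (2 * (l div 2)) = even l"
    proof (cases "even l")
      case False
      have "l div 2 < N" using l by (simp add: lits_def less_mult_imp_div_less mult.commute)
      then show ?thesis using pair_not_both[of "l div 2"] l False by (auto elim!: oddE)
    qed (use l in auto)
    then show "\<exists>l<lits. inc q l \<and> up (2 * (l div 2)) = even l" using l by blast
  qed
next
  case True
  then show ?thesis unfolding sat_def by (intro exI[of _ "\<lambda>_. True"]) simp
qed

end
end

subsection \<open>Assignments give colorings\<close>

context gadget
begin

context
  fixes a :: "nat \<Rightarrow> bool" and pick :: "nat \<Rightarrow> nat"
begin

definition tr :: "nat \<Rightarrow> bool" where "tr l \<longleftrightarrow> a (l div 2) = even l"

definition lev :: "nat \<Rightarrow> nat \<Rightarrow> nat" where "lev l i = (if tr l then Suc i else i)"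

text \<open>A true literal leaves level 0 to its hole, a false one level \<open>K + 1\<close>. In a
  pair, the low color of the positive literal goes to the test of whichever literal is true:
  \<open>PairC1\<close> for the positive and \<open>PairC2\<close> for the negative one. In a clause
  the slots run through the colors of the highs in increasing order, with the level of the chosen
  literal inserted directly after its own high.\<close>

fun place :: "item \<Rightarrow> nat \<times> nat \<times> nat" where
  "place (Pin l i s) = (l, i, s)"
| "place (Pad c j) = (0, 0, 0)"
| "place (Low l i) = (l, i, 1)"
| "place (High l i) = (l, i, 2)"
| "place (Lit l i) = (l, lev l i, 0)"
| "place (Hole l) = (l, if tr l then 0 else Suc K, 0)"
| "place (PairE j) = (Suc (2 * j), K, 1)"
| "place (PairC2 j) = (if a j then (Suc (2 * j), K, 0) else (2 * j, K, 1))"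
| "place (PairF2 j) = (Suc (2 * j), K, 2)"
| "place (PairC1 j) = (2 * j, K, if a j then 1 else 0)"
| "place (PairD j) = (if a j then 2 * j else Suc (2 * j), Suc K, 0)"
| "place (PairF1 j) = (2 * j, K, 2)"
| "place (Guard q l) = (l, q, 1)"
| "place (Slot q m) =
     (if m \<le> pick q then (m, q, 2)
      else if m = Suc (pick q) then (pick q, lev (pick q) q, 0) else (m - 1, q, 2))"
| "place (Rest q j) = (let l = (if j < pick q then j else Suc j) in (l, lev l q, 0))"

text \<open>Stages 1 to 3 are the generations; a hole counts for the one in which it starts.\<close>

fun stage :: "item \<Rightarrow> nat" where
  "stage (Pin l i s) = 1"
| "stage (Pad c j) = 0"
| "stage (Low l i) = 2"
| "stage (High l i) = 2"
| "stage (Lit l i) = 2"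
| "stage (Hole l) = 2"
| "stage v = 3"

definition honest :: "item \<Rightarrow> nat" where
  "honest v = (case v of Pad c j \<Rightarrow> j | _ \<Rightarrow> (\<lambda>(l, i, s). col l i s) (place v))"

lemma tr_pair: "tr (2 * j) = a j" "tr (Suc (2 * j)) = (\<not> a j)"
  by (auto simp: tr_def)

lemma honest_place: "stage v \<noteq> 0 \<Longrightarrow> honest v = (\<lambda>(l, i, s). col l i s) (place v)"
  by (cases v) (auto simp: honest_def)

context
  assumes pick: "\<And>q. q < K \<Longrightarrow> pick q < lits \<and> inc q (pick q) \<and> tr (pick q)"
begin

lemma place_slots:
  assumes "valid v" "stage v \<noteq> 0"
  shows "place v \<in> slots"
proof (cases v)
  case (Slot q m)
  then show ?thesis using assms pick[of q] by (auto simp: slots_def lev_def)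
next
  case (Rest q j)
  then show ?thesis using assms pick[of q] by (auto simp: slots_def lev_def Let_def)
qed (use assms in \<open>auto simp: slots_def lev_def lits_def\<close>)

lemma honest_less: "valid v \<Longrightarrow> honest v < ncol"
proof (cases "stage v = 0")
  case True
  assume "valid v"
  then show ?thesis using True by (cases v) (auto simp: honest_def)
next
  case False
  assume "valid v"
  then have "(\<lambda>(l, i, s). col l i s) (place v) \<in> (\<lambda>(l, i, s). col l i s) ` slots"
    using False place_slots by (intro imageI) auto
  then show ?thesis using False by (simp add: honest_place slot_col_image)
qed

lemma honest_eq_iff:
  assumes "valid v" "valid w" "stage v \<noteq> 0" "stage w \<noteq> 0"
  shows "honest v = honest w \<longleftrightarrow> place v = place w"
proof
  assume "honest v = honest w"
  then have "(\<lambda>(l, i, s). col l i s) (place v) = (\<lambda>(l, i, s). col l i s) (place w)"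
    using honest_place[OF assms(3)] honest_place[OF assms(4)] by metis
  then show "place v = place w"
    by (rule inj_onD[OF slot_col_inj]) (use assms place_slots in auto)
next
  assume "place v = place w"
  then show "honest v = honest w" using honest_place[OF assms(3)] honest_place[OF assms(4)] by metis
qed

text \<open>Inverse of \<open>place\<close> on the second generation: the owner of a given color at
  time \<open>tB\<close>.\<close>

definition mid_at :: "nat \<times> nat \<times> nat \<Rightarrow> item" where
  "mid_at = (\<lambda>(l, i, s). if s = 1 then Low l i else if s = 2 then High l i
      else if i = (if tr l then 0 else Suc K) then Hole l else Lit l (if tr l then i - 1 else i))"

lemma mid_at_place: "valid v \<Longrightarrow> stage v = 2 \<Longrightarrow> mid_at (place v) = v"
  by (cases v) (auto simp: mid_at_def lev_def)

lemma place_mid_inj: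
  assumes "valid v" "valid w" "stage v = 2" "stage w = 2" "place v = place w"
  shows "v = w"
  using mid_at_place[OF assms(1,3)] mid_at_place[OF assms(2,4)] assms(5) by metis

lemma place_last_inj:
  assumes "valid v" "valid w" "stage v = 3" "stage w = 3" "place v = place w"
  shows "v = w"
proof -
  \<comment> \<open>\<open>g\<close> inverts \<open>place\<close> on the third generation. A level
    does not show its copy directly: for a true literal, level \<open>i\<close> belongs to copy
    \<open>i - 1\<close>, hence \<open>p\<close>.\<close>
  define g :: "nat \<times> nat \<times> nat \<Rightarrow> item" where "g = (\<lambda>(l, i, s). if s = 1 then (if i < K then Guard i l else if odd l then PairE (l div 2)
        else if a (l div 2) then PairC1 (l div 2) else PairC2 (l div 2))
      else if s = 2 then (if i < K then Slot i (if l \<le> pick i then l else Suc l)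
        else if odd l then PairF2 (l div 2) else PairF1 (l div 2))
      else let p = (if tr l then i - 1 else i) in
        if p < K then (if l = pick p then Slot p (Suc l) else Rest p (if l < pick p then l else l - 1))
        else if odd l then (if a (l div 2) then PairC2 (l div 2) else PairD (l div 2))
        else if a (l div 2) then PairD (l div 2) else PairC1 (l div 2))"
  have g: "g (place u) = u" if "valid u" "stage u = 3" for u
  proof (cases u)
    case (Slot q m)
    then show ?thesis using that pick[of q] by (auto simp: g_def lev_def)
  next
    case (Rest q j)
    then show ?thesis using that pick[of q] by (auto simp: g_def lev_def Let_def)
  qed (use that in \<open>auto simp: g_def tr_pair\<close>)
  have "v = g (place v)" by (rule g[OF assms(1,3), symmetric])
  also have "\<dots> = g (place w)" using assms(5) by (simp only:)
  also have "\<dots> = w" by (rule g[OF assms(2,4)])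
  finally show ?thesis .
qed

lemma pin_mid_disjoint:
  assumes "valid w" "stage w = 2" "place (Pin l i s) = place w"
  shows "rgt (Pin l i s) < lft w"
proof -
  have "l < lits" using place_slots[of w] assms by (auto simp: slots_def)
  \<comment> \<open>Positivity matters for \<open>Pin l 0 1\<close>: its right end
    \<open>blk l - 1\<close> is a truncated difference that must lie below
    \<open>blk l\<close>.\<close>
  have "0 < tA" using \<open>l < lits\<close> by (auto simp: tA_def wid_def ncol_def bsize_def)
  then have "0 < blk l" using blk_lower[of l] by simp
  then show ?thesis using assms by (cases w) (auto simp: lev_def split: if_splits)
qed

text \<open>The previous owner of the color is found by \<open>mid_at\<close> and has ended before
  the new item starts. For the slot behind the chosen literal this is where
  \<open>inc q (pick q)\<close> is needed.\<close>

lemma mid_last_disjoint: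
  assumes "valid v" "valid w" "stage v = 2" "stage w = 3" "place v = place w"
  shows "rgt v < lft w"
proof -
  have "rgt (mid_at (place w)) < lft w"
  proof (cases w)
    case (Slot q m)
    then have "pick q < lits \<and> inc q (pick q) \<and> tr (pick q)" using pick assms by auto
    then show ?thesis using assms Slot by (auto simp: mid_at_def lev_def)
  next
    case (Rest q j)
    then show ?thesis using assms pick[of q] by (auto simp: mid_at_def lev_def Let_def)
  qed (use assms(2,4) in \<open>auto simp: mid_at_def tr_pair\<close>)
  then show ?thesis using mid_at_place[OF assms(1,3)] assms(5) by metis
qed

section \<open>Containments among the colored intervals\<close>

lemma stage_bounds:
  assumes "valid v"
  shows "stage v = 1 \<Longrightarrow> lft v < tA \<and> tA \<le> Suc (rgt v) \<and> rgt v < tB"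
    and "stage v = 2 \<Longrightarrow> tA \<le> lft v \<and> lft v < tB \<and> tB \<le> rgt v \<and> rgt v < tE"
    and "stage v = 3 \<Longrightarrow> tB < lft v \<and> lft v < tD \<and> tE \<le> rgt v"
    and "stage v = 0 \<Longrightarrow> rgt v < tA"
proof -
  show "lft v < tA \<and> tA \<le> Suc (rgt v) \<and> rgt v < tB" if "stage v = 1"
  proof -
    from that obtain l i s where v: "v = Pin l i s" by (cases v) auto
    then have x: "(l, i, s) \<in> slots" using assms by (auto simp: slots_def)
    show ?thesis using pin_lft[OF x] pin_rgt[OF x] v assms blk_upper[of l]
      by (auto simp: bsize_def)
  qed
  show "tA \<le> lft v \<and> lft v < tB \<and> tB \<le> rgt v \<and> rgt v < tE" if "stage v = 2"
  proof -
    have x: "tA \<le> lft v \<and> lft v < tB" if "v = mid_of x" "x \<in> slots" for x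
      using mid_lft[OF that(2)] that(1) by simp
    have y: "tB \<le> rgt v" if "v = mid_of x" "x \<in> slots" for x
      using mid_rgt[OF that(2)] that(1) by simp
    show ?thesis
    proof (cases v)
      case (Low l i)
      then show ?thesis using assms x[of "(l, i, 1)"] y[of "(l, i, 1)"] cst_upper[of i]
          lit_pair_upper[of l] times_chain by (auto simp: slots_def)
    next
      case (High l i)
      then show ?thesis using assms x[of "(l, i, 2)"] y[of "(l, i, 2)"] cst_upper[of i]
          lit_pair_upper[of l] times_chain by (auto simp: slots_def)
    next
      case (Lit l i)
      then show ?thesis using assms x[of "(l, i, 0)"] y[of "(l, i, 0)"] cst_upper[of i]
          lit_pair_upper[of l] times_chain by (auto simp: slots_def)
    next
      case (Hole l)
      then show ?thesis using assms x[of "(l, Suc K, 0)"] y[of "(l, Suc K, 0)"] times_chain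
        by (auto simp: slots_def)
    qed (use that in auto)
  qed
  show "tB < lft v \<and> lft v < tD \<and> tE \<le> rgt v" if "stage v = 3"
  proof (cases v)
    case (Guard q l)
    then show ?thesis using assms cst_lower[of q] cst_upper[of q] cen_lower[of q] times_chain by auto
  next
    case (Slot q m)
    then show ?thesis using assms pick[of q] cst_lower[of q] cst_upper[of q] cen_lower[of q] times_chain by auto
  next
    case (Rest q j)
    then show ?thesis using assms cst_lower[of q] cst_upper[of q] cen_lower[of q] times_chain by auto
  qed (use that assms times_chain in auto)
  show "rgt v < tA" if "stage v = 0"
  proof -
    from that obtain c j where v: "v = Pad c j" by (cases v) auto
    then have "c * wid + wid \<le> tA" using mult_less_step[of c ncol wid] assms by (simp add: tA_def)
    then show ?thesis using v assms by (simp add: wid_def)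
  qed
qed

text \<open>Between literals, the order of left ends agrees with the order of color blocks. Within a
  literal the hole starts and ends last and is in no containment; intervals of equal index overlap,
  and only a smaller index can contain a larger one, where the colors increase because all copies
  have the same truth value.\<close>

lemma mid_nested:
  assumes "valid v" "valid w" "stage v = 2" "stage w = 2" "v \<noteq> w" "conts v w"
  shows "honest v < honest w"
proof -
  obtain l i s where v: "place v = (l, i, s)" by (metis prod_cases3)
  obtain l' i' s' where w: "place w = (l', i', s')" by (metis prod_cases3)
  have sl: "(l, i, s) \<in> slots" "(l', i', s') \<in> slots"
    using place_slots[of v] place_slots[of w] assms v w by auto
  have b: "blk l \<le> lft v" "lft v < blk l + bsize" "blk l' \<le> lft w" "lft w < blk l' + bsize"
    using assms v w by (cases v; auto simp: bsize_def; fail | cases w; auto simp: bsize_def; fail)+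
  have le: "lft v \<le> lft w" "rgt w \<le> rgt v" using assms by (auto simp: conts_def)
  have "\<not> l' < l" using blk_less[of l' l] b le by auto
  then consider "l < l'" | "l = l'" by linarith
  then have "col l i s < col l' i' s'"
  proof cases
    case 1
    then show ?thesis using slot_bound[OF sl(1)] by (rule col_block)
  next
    case 2
    have form: "u = Hole l \<or> (\<exists>n\<le>K. u = Low l n \<or> u = High l n \<or> u = Lit l n)"
      if "valid u" "stage u = 2" "fst (place u) = l" for u
      using that by (cases u) auto
    have late: "rgt u < tD" "lft u < lft (Hole l)"
      if "valid u" "u = Low l n \<or> u = High l n \<or> u = Lit l n" for u n
      using that cst_upper[of n] times_chain lit_pair_upper[of l] by auto
    have "v \<noteq> Hole l"
    proof
      assume "v = Hole l"
      then show False using form[of w] late[of w] le w 2 assms by fastforce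
    qed
    then obtain n where n: "v = Low l n \<or> v = High l n \<or> v = Lit l n" "n \<le> K"
      using form[of v] assms v by auto
    have "w \<noteq> Hole l"
    proof
      assume "w = Hole l"
      then show False using late(1)[OF assms(1) n(1)] le by simp
    qed
    then obtain n' where n': "w = Low l n' \<or> w = High l n' \<or> w = Lit l n'" "n' \<le> K"
      using form[of w] assms w 2 by auto
    have l: "l < lits" using sl by (auto simp: slots_def)
    have "\<not> n' < n"
    proof
      assume lt: "n' < n"
      show False
      proof (cases "n < K")
        case True
        then show False using cst_less[OF lt True] le n n' l lt by auto
      next
        case False
        then have "n = K" using n by simp
        then show False using cst_lower[of n'] lit_pair_upper[OF l] le n n' l lt by auto
      qed
    qed
    moreover have "n \<noteq> n'"
    proof
      assume "n = n'"
      then show False using n(1) n'(1) n(2) le l assms(5)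
        by (cases "n < K"; elim disjE; simp split: if_splits)
    qed
    ultimately have "n < n'" by simp
    then show ?thesis using n n' v w 2 by (auto simp: col_same lev_def split: if_splits)
  qed
  then show ?thesis using v w assms by (simp add: honest_place)
qed

fun event :: "item \<Rightarrow> nat" where
  "event (PairE j) = j"
| "event (PairC2 j) = j"
| "event (PairF2 j) = j"
| "event (PairC1 j) = j"
| "event (PairD j) = j"
| "event (PairF1 j) = j"
| "event (Guard q l) = N + (K - Suc q)"
| "event (Slot q l) = N + (K - Suc q)"
| "event (Rest q l) = N + (K - Suc q)"
| "event v = 0"

text \<open>First started, first ended: this confines containment in the third generation to a
  single pair or clause.\<close>

lemma last_fifo:
  assumes "valid v" "valid w" "stage v = 3" "stage w = 3" "event v < event w"
  shows "lft v < lft w \<and> rgt v < rgt w"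
proof -
  have pr: "tB + 6 * j < lft u \<and> lft u \<le> tB + 6 * j + 6 \<and> tE + 6 * j \<le> rgt u \<and> rgt u < tE + 6 * j + 6"
    if "valid u" "stage u = 3" "event u = j" "j < N" for u j
    using that by (cases u) auto
  have cl: "\<exists>q<K. event u = N + (K - Suc q) \<and> cst q < lft u \<and> lft u \<le> cst q + 3 * lits \<and>
      cen q \<le> rgt u \<and> rgt u < cen q + 3 * lits"
    if "valid u" "stage u = 3" "\<not> event u < N" for u
  proof (cases u)
    case (Slot q m)
    then show ?thesis using that pick[of q] by (intro exI[of _ q]) auto
  next
    case (Guard q m)
    then show ?thesis using that by (intro exI[of _ q]) auto
  next
    case (Rest q m)
    then show ?thesis using that by (intro exI[of _ q]) auto
  qed (use that in auto)
  show ?thesis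
  proof (cases "event w < N")
    case True
    then have "event v < N" using assms by simp
    then show ?thesis
      using pr[OF assms(1,3) refl] pr[OF assms(2,4) refl True] assms(5) by linarith
  next
    case False
    then obtain q where q: "q < K" "event w = N + (K - Suc q)" "cst q < lft w" "cen q \<le> rgt w"
      using cl[of w] assms by auto
    show ?thesis
    proof (cases "event v < N")
      case True
      then show ?thesis using pr[OF assms(1,3) refl True] q cst_lower[of q] cen_lower[of q] times_chain
          pair_upper[OF True] by linarith
    next
      case False
      then obtain q' where q': "q' < K" "event v = N + (K - Suc q')" "lft v \<le> cst q' + 3 * lits"
        "rgt v < cen q' + 3 * lits"
        using cl[of v] assms by auto
      then have "q < q'" using q assms by simp
      then show ?thesis using cst_less[of q q'] cen_less[of q q'] q q' by simp
    qed
  qed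
qed

lemma last_nested:
  assumes "valid v" "valid w" "stage v = 3" "stage w = 3" "v \<noteq> w" "conts v w"
  shows "honest v < honest w"
proof -
  have le: "lft v \<le> lft w" "rgt w \<le> rgt v" using assms by (auto simp: conts_def)
  then have ev: "event v = event w"
    using last_fifo[of v w] last_fifo[of w v] assms by (metis leD linorder_neqE_nat)
  show ?thesis
  proof (cases "event v < N")
    case True
    define j where "j = event v"
    have e: "2 * j div 2 = j" "Suc (2 * j) div 2 = j" by auto
    have blk: "col (2 * j) K s < col (Suc (2 * j)) i' s'" if "s \<le> 2" for s i' s'
      using that by (intro col_block) (auto simp: bsize_def)
    have form: "u \<in> {PairE j, PairC2 j, PairF2 j, PairC1 j, PairD j, PairF1 j}"
      if "stage u = 3" "event u = j" for u
      using that True by (cases u) (auto simp: j_def)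
    have "v \<in> {PairE j, PairC2 j, PairF2 j, PairC1 j, PairD j, PairF1 j}"
      "w \<in> {PairE j, PairC2 j, PairF2 j, PairC1 j, PairD j, PairF1 j}"
      using form[of v] form[of w] ev assms by (simp_all add: j_def)
    then show ?thesis using le assms(5)
      by (auto simp: honest_def col_same blk)
  next
    case False
    then have "\<exists>q<K. \<exists>m. v = Guard q m \<or> v = Slot q m \<or> v = Rest q m"
      using assms by (cases v) auto
    then obtain q where q: "q < K" "\<exists>m. v = Guard q m \<or> v = Slot q m \<or> v = Rest q m" by blast
    have w: "\<exists>m. w = Guard q m \<or> w = Slot q m \<or> w = Rest q m"
      using assms ev q False by (cases w) auto
    have pk: "pick q < lits" "tr (pick q)" using pick q by auto
    have bb: "3 * q + 2 < bsize" "3 * Suc q < bsize" using q by (auto simp: bsize_def)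
    have gl: "col l q 1 < col l' q 2" "col l q 1 < col l' (Suc q) 0" "col l q 2 < col l' (Suc q) 0"
      if "l \<le> l'" for l l'
      using that bb by (cases "l = l'"; simp add: col_same col_block)+
    \<comment> \<open>The slots behind the inserted one hold the high of literal
      \<open>m - 1\<close> instead of \<open>m\<close>, which still lies above every guard
      \<open>l < m\<close>.\<close>
    have gs: "col l q 1 < honest (Slot q m)" if "l < m" for l m
    proof -
      have "l \<le> m" "l \<le> m - 1" "m = Suc (pick q) \<Longrightarrow> l \<le> pick q" using that by auto
      then show ?thesis using pk gl by (auto simp: honest_def lev_def)
    qed
    have ss: "honest (Slot q m) < honest (Slot q m')" if "m < m'" for m m'
      using that pk bb gl(3)[of m "pick q"]
      by (auto simp: honest_def lev_def col_same intro!: col_block gl(3))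
    have gg: "col l q 1 < col l' q 1" if "l < l'" for l l'
      using that bb by (intro col_block) auto
    obtain m m' where m: "v = Guard q m \<or> v = Slot q m \<or> v = Rest q m"
      "w = Guard q m' \<or> w = Slot q m' \<or> w = Rest q m'" using q w by blast
    show ?thesis using m
    proof (elim disjE)
      assume vw: "v = Guard q m" "w = Guard q m'"
      then show ?thesis using le assms gg[of m m'] by (auto simp: honest_def)
    next
      assume vw: "v = Guard q m" "w = Slot q m'"
      then have "m < m'" using le assms by auto
      then show ?thesis using gs vw by (auto simp: honest_def)
    next
      assume vw: "v = Slot q m" "w = Slot q m'"
      then have "m < m'" using le assms by auto
      then show ?thesis using ss vw by auto
    qed (use le assms in auto)
  qed
qed

theorem honest_proper: "proper honest"
  unfolding proper_def
proof (intro allI impI)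
  fix v w assume vw: "valid v" "valid w" "v \<noteq> w" "meets v w"
  have m: "lft v \<le> rgt w" "lft w \<le> rgt v" using vw by (auto simp: meets_def)
  have st: "stage u \<in> {0, 1, 2, 3}" for u by (cases u) auto
  \<comment> \<open>A pin that meets a pad of window \<open>c\<close> starts at the latest in this
    window, so its color is at most \<open>c\<close>, and the pad has \<open>j > c\<close>.\<close>
  have padless: "honest u < honest p" "\<not> conts p u"
    if asm: "valid u" "valid p" "stage p = 0" "stage u = 1" "lft u \<le> rgt p" for u p
  proof -
    obtain c j where p: "p = Pad c j" using asm by (cases p) auto
    obtain l i s where u: "u = Pin l i s" using asm by (cases u) auto
    have "col l i s * wid < c * wid + wid" using asm u p by (simp add: wid_def)
    then have "col l i s < Suc c" by (metis add.commute mult_Suc mult_less_cancel2)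
    then show "honest u < honest p" using asm u p by (simp add: honest_def)
    have "c * wid + wid \<le> tA" using mult_less_step[of c ncol wid] asm p by (simp add: tA_def)
    then have "Suc (rgt p) < tA" using p asm by (auto simp: wid_def)
    then show "\<not> conts p u" using stage_bounds(1)[OF asm(1,4)] by (simp add: conts_def)
  qed
  \<comment> \<open>Two owners of one color in different generations are disjoint. Later generations
    start later and end later, so there is no containment between them.\<close>
  have across: "honest u \<noteq> honest t \<and> \<not> conts u t \<and> \<not> conts t u"
    if asm: "valid u" "valid t" "0 < stage u" "stage u < stage t" "lft t \<le> rgt u" for u t
  proof -
    have "stage u = 1 \<and> stage t = 2 \<or> stage u = 1 \<and> stage t = 3 \<or> stage u = 2 \<and> stage t = 3"
      using asm st[of u] st[of t] by auto
    then show ?thesis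
    proof (elim disjE conjE)
      assume s: "stage u = 1" "stage t = 2"
      then obtain l i s' where u: "u = Pin l i s'" by (cases u) auto
      have "place u \<noteq> place t" using pin_mid_disjoint[of t l i s'] asm s u by auto
      then show ?thesis using asm s stage_bounds[of u] stage_bounds[of t] honest_eq_iff[of u t]
        by (auto simp: conts_def)
    next
      assume s: "stage u = 1" "stage t = 3"
      then show ?thesis using asm stage_bounds[of u] stage_bounds[of t] by auto
    next
      assume s: "stage u = 2" "stage t = 3"
      have "place u \<noteq> place t" using mid_last_disjoint[of u t] asm s by auto
      then show ?thesis using asm s stage_bounds[of u] stage_bounds[of t] honest_eq_iff[of u t]
        by (auto simp: conts_def)
    qed
  qed
  consider "stage v = 0" "stage w = 0" | "stage v = 0" "stage w = 1" | "stage v = 1" "stage w = 0"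
    | "stage v = 0" "2 \<le> stage w" | "2 \<le> stage v" "stage w = 0"
    | "0 < stage v" "stage v < stage w" | "0 < stage w" "stage w < stage v"
    | "stage v = stage w" "0 < stage v" by linarith
  then show "honest v \<noteq> honest w \<and> (conts v w \<longrightarrow> honest v < honest w)"
  proof cases
    case 1
    obtain c j where pv: "v = Pad c j" using 1 by (cases v) auto
    obtain c' j' where pw: "w = Pad c' j'" using 1 by (cases w) auto
    note p = pv pw
    have "c = c'"
    proof (rule ccontr)
      assume "c \<noteq> c'"
      then have "c * wid + wid \<le> c' * wid \<or> c' * wid + wid \<le> c * wid"
        using mult_less_step[of c c' wid] mult_less_step[of c' c wid] by linarith
      then show False using m vw p by (auto simp: wid_def)
    qed
    then show ?thesis using p vw by (auto simp: honest_def conts_def)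
  next
    case 2
    then show ?thesis using padless[of w v] vw m by auto
  next
    case 3
    then show ?thesis using padless[of v w] vw m by auto
  next
    case 4
    then show ?thesis using stage_bounds[of v] stage_bounds[of w] vw m st[of w] times_chain by auto
  next
    case 5
    then show ?thesis using stage_bounds[of v] stage_bounds[of w] vw m st[of v] times_chain by auto
  next
    case 6
    then show ?thesis using across[of v w] vw m by auto
  next
    case 7
    then show ?thesis using across[of w v] vw m by auto
  next
    case 8
    then consider "stage v = 1" | "stage v = 2" | "stage v = 3" using st[of v] by auto
    then show ?thesis
    proof cases
      case 1
      then have s: "stage w = 1" using 8 by simp
      obtain l i s where pv: "v = Pin l i s" using 1 by (cases v) auto
      obtain l' i' s' where pw: "w = Pin l' i' s'" using s by (cases w) auto
      note p = pv pw
      have ne: "honest v \<noteq> honest w" using honest_eq_iff[of v w] vw 1 s p by auto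
      moreover have "conts v w \<Longrightarrow> honest v \<le> honest w"
      proof -
        assume "conts v w"
        then have "col l i s * wid \<le> col l' i' s' * wid" using p by (simp only: conts_def lft.simps)
        moreover have "0 < wid" by (simp add: wid_def)
        ultimately show ?thesis using p by (simp add: honest_def)
      qed
      ultimately show ?thesis by fastforce
    next
      case 2
      then show ?thesis using 8 vw mid_nested[of v w] place_mid_inj[of v w] honest_eq_iff[of v w] by auto
    next
      case 3
      then show ?thesis using 8 vw last_nested[of v w] place_last_inj[of v w] honest_eq_iff[of v w] by auto
    qed
  qed
qed

end
end

lemma sat_imp_proper:
  assumes "sat"
  shows "\<exists>f. proper f \<and> (\<forall>v. valid v \<longrightarrow> f v < ncol)"
proof -
  obtain b where b: "\<forall>q<K. \<exists>l<lits. inc q l \<and> b (l div 2) = even l"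
    using assms unfolding sat_def by blast
  then obtain pick where "\<forall>q<K. pick q < lits \<and> inc q (pick q) \<and> b (pick q div 2) = even (pick q)"
    by metis
  then have "\<And>q. q < K \<Longrightarrow> pick q < lits \<and> inc q (pick q) \<and> tr b (pick q)" by (simp add: tr_def)
  then show ?thesis using honest_proper honest_less by blast
qed

end

subsection \<open>Items as intervals\<close>

text \<open>Replacing each color by its rank among the colors in use keeps all strict inequalities,
  so using at most \<open>k\<close> colors is as good as using colors below
  \<open>k\<close>.\<close>

lemma chromatic_number_le_iff:
  assumes "finite I"
  shows "chromatic_number (containment_graph I) \<le> k \<longleftrightarrow>
    (\<exists>f. proper_coloring (containment_graph I) f \<and> (\<forall>u\<in>I. f u < k))"
proof
  assume le: "chromatic_number (containment_graph I) \<le> k"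
  obtain f0 where "proper_coloring (containment_graph I) f0"
    using containment_graph_colorable[OF assms] by blast
  then have "\<exists>f. proper_coloring (containment_graph I) f \<and>
      card (f ` verts (containment_graph I)) = chromatic_number (containment_graph I)"
    unfolding chromatic_number_def
    by (intro LeastI_ex[where P = "\<lambda>n. \<exists>f. proper_coloring (containment_graph I) f \<and>
      card (f ` verts (containment_graph I)) = n"]) auto
  then obtain f where f: "proper_coloring (containment_graph I) f" "card (f ` I) \<le> k"
    using le by (auto simp: containment_graph_def)
  define g where "g u = card {c \<in> f ` I. c < f u}" for u
  have less: "g u < g v" if "u \<in> I" "f u < f v" for u v
    unfolding g_def using that assms by (intro psubset_card_mono) force+
  have neq: "g u \<noteq> g v" if "u \<in> I" "v \<in> I" "f u \<noteq> f v" for u v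
    using less that by (metis less_irrefl linorder_neqE_nat)
  have "proper_coloring (containment_graph I) g"
    unfolding proper_coloring_def
  proof (intro conjI allI impI)
    fix u v assume e: "{u, v} \<in> edges (containment_graph I)"
    then have "u \<in> I" "v \<in> I" by (auto simp: containment_graph_def doubleton_eq_iff)
    moreover have "f u \<noteq> f v" using f(1) e unfolding proper_coloring_def by blast
    ultimately show "g u \<noteq> g v" by (rule neq)
  next
    fix u v assume e: "(u, v) \<in> arcs (containment_graph I)"
    then have "u \<in> I" by (auto simp: containment_graph_def)
    moreover have "f u < f v" using f(1) e unfolding proper_coloring_def by blast
    ultimately show "g u < g v" by (rule less)
  qed
  moreover have "g u < k" if "u \<in> I" for u
  proof -
    have "g u < card (f ` I)" unfolding g_def using that assms by (intro psubset_card_mono) force+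
    then show ?thesis using f(2) by simp
  qed
  ultimately show "\<exists>f. proper_coloring (containment_graph I) f \<and> (\<forall>u\<in>I. f u < k)" by blast
next
  assume "\<exists>f. proper_coloring (containment_graph I) f \<and> (\<forall>u\<in>I. f u < k)"
  then obtain f where f: "proper_coloring (containment_graph I) f" "f ` I \<subseteq> {..<k}" by auto
  have "chromatic_number (containment_graph I) \<le> card (f ` I)"
    unfolding chromatic_number_def
    by (rule Least_le) (use f in \<open>auto simp: containment_graph_def\<close>)
  also have "\<dots> \<le> k" using card_mono[OF _ f(2)] by simp
  finally show "chromatic_number (containment_graph I) \<le> k" .
qed

section \<open>Items are determined by their left ends\<close>

context gadget begin

text \<open>Mixed-radix address of the left end: zone, block in the zone, offset in the block. It
  shows that left ends are distinct; otherwise two items could merge into one vertex of the graph,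
  or repeat in the instance.\<close>

fun addr :: "item \<Rightarrow> nat \<times> nat \<times> nat" where
  "addr (Pin l i s) = (0, col l i s, 0)"
| "addr (Pad c j) = (0, c, j)"
| "addr (Low l i) = (1, l, 2 * i)"
| "addr (High l i) = (1, l, if i < K then 2 * i + 1 else 3 * K + 2)"
| "addr (Lit l i) = (1, l, 2 * K + 1 + i)"
| "addr (Hole l) = (1, l, 3 * K + 3)"
| "addr (PairE j) = (2, j, 0)"
| "addr (PairC2 j) = (2, j, 1)"
| "addr (PairF2 j) = (2, j, 2)"
| "addr (PairC1 j) = (2, j, 3)"
| "addr (PairD j) = (2, j, 4)"
| "addr (PairF1 j) = (2, j, 5)"
| "addr (Guard q l) = (3, K - Suc q, l)"
| "addr (Slot q m) = (3, K - Suc q, lits + m)"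
| "addr (Rest q j) = (3, K - Suc q, 2 * lits + 1 + j)"

definition base :: "nat \<Rightarrow> nat" where "base g = [0, tA, tB + 1, tC + 1, tD] ! g"
definition unit :: "nat \<Rightarrow> nat" where "unit g = [wid, bsize, 6, 3 * lits] ! g"
definition count :: "nat \<Rightarrow> nat" where "count g = [ncol, lits, N, K] ! g"

lemma addr_lft:
  assumes "valid v" "addr v = (g, x, y)" "0 < N"
  shows "g \<le> 3" "lft v = base g + x * unit g + y" "x < count g" "y < unit g"
proof -
  have "col l i s < ncol" if "valid (Pin l i s)" for l i s
    using that slot_bound[of l i s] by (auto simp: slots_def intro!: col_less_ncol)
  then have "g \<le> 3 \<and> lft v = base g + x * unit g + y \<and> x < count g \<and> y < unit g"
    using assms
    by (cases v) (auto simp: base_def unit_def count_def wid_def bsize_def blk_def cst_def lits_def)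
  then show "g \<le> 3" "lft v = base g + x * unit g + y" "x < count g" "y < unit g" by auto
qed

lemma base_step: "g \<le> 3 \<Longrightarrow> base g + count g * unit g \<le> base (Suc g)"
proof -
  assume "g \<le> 3"
  then consider "g = 0" | "g = 1" | "g = 2" | "g = 3" by linarith
  then show ?thesis
    by cases (auto simp: base_def unit_def count_def tA_def tB_def tC_def tD_def ncol_def numeral_3_eq_3)
qed

lemma base_mono: "g < g' \<Longrightarrow> g' \<le> 3 \<Longrightarrow> base (Suc g) \<le> base g'"
proof (induction g')
  case (Suc m)
  then show ?case using base_step[of m] by (cases "g = m") auto
qed simp

lemma addr_less:
  assumes "valid v" "addr v = (g, x, y)" "0 < N"
  shows "base g \<le> lft v" "lft v < base (Suc g)"
proof -
  note a = addr_lft[OF assms]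
  show "base g \<le> lft v" using a(2) by simp
  have "x * unit g + unit g \<le> count g * unit g" using mult_less_step[OF a(3)] .
  then show "lft v < base (Suc g)" using a base_step[OF a(1)] by linarith
qed

lemma addr_inj: "valid v \<Longrightarrow> valid w \<Longrightarrow> addr v = addr w \<Longrightarrow> v = w"
proof -
  assume vw: "valid v" "valid w" "addr v = addr w"
  show "v = w"
  proof (cases "\<exists>l i s l' i' s'. v = Pin l i s \<and> w = Pin l' i' s'")
    case True
    then obtain l i s l' i' s' where p: "v = Pin l i s" "w = Pin l' i' s'" by blast
    then have "(l, i, s) \<in> slots" "(l', i', s') \<in> slots" using vw by (auto simp: slots_def)
    moreover from this have "l = l' \<and> i = i' \<and> s = s'"
      using vw(3) p by (intro col_inject slot_bound) (auto simp: slots_def)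
    ultimately show ?thesis using p by simp
  next
    case False
    have d: "2 * a \<noteq> Suc (2 * b)" for a b :: nat by presburger
    have k: "K - Suc a = K - Suc b \<longleftrightarrow> a = b" if "a < K" "b < K" for a b using that by auto
    show ?thesis using vw False
      by (cases v; cases w; simp add: k d d[symmetric] split: if_splits)
  qed
qed

lemma lft_inj:
  assumes "valid v" "valid w" "lft v = lft w" "0 < N"
  shows "v = w"
proof -
  obtain g x y g' x' y' where vw: "addr v = (g, x, y)" "addr w = (g', x', y')" by (metis prod_cases3)
  note v = addr_lft[OF assms(1) vw(1) assms(4)] addr_less[OF assms(1) vw(1) assms(4)]
  note w = addr_lft[OF assms(2) vw(2) assms(4)] addr_less[OF assms(2) vw(2) assms(4)]
  have "\<not> g < g'" "\<not> g' < g"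
    using base_mono[of g g'] base_mono[of g' g] v(1,5,6) w(1,5,6) assms(3) by linarith+
  then have g: "g = g'" by simp
  then have "x * unit g + y = x' * unit g + y'" using v(2) w(2) assms(3) by simp
  then have "(x * unit g + y) div unit g = (x' * unit g + y') div unit g"
    "(x * unit g + y) mod unit g = (x' * unit g + y') mod unit g" by simp_all
  then have "x = x'" "y = y'" using v(4) w(4) g by simp_all
  then show ?thesis using addr_inj[OF assms(1,2)] vw g by simp
qed

lemma lft_le_rgt: "valid v \<Longrightarrow> lft v \<le> rgt v"
proof (cases v)
  case (Pin l i s)
  moreover assume "valid v"
  ultimately have "(l, i, s) \<in> slots" by (simp add: slots_def)
  from pin_lft[OF this] pin_rgt[OF this] show ?thesis using Pin by simp
next
  case (Pad c j)
  assume "valid v"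
  then have "2 * j \<le> 2 * ncol + 1" using Pad by simp
  then show ?thesis unfolding Pad lft.simps rgt.simps by linarith
next
  case (Low l i)
  assume "valid v"
  then show ?thesis using Low blk_upper[of l] cst_lower[of i] times_chain by (simp add: bsize_def)
next
  case (High l i)
  assume "valid v"
  then show ?thesis using High blk_upper[of l] cst_lower[of i] times_chain by (simp add: bsize_def)
next
  case (Lit l i)
  assume "valid v"
  then show ?thesis using Lit blk_upper[of l] cst_lower[of i] times_chain by (simp add: bsize_def)
next
  case (Hole l)
  assume "valid v"
  then show ?thesis using Hole blk_upper[of l] times_chain by (simp add: bsize_def)
next
  case (Guard q l)
  assume "valid v"
  then have "q < K" "l < lits" using Guard by auto
  then show ?thesis unfolding Guard lft.simps rgt.simps
    using cst_upper[of q] cen_lower[of q] times_chain by linarith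
next
  case (Slot q m)
  assume "valid v"
  then show ?thesis using Slot cst_upper[of q] cen_lower[of q] times_chain by simp
next
  case (Rest q j)
  assume "valid v"
  then show ?thesis using Rest cst_upper[of q] cen_lower[of q] times_chain by simp
qed (use times_chain in \<open>fastforce+\<close>)

definition span :: "item \<Rightarrow> rat \<times> rat" where "span v = (of_nat (lft v), of_nat (rgt v))"

lemma interval_of_span: "interval_of (span v) = {real (lft v)..real (rgt v)}"
  by (simp add: span_def)

lemma span_inj: "0 < N \<Longrightarrow> inj_on span {v. valid v}"
  by (auto intro!: inj_onI lft_inj simp: span_def)

lemma interval_inj: "0 < N \<Longrightarrow> inj_on (\<lambda>v. interval_of (span v)) {v. valid v}"
  using lft_le_rgt by (auto intro!: inj_onI lft_inj simp: interval_of_span Icc_eq_Icc)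

lemma interval_meets:
  assumes "valid v" "valid w"
  shows "interval_of (span v) \<inter> interval_of (span w) \<noteq> {} \<longleftrightarrow> meets v w"
  using lft_le_rgt[OF assms(1)] lft_le_rgt[OF assms(2)]
  by (auto simp: interval_of_span meets_def)

lemma interval_subset:
  assumes "valid v" "valid w"
  shows "interval_of (span w) \<subseteq> interval_of (span v) \<longleftrightarrow> conts v w"
  using lft_le_rgt[OF assms(1)] lft_le_rgt[OF assms(2)]
  by (auto simp: interval_of_span conts_def)

theorem chromatic_number_iff_sat:
  assumes "finite {v. valid v}" "0 < N"
  shows "chromatic_number (containment_graph (interval_of ` span ` {v. valid v})) \<le> ncol \<longleftrightarrow> sat"
proof -
  let ?V = "{v. valid v}" and ?i = "\<lambda>v. interval_of (span v)"
  let ?G = "containment_graph (?i ` ?V)"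
  have eq: "?i v = ?i w \<longleftrightarrow> v = w" if "valid v" "valid w" for v w
    using interval_inj[OF assms(2)] that by (auto dest: inj_onD)
  have arc: "(?i v, ?i w) \<in> arcs ?G \<longleftrightarrow> v \<noteq> w \<and> meets v w \<and> conts v w"
    if "valid v" "valid w" for v w
    using that interval_meets[OF that] interval_subset[OF that] eq[OF that]
    by (auto simp: containment_graph_def)
  have edge: "{?i v, ?i w} \<in> edges ?G \<longleftrightarrow> v \<noteq> w \<and> meets v w \<and> \<not> conts v w \<and> \<not> conts w v"
    if "valid v" "valid w" for v w
  proof -
    have "{?i v, ?i w} \<in> edges ?G \<longleftrightarrow> ?i v \<noteq> ?i w \<and> ?i v \<inter> ?i w \<noteq> {} \<and> \<not> ?i w \<subseteq> ?i v \<and> \<not> ?i v \<subseteq> ?i w"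
      using that by (auto simp: containment_graph_def doubleton_eq_iff)
    then show ?thesis
      using interval_meets[OF that] interval_subset[OF that] interval_subset[OF that(2,1)] eq[OF that]
      by simp
  qed
  have in_verts: "u \<in> ?i ` ?V \<and> v \<in> ?i ` ?V" if "{u, v} \<in> edges ?G \<or> (u, v) \<in> arcs ?G" for u v
    using that by (auto simp: containment_graph_def doubleton_eq_iff)
  have coloring: "proper_coloring ?G f \<longleftrightarrow> proper (\<lambda>v. f (?i v))" for f
  proof
    assume f: "proper_coloring ?G f"
    show "proper (\<lambda>v. f (?i v))" unfolding proper_def
    proof (intro allI impI)
      fix v w assume vw: "valid v" "valid w" "v \<noteq> w" "meets v w"
      moreover have "meets w v" using vw(4) by (auto simp: meets_def)
      ultimately show "f (?i v) \<noteq> f (?i w) \<and> (conts v w \<longrightarrow> f (?i v) < f (?i w))"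
        using f arc[OF vw(1,2)] arc[OF vw(2,1)] edge[OF vw(1,2)]
        unfolding proper_coloring_def by (metis less_irrefl)
    qed
  next
    assume p: "proper (\<lambda>v. f (?i v))"
    show "proper_coloring ?G f" unfolding proper_coloring_def
    proof (intro conjI allI impI)
      fix u v assume e: "{u, v} \<in> edges ?G"
      then obtain x y where xy: "valid x" "valid y" "u = ?i x" "v = ?i y" using in_verts by blast
      then have "x \<noteq> y \<and> meets x y" using e edge by simp
      then show "f u \<noteq> f v" using p xy unfolding proper_def by blast
    next
      fix u v assume e: "(u, v) \<in> arcs ?G"
      then obtain x y where xy: "valid x" "valid y" "u = ?i x" "v = ?i y" using in_verts by blast
      then have "x \<noteq> y \<and> meets x y \<and> conts x y" using e arc by simp
      then show "f u < f v" using p xy unfolding proper_def by blast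
    qed
  qed
  have "(\<exists>f. proper_coloring ?G f \<and> (\<forall>u\<in>?i ` ?V. f u < ncol)) \<longleftrightarrow>
      (\<exists>f. proper f \<and> (\<forall>v. valid v \<longrightarrow> f v < ncol))"
  proof
    assume "\<exists>f. proper_coloring ?G f \<and> (\<forall>u\<in>?i ` ?V. f u < ncol)"
    then obtain f where "proper_coloring ?G f" "\<forall>u\<in>?i ` ?V. f u < ncol" by blast
    then show "\<exists>f. proper f \<and> (\<forall>v. valid v \<longrightarrow> f v < ncol)"
      using coloring by (intro exI[of _ "\<lambda>v. f (?i v)"]) auto
  next
    assume "\<exists>f. proper f \<and> (\<forall>v. valid v \<longrightarrow> f v < ncol)"
    then obtain f where f: "proper f" "\<And>v. valid v \<Longrightarrow> f v < ncol" by blast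
    define g where "g u = f (inv_into ?V ?i u)" for u
    have g: "g (?i v) = f v" if "valid v" for v
      using inv_into_f_f[OF interval_inj[OF assms(2)], of v] that by (simp add: g_def)
    have "proper (\<lambda>v. g (?i v))" using f(1) g unfolding proper_def by simp
    then show "\<exists>f. proper_coloring ?G f \<and> (\<forall>u\<in>?i ` ?V. f u < ncol)"
      using coloring f(2) g by (intro exI[of _ g]) auto
  qed
  also have "\<dots> \<longleftrightarrow> sat" using proper_imp_sat sat_imp_proper by blast
  finally show ?thesis
    using chromatic_number_le_iff[of "?i ` ?V" ncol] assms by (simp add: image_image)
qed

end

section \<open>Printing the intervals\<close>

text \<open>A leaf carries the item along with the two expressions printed for it. Correctness of
  the endpoints (\<open>agrees\<close>) is thereby separated from the question which items are
  listed.\<close>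

datatype 'v prog =
    Leaf "bool list \<Rightarrow> (nat \<Rightarrow> nat) \<Rightarrow> 'v" aexp aexp
  | Both "'v prog" "'v prog"
  | Loop nat aexp "'v prog"

fun items :: "bool list \<Rightarrow> (nat \<Rightarrow> nat) \<Rightarrow> 'v prog \<Rightarrow> 'v list" where
  "items w s (Leaf v x y) = [v w s]"
| "items w s (Both P Q) = items w s P @ items w s Q"
| "items w s (Loop x a P) = concat (map (\<lambda>i. items w (s(x := i)) P) [0..<eval w s a])"

fun agrees :: "('v \<Rightarrow> nat) \<Rightarrow> ('v \<Rightarrow> nat) \<Rightarrow> bool list \<Rightarrow> (nat \<Rightarrow> nat) \<Rightarrow> 'v prog \<Rightarrow> bool" where
  "agrees L R w s (Leaf v x y) \<longleftrightarrow> eval w s x = L (v w s) \<and> eval w s y = R (v w s)"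
| "agrees L R w s (Both P Q) \<longleftrightarrow> agrees L R w s P \<and> agrees L R w s Q"
| "agrees L R w s (Loop x a P) \<longleftrightarrow> (\<forall>i<eval w s a. agrees L R w (s(x := i)) P)"

fun printer :: "'v prog \<Rightarrow> gen" where
  "printer (Leaf v x y) = Then (Put [False]) (Then (PutNat x) (Then (Put (enc_nat 1 @ [False]))
     (Then (PutNat y) (Put (enc_nat 1)))))"
| "printer (Both P Q) = Then (printer P) (printer Q)"
| "printer (Loop x a P) = Each x a (printer P)"

lemma enc_rat_of_nat: "enc_rat (of_nat n) = False # enc_nat n @ enc_nat 1"
proof -
  have "quotient_of (of_nat n) = (int n, 1)"
    using quotient_of_int[of "int n"] by (simp add: Rat.of_int_def)
  then show ?thesis by (simp add: enc_rat_def enc_int_def)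
qed

lemma den_printer:
  "agrees L R w s P \<Longrightarrow> den w s (printer P) =
     concat (map (\<lambda>v. enc_rat (of_nat (L v)) @ enc_rat (of_nat (R v))) (items w s P))"
proof (induction P arbitrary: s)
  case (Leaf v x y)
  then show ?case by (simp add: enc_rat_of_nat)
next
  case (Both P Q)
  then show ?case by simp
next
  case (Loop x a P)
  have flat: "concat (map g (concat (map F ys))) = concat (map (\<lambda>i. concat (map g (F i))) ys)"
    for F and g :: "'a \<Rightarrow> bool list" and ys :: "nat list"
    by (induction ys) auto
  have "den w (s(x := i)) (printer P) =
      concat (map (\<lambda>v. enc_rat (of_nat (L v)) @ enc_rat (of_nat (R v))) (items w (s(x := i)) P))"
    if "i \<in> set [0..<eval w s a]" for i
    using Loop that by auto
  then show ?case unfolding printer.simps den.simps items.simps flat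
    by (intro arg_cong[of _ _ concat] map_cong) auto
qed

text \<open>Nested loops visit mixed-radix numbers in increasing order; three applications merge the
  loops of \<open>p_lit\<close> into one over all clause numbers.\<close>

lemma concat_upt_mult:
  "concat (map (\<lambda>i. concat (map (\<lambda>j. F (i * n + j)) [0..<n])) [0..<m]) = concat (map F [0..<m * n])"
proof (induction m)
  case (Suc m)
  have "[0..<Suc m * n] = [0..<m * n] @ map (\<lambda>j. m * n + j) [0..<n]"
    using upt_add_eq_append[of 0 "m * n" n] by (simp add: add.commute map_add_upt[symmetric])
  then show ?case using Suc by (simp add: comp_def)
qed simp

lemma distinct_concat_map:
  assumes "distinct xs" "\<And>x. x \<in> set xs \<Longrightarrow> distinct (F x)"
    "\<And>x v. x \<in> set xs \<Longrightarrow> v \<in> set (F x) \<Longrightarrow> key v = x"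
  shows "distinct (concat (map F xs))"
  using assms
proof (induction xs)
  case (Cons x xs)
  have "set (F x) \<inter> set (concat (map F xs)) = {}"
  proof (rule ccontr)
    assume "set (F x) \<inter> set (concat (map F xs)) \<noteq> {}"
    then obtain v y where v: "v \<in> set (F x)" "y \<in> set xs" "v \<in> set (F y)" by auto
    then have "key v = x" "key v = y" using Cons.prems(3)[of x v] Cons.prems(3)[of y v] by simp_all
    then show False using v Cons.prems(1) by simp
  qed
  moreover have "distinct (concat (map F xs))"
    using Cons.prems by (intro Cons.IH) simp_all
  ultimately show ?case using Cons.prems(2)[of x] by simp
qed simp

definition kinds :: "'k clause list \<Rightarrow> 'k set" where
  "kinds cs = (\<lambda>(b, k, x, y). k) ` (\<Union>c\<in>set cs. set (snd c))"

locale uniform =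
  fixes cs :: "'k clause list" and a :: aexp and kn :: "'k \<Rightarrow> nat" and NK :: nat
  assumes vars_a: "vars a \<subseteq> {1}" and a_pos: "\<And>w s. 0 < eval w s a"
    and cs_wf: "\<And>c. c \<in> set cs \<Longrightarrow> clause_wf a c"
    and kn_inj: "inj_on kn (kinds cs)" and kn_less: "\<And>k. k \<in> kinds cs \<Longrightarrow> kn k < NK"
    and NK_pos: "0 < NK"
begin

section \<open>Endpoints as arithmetic expressions\<close>

definition xN where "xN = Times (Times (Num NK) a) a"
definition xK where "xK = Times (Times (Times (Num (length cs)) a) a) a"
definition xL where "xL = Times (Num 2) xN"
definition xB where "xB = Plus (Times (Num 3) xK) (Num 4)"
definition xC where "xC = Times xL xB"
definition xW where "xW = Plus (Times (Num 2) xC) (Num 2)"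
definition xA where "xA = Times xC xW"
definition xTB where "xTB = Plus xA xC"
definition xTC where "xTC = Plus xTB (Times (Num 6) xN)"
definition xTD where "xTD = Plus (Plus xTC (Times (Times (Num 3) xL) xK)) (Num 1)"
definition xTE where "xTE = Plus xTD xL"
definition xTF where "xTF = Plus xTE (Times (Num 6) xN)"
definition xblk where "xblk l = Plus xA (Times l xB)"
definition xcol where "xcol l i s = Plus (Plus (Times l xB) (Times (Num 3) i)) (Num s)"
definition xcst where "xcst q = Plus xTC (Times (Times (Num 3) xL) (Minus xK (Plus q (Num 1))))"
definition xcen where "xcen q = Plus xTF (Times (Times (Num 3) xL) (Minus xK (Plus q (Num 1))))"

lemmas closed_defs = xN_def xK_def xL_def xB_def xC_def xW_def xA_def xTB_def xTC_def xTD_def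
  xTE_def xTF_def

lemma vars_a_sub: "Suc 0 \<in> D \<Longrightarrow> vars a \<subseteq> D"
  using vars_a by auto

lemma vars_closed [simp]:
  assumes "Suc 0 \<in> D"
  shows "vars a \<subseteq> D" "vars xN \<subseteq> D" "vars xK \<subseteq> D" "vars xL \<subseteq> D" "vars xB \<subseteq> D" "vars xC \<subseteq> D"
    "vars xW \<subseteq> D" "vars xA \<subseteq> D" "vars xTB \<subseteq> D" "vars xTC \<subseteq> D" "vars xTD \<subseteq> D" "vars xTE \<subseteq> D"
    "vars xTF \<subseteq> D"
    "vars (xblk l) \<subseteq> D \<longleftrightarrow> vars l \<subseteq> D" "vars (xcol l i s) \<subseteq> D \<longleftrightarrow> vars l \<subseteq> D \<and> vars i \<subseteq> D"
    "vars (xcst l) \<subseteq> D \<longleftrightarrow> vars l \<subseteq> D" "vars (xcen l) \<subseteq> D \<longleftrightarrow> vars l \<subseteq> D"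
  using vars_a_sub[OF assms] by (simp_all add: closed_defs xblk_def xcol_def xcst_def xcen_def)

abbreviation "twice x \<equiv> Times (Num 2) x"
abbreviation "addn x n \<equiv> Plus x (Num n)"

definition p_pin :: "item prog" where
  "p_pin = Loop 2 xL
     (Both (Loop 4 (addn xK 2) (Leaf (\<lambda>w s. Pin (s 2) (s 4) 0)
         (Times (xcol (Var 2) (Var 4) 0) xW) (Plus (xblk (Var 2)) (twice xK))))
     (Both (Loop 4 (addn xK 1) (Leaf (\<lambda>w s. Pin (s 2) (s 4) 1)
         (Times (xcol (Var 2) (Var 4) 1) xW) (Minus (Plus (xblk (Var 2)) (twice (Var 4))) (Num 1))))
     (Both (Loop 4 xK (Leaf (\<lambda>w s. Pin (s 2) (s 4) 2)
         (Times (xcol (Var 2) (Var 4) 2) xW) (Plus (xblk (Var 2)) (twice (Var 4)))))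
       (Leaf (\<lambda>w s. Pin (s 2) (eval w s xK) 2)
         (Times (xcol (Var 2) xK 2) xW) (Plus (xblk (Var 2)) (addn (Times (Num 3) xK) 1))))))"

definition p_pad :: "item prog" where
  "p_pad = Loop 2 xC (Loop 4 (Var 2) (Leaf (\<lambda>w s. Pad (s 4) (s 2))
     (Plus (Times (Var 4) xW) (Var 2))
     (Minus (addn (Plus (Times (Var 4) xW) (twice xC)) 1) (Var 2))))"

definition p_low :: "item prog" where
  "p_low = Loop 2 xL (Loop 4 xK (Leaf (\<lambda>w s. Low (s 2) (s 4))
     (Plus (xblk (Var 2)) (twice (Var 4))) (Plus (xcst (Var 4)) (Var 2))))"

definition p_high :: "item prog" where
  "p_high = Loop 2 xL (Loop 4 xK (Leaf (\<lambda>w s. High (s 2) (s 4))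
     (Plus (xblk (Var 2)) (addn (twice (Var 4)) 1)) (Plus (xcst (Var 4)) xL)))"

definition p_hole :: "item prog" where
  "p_hole = Loop 2 xL (Leaf (\<lambda>w s. Hole (s 2))
     (Plus (xblk (Var 2)) (addn (Times (Num 3) xK) 3)) (Plus xTD (Var 2)))"

abbreviation "six \<equiv> Times (Num 6) (Var 2)"

text \<open>The items of index \<open>K\<close> have endpoints that depend on \<open>l div 2\<close>
  and on the parity of \<open>l\<close>. Looping over variables and listing both literals makes
  these explicit without a division.\<close>

definition p_pair :: "item prog" where
  "p_pair = Loop 2 xN (foldr Both
    [Leaf (\<lambda>w s. Low (2 * s 2) (eval w s xK)) (Plus (xblk (twice (Var 2))) (twice xK)) (Plus xTB six),
     Leaf (\<lambda>w s. Low (2 * s 2 + 1) (eval w s xK)) (Plus (xblk (addn (twice (Var 2)) 1)) (twice xK)) (Plus xTB six),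
     Leaf (\<lambda>w s. High (2 * s 2) (eval w s xK))
       (Plus (xblk (twice (Var 2))) (addn (Times (Num 3) xK) 2)) (addn (Plus xTB six) 5),
     Leaf (\<lambda>w s. High (2 * s 2 + 1) (eval w s xK))
       (Plus (xblk (addn (twice (Var 2)) 1)) (addn (Times (Num 3) xK) 2)) (addn (Plus xTB six) 2),
     Leaf (\<lambda>w s. Lit (2 * s 2) (eval w s xK))
       (Plus (xblk (twice (Var 2))) (addn (Times (Num 3) xK) 1)) (addn (Plus xTB six) 3),
     Leaf (\<lambda>w s. Lit (2 * s 2 + 1) (eval w s xK))
       (Plus (xblk (addn (twice (Var 2)) 1)) (addn (Times (Num 3) xK) 1)) (addn (Plus xTB six) 1),
     Leaf (\<lambda>w s. PairE (s 2)) (addn (Plus xTB six) 1) (Plus xTE six),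
     Leaf (\<lambda>w s. PairC2 (s 2)) (addn (Plus xTB six) 2) (addn (Plus xTE six) 2),
     Leaf (\<lambda>w s. PairF2 (s 2)) (addn (Plus xTB six) 3) (addn (Plus xTE six) 1),
     Leaf (\<lambda>w s. PairC1 (s 2)) (addn (Plus xTB six) 4) (addn (Plus xTE six) 5),
     Leaf (\<lambda>w s. PairD (s 2)) (addn (Plus xTB six) 5) (addn (Plus xTE six) 3)]
     (Leaf (\<lambda>w s. PairF1 (s 2)) (addn (Plus xTB six) 6) (addn (Plus xTE six) 4)))"

definition p_clause :: "item prog" where
  "p_clause = Loop 2 xK
    (Both (Loop 4 xL (Leaf (\<lambda>w s. Guard (s 2) (s 4)) (Plus (addn (xcst (Var 2)) 1) (Var 4))
        (Minus (Plus (xcen (Var 2)) (twice (Minus xL (Var 4)))) (Num 1))))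
    (Both (Loop 4 (addn xL 1) (Leaf (\<lambda>w s. Slot (s 2) (s 4)) (Plus (addn (Plus (xcst (Var 2)) xL) 1) (Var 4))
        (Plus (xcen (Var 2)) (twice (Minus xL (Var 4))))))
      (Loop 4 (Minus xL (Num 1)) (Leaf (\<lambda>w s. Rest (s 2) (s 4))
        (Plus (addn (Plus (xcst (Var 2)) (twice xL)) 2) (Var 4))
        (Plus (addn (Plus (xcen (Var 2)) (twice xL)) 1) (Var 4))))))"

definition xQ where
  "xQ = Plus (Times (Plus (Times (Plus (Times (Var 2) a) (Var 4)) a) (Var 6)) a) (Var 8)"

fun xlit :: "bool \<times> 'k \<times> aexp \<times> aexp \<Rightarrow> aexp" where
  "xlit (b, k, x, y) =
     Plus (twice (Plus (Times (Plus (Times (Num (kn k)) a) x) a) y)) (Num (if b then 0 else 1))"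

text \<open>A product of inequalities: 1 exactly if the literal in register 10 does not occur in the
  instance. This is the time unit added to the right end of its copy. A zero guard makes the product
  0, that is, every literal occurs.\<close>

definition xfree :: "'k clause \<Rightarrow> aexp" where
  "xfree c = Times (Neq (fst c) (Num 0)) (foldr (\<lambda>e. Times (Neq (Var 10) (xlit e))) (snd c) (Num 1))"

text \<open>The family index is known only at run time, but each family has its own expression; the
  sum over all families selects the one in register 2.\<close>

definition xdelay :: aexp where
  "xdelay = foldr (\<lambda>f. Plus (Times (Eq (Var 2) (Num f)) (xfree (cs ! f)))) [0..<length cs] (Num 0)"

text \<open>Here alone the endpoints depend on the content of the clause. The loops run over the
  digits of its number, and \<open>xQ\<close> assembles the number from them.\<close>

definition p_lit :: "item prog" where
  "p_lit = Loop 2 (Num (length cs)) (Loop 4 a (Loop 6 a (Loop 8 a (Loop 10 xL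
     (Leaf (\<lambda>w s. Lit (s 10) (eval w s xQ))
       (Plus (addn (Plus (xblk (Var 10)) (twice xK)) 1) xQ)
       (Plus (Plus (addn (Plus (xcst xQ) xL) 1) (Var 10)) xdelay))))))"

definition p_all :: "item prog" where
  "p_all = foldr Both [p_pin, p_pad, p_low, p_high, p_hole, p_pair, p_clause] p_lit"

definition instance_gen :: gen where
  "instance_gen = Then (PutNat xC) (printer p_all)"

lemma clause_vars:
  assumes "c \<in> set cs"
  shows "vars (fst c) \<subseteq> {1, 4, 6, 8}"
    and "(b, k, x, y) \<in> set (snd c) \<Longrightarrow> vars x \<subseteq> {1, 4, 6, 8} \<and> vars y \<subseteq> {1, 4, 6, 8}"
proof -
  have wf: "clause_wf a c" by (rule cs_wf[OF assms])
  show "vars (fst c) \<subseteq> {1, 4, 6, 8}" using wf unfolding clause_wf_def by blast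
  assume "(b, k, x, y) \<in> set (snd c)"
  then show "vars x \<subseteq> {1, 4, 6, 8} \<and> vars y \<subseteq> {1, 4, 6, 8}"
    using wf unfolding clause_wf_def by (auto dest!: bspec)
qed

lemma vars_xfree: "c \<in> set cs \<Longrightarrow> vars (xfree c) \<subseteq> {1, 4, 6, 8, 10}"
proof -
  assume "c \<in> set cs"
  note wf = clause_vars[OF this]
  have "vars (foldr (\<lambda>e. Times (Neq (Var 10) (xlit e))) es (Num 1)) \<subseteq> {1, 4, 6, 8, 10}"
    if "set es \<subseteq> set (snd c)" for es
    using that
  proof (induction es)
    case (Cons e es)
    obtain b k x y where e: "e = (b, k, x, y)" by (metis prod_cases4)
    then have "vars x \<subseteq> {1, 4, 6, 8}" "vars y \<subseteq> {1, 4, 6, 8}" using wf(2)[of b k x y] Cons.prems by auto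
    then have "vars (xlit e) \<subseteq> {1, 4, 6, 8, 10}" using vars_a by (auto simp: e)
    then show ?case using Cons by simp
  qed simp
  from this[of "snd c"] show ?thesis using wf(1) by (auto simp: xfree_def)
qed

lemma vars_xdelay: "vars xdelay \<subseteq> {1, 2, 4, 6, 8, 10}"
proof -
  have "vars (foldr (\<lambda>f. Plus (Times (Eq (Var 2) (Num f)) (xfree (cs ! f)))) fs (Num 0)) \<subseteq> {1, 2, 4, 6, 8, 10}"
    if "set fs \<subseteq> {..<length cs}" for fs
    using that
  proof (induction fs)
    case (Cons f fs)
    then have "vars (xfree (cs ! f)) \<subseteq> {1, 2, 4, 6, 8, 10}" using vars_xfree[of "cs ! f"] by auto
    then show ?case using Cons by simp
  qed simp
  from this[of "[0..<length cs]"] show ?thesis unfolding xdelay_def by (simp add: lessThan_atLeast0)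
qed

lemma scoped_instance_gen: "scoped {1} 2 instance_gen"
proof -
  have d: "vars xdelay \<subseteq> {10, 8, 6, 4, 2, Suc 0}" using vars_xdelay by auto
  show ?thesis
    using d by (simp add: instance_gen_def p_all_def p_pin_def p_pad_def p_low_def p_high_def
      p_hole_def p_pair_def p_clause_def p_lit_def xQ_def)
qed

end

section \<open>Correctness of the printed instance\<close>

locale uniform_word = uniform cs a kn NK
  for cs :: "'k clause list" and a :: aexp and kn :: "'k \<Rightarrow> nat" and NK :: nat +
  fixes w :: "bool list"
begin

definition start :: "nat \<Rightarrow> nat" where "start = (\<lambda>_. 0)(1 := length w)"
definition S :: nat where "S = eval w start a"
definition nv :: nat where "nv = NK * S * S"
definition nc :: nat where "nc = length cs * S * S * S"
definition lcode :: "bool \<Rightarrow> 'k \<Rightarrow> nat \<Rightarrow> nat \<Rightarrow> nat" where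
  "lcode b k x y = 2 * ((kn k * S + x) * S + y) + (if b then 0 else 1)"
definition qcode :: "nat \<Rightarrow> nat \<Rightarrow> nat \<Rightarrow> nat \<Rightarrow> nat" where
  "qcode f t i j = ((f * S + t) * S + i) * S + j"
text \<open>An instance whose guard vanishes contains all literals, hence a variable with its
  negation, and is satisfied trivially. So the number of clauses does not depend on the
  guards.\<close>

definition occurs :: "'k clause \<Rightarrow> nat \<Rightarrow> nat \<Rightarrow> nat \<Rightarrow> nat \<Rightarrow> bool" where
  "occurs c t i j l \<longleftrightarrow> eval w (env w t i j) (fst c) = 0 \<or>
     (\<exists>(b, k, x, y)\<in>set (snd c). l = lcode b k (eval w (env w t i j) x) (eval w (env w t i j) y))"
definition occ :: "nat \<Rightarrow> nat \<Rightarrow> bool" where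
  "occ q l \<longleftrightarrow> occurs (cs ! (q div S div S div S)) (q div S div S mod S) (q div S mod S) (q mod S) l"

sublocale gadget nv nc occ .

lemma eval_a: "s 1 = length w \<Longrightarrow> eval w s a = S"
  unfolding S_def by (rule eval_cong) (auto simp: start_def dest: subsetD[OF vars_a])

lemma S_pos: "0 < S"
  unfolding S_def by (rule a_pos)

lemma nv_pos: "0 < nv"
  using S_pos NK_pos by (simp add: nv_def)

lemma eval_closed [simp]:
  assumes "s (Suc 0) = length w"
  shows "eval w s a = S" "eval w s xN = nv" "eval w s xK = nc" "eval w s xL = lits" "eval w s xB = bsize"
    "eval w s xC = ncol" "eval w s xW = wid" "eval w s xA = tA" "eval w s xTB = tB" "eval w s xTC = tC"
    "eval w s xTD = tD" "eval w s xTE = tE" "eval w s xTF = tF"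
    "eval w s (xblk e) = blk (eval w s e)"
    "eval w s (xcol e f m) = col (eval w s e) (eval w s f) m"
    "eval w s (xcst e) = cst (eval w s e)" "eval w s (xcen e) = cen (eval w s e)"
proof -
  have a: "eval w s a = S" using eval_a assms by simp
  have N: "eval w s xN = nv" by (simp add: xN_def nv_def a)
  have K: "eval w s xK = nc" by (simp add: xK_def nc_def a)
  note defs = xL_def xB_def xC_def xW_def xA_def xTB_def xTC_def xTD_def xTE_def xTF_def
    lits_def bsize_def ncol_def wid_def tA_def tB_def tC_def tD_def tE_def tF_def
  show "eval w s a = S" "eval w s xN = nv" "eval w s xK = nc" by fact+
  show "eval w s xL = lits" "eval w s xB = bsize"
    "eval w s xC = ncol" "eval w s xW = wid" "eval w s xA = tA" "eval w s xTB = tB" "eval w s xTC = tC"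
    "eval w s xTD = tD" "eval w s xTE = tE" "eval w s xTF = tF"
    "eval w s (xblk e) = blk (eval w s e)"
    "eval w s (xcol e f m) = col (eval w s e) (eval w s f) m"
    "eval w s (xcst e) = cst (eval w s e)" "eval w s (xcen e) = cen (eval w s e)"
    by (simp_all add: defs N K xblk_def xcol_def xcst_def xcen_def blk_def col_def cst_def cen_def)
qed

lemma qcode_decode:
  assumes "t < S" "i < S" "j < S"
  shows "qcode f t i j div S div S div S = f" "qcode f t i j div S div S mod S = t"
    "qcode f t i j div S mod S = i" "qcode f t i j mod S = j"
  using assms by (simp_all add: qcode_def)

lemma occ_qcode:
  assumes "t < S" "i < S" "j < S"
  shows "occ (qcode f t i j) l \<longleftrightarrow> occurs (cs ! f) t i j l"
  unfolding occ_def qcode_decode[OF assms] ..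

lemma qcode_less: "f < n \<Longrightarrow> t < S \<Longrightarrow> i < S \<Longrightarrow> j < S \<Longrightarrow> qcode f t i j < n * S * S * S"
proof -
  have step: "x * S + y < m * S" if "x < m" "y < S" for x y m
    using mult_less_step[OF that(1), of S] that(2) by linarith
  assume "f < n" "t < S" "i < S" "j < S"
  then show ?thesis unfolding qcode_def by (intro step)
qed

lemma qcode_ex:
  assumes "q < n * S * S * S"
  obtains f t i j where "f < n" "t < S" "i < S" "j < S" "q = qcode f t i j"
proof
  show "q div S div S div S < n" using assms S_pos by (simp add: div_less_iff_less_mult)
  show "q = qcode (q div S div S div S) (q div S div S mod S) (q div S mod S) (q mod S)"
    by (simp only: qcode_def div_mult_mod_eq)
qed (use S_pos in auto)

lemma literal_bounds:
  assumes "c \<in> set cs" "(b, k, x, y) \<in> set (snd c)" "t < S" "i < S" "j < S"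
    "eval w (env w t i j) (fst c) \<noteq> 0"
  shows "eval w (env w t i j) x < S" "eval w (env w t i j) y < S" "k \<in> kinds cs"
proof -
  have "eval w (env w t i j) a = S" by (rule eval_a) (simp add: env_def)
  then show "eval w (env w t i j) x < S" "eval w (env w t i j) y < S"
    using bspec[OF conjunct2[OF iffD1[OF clause_wf_def cs_wf[OF assms(1)]]] assms(2),
        unfolded prod.case Let_def, THEN conjunct2, THEN conjunct2, rule_format,
        where w = w and t = t and i = i and j = j] assms(3-)
    by simp_all
  show "k \<in> kinds cs" using assms(1,2) unfolding kinds_def by force
qed

theorem sat_iff_models: "sat \<longleftrightarrow> (\<exists>A. models w S A cs)"
proof
  assume "sat"
  then obtain \<alpha> where \<alpha>: "\<And>q. q < nc \<Longrightarrow> \<exists>l<lits. occ q l \<and> \<alpha> (l div 2) = even l"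
    unfolding sat_def by blast
  define A where "A k x y = \<alpha> ((kn k * S + x) * S + y)" for k x y
  have "clause_holds w A c t i j" if c: "c \<in> set cs" and b: "t < S" "i < S" "j < S" for c t i j
  proof -
    obtain f where f: "f < length cs" "c = cs ! f" using c by (metis in_set_conv_nth)
    then have "qcode f t i j < nc" unfolding nc_def using b by (intro qcode_less)
    then obtain l where l: "occurs c t i j l" "\<alpha> (l div 2) = even l"
      using \<alpha> occ_qcode[OF b] f by blast
    show ?thesis unfolding clause_holds_def
    proof
      assume "eval w (env w t i j) (fst c) \<noteq> 0"
      then obtain b k x y where e: "(b, k, x, y) \<in> set (snd c)"
        "l = lcode b k (eval w (env w t i j) x) (eval w (env w t i j) y)"
        using l(1) unfolding occurs_def by auto
      then have "A k (eval w (env w t i j) x) (eval w (env w t i j) y) = b"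
        using l(2) by (cases b) (simp_all add: lcode_def A_def)
      then show "\<exists>(b, k, x, y)\<in>set (snd c). A k (eval w (env w t i j) x) (eval w (env w t i j) y) = b"
        using e(1) by (intro bexI[of _ "(b, k, x, y)"]) auto
    qed
  qed
  then have "models w S A cs" unfolding models_def by blast
  then show "\<exists>A. models w S A cs" by blast
next
  assume "\<exists>A. models w S A cs"
  then obtain A where A: "models w S A cs" by blast
  \<comment> \<open>The variable number is decoded into kind and coordinates, reversing the
    numbering in \<open>lcode\<close>.\<close>
  define \<alpha> where "\<alpha> n = A (inv_into (kinds cs) kn (n div S div S)) (n div S mod S) (n mod S)" for n
  have \<alpha>: "\<alpha> ((kn k * S + x) * S + y) = A k x y" if "k \<in> kinds cs" "x < S" "y < S" for k x y
    using that inv_into_f_f[OF kn_inj that(1)] by (simp add: \<alpha>_def)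
  have "\<exists>l<lits. occ q l \<and> \<alpha> (l div 2) = even l" if qn: "q < nc" for q
  proof -
    obtain f t i j where q: "f < length cs" "t < S" "i < S" "j < S" "q = qcode f t i j"
      by (rule qcode_ex[OF qn[unfolded nc_def]])
    let ?c = "cs ! f" and ?e = "eval w (env w t i j)"
    have c: "?c \<in> set cs" using q by simp
    have occ: "occ q l \<longleftrightarrow> occurs ?c t i j l" for l using q occ_qcode by simp
    show ?thesis
    proof (cases "?e (fst ?c) = 0")
      case True
      have "(if \<alpha> 0 then 0 else 1) < lits" using nv_pos by (simp add: lits_def)
      then show ?thesis using True unfolding occ occurs_def
        by (intro exI[of _ "if \<alpha> 0 then 0 else 1"]) auto
    next
      case False
      have "clause_holds w A ?c t i j" using A c q(2-4) unfolding models_def by blast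
      then obtain b k x y where e: "(b, k, x, y) \<in> set (snd ?c)" "A k (?e x) (?e y) = b"
        using False unfolding clause_holds_def by auto
      note bd = literal_bounds[OF c e(1) q(2-4) False]
      let ?l = "lcode b k (?e x) (?e y)"
      have "(kn k * S + ?e x) * S + ?e y < nv"
      proof -
        have step: "x * S + y < m * S" if "x < m" "y < S" for x y m
          using mult_less_step[OF that(1), of S] that(2) by linarith
        show ?thesis unfolding nv_def using bd kn_less by (intro step)
      qed
      then have "?l < lits" by (simp add: lcode_def lits_def)
      moreover have "occ q ?l" unfolding occ occurs_def using e(1)
        by (intro disjI2 bexI[of _ "(b, k, x, y)"]) auto
      moreover have "\<alpha> (?l div 2) = even ?l" using \<alpha>[OF bd(3,1,2)] e(2) by (simp add: lcode_def)
      ultimately show ?thesis by blast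
    qed
  qed
  then show "sat" unfolding sat_def by blast
qed

lemma eval_xfree:
  assumes c: "c \<in> set cs" and s: "s (Suc 0) = length w" "s 4 = t" "s 6 = i" "s 8 = j" "s 10 = l"
  shows "eval w s (xfree c) = (if occurs c t i j l then 0 else 1)"
proof -
  have same: "eval w s e = eval w (env w t i j) e" if "vars e \<subseteq> {1, 4, 6, 8}" for e
    using that s by (intro eval_cong) (auto simp: env_def)
  note wf = clause_vars[OF c]
  have "eval w s (foldr (\<lambda>e. Times (Neq (Var 10) (xlit e))) es (Num 1)) =
      (if \<exists>(b, k, x, y)\<in>set es. l = lcode b k (eval w (env w t i j) x) (eval w (env w t i j) y) then 0 else 1)"
    if "set es \<subseteq> set (snd c)" for es
    using that
  proof (induction es)
    case (Cons e es)
    obtain b k x y where e: "e = (b, k, x, y)" by (metis prod_cases4)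
    then have "eval w s (xlit e) = lcode b k (eval w (env w t i j) x) (eval w (env w t i j) y)"
      using wf(2)[of b k x y] Cons.prems same s(1) by (simp add: lcode_def)
    then show ?case using Cons s(5) by (simp add: e)
  qed simp
  from this[of "snd c"] show ?thesis
    using same[OF wf(1)] by (simp add: xfree_def occurs_def)
qed

lemma eval_xdelay:
  assumes "f < length cs" "s (Suc 0) = length w" "s 2 = f" "s 4 = t" "s 6 = i" "s 8 = j" "s 10 = l"
  shows "eval w s xdelay = (if occurs (cs ! f) t i j l then 0 else 1)"
proof -
  have "eval w s (foldr (\<lambda>f. Plus (Times (Eq (Var 2) (Num f)) (xfree (cs ! f)))) fs (Num 0)) =
      (if f \<in> set fs then eval w s (xfree (cs ! f)) else 0)" if "distinct fs" for fs
    using that assms(3) by (induction fs) auto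
  then show ?thesis using eval_xfree[of "cs ! f" s t i j l] assms by (simp add: xdelay_def)
qed

lemma eval_xQ: "s (Suc 0) = length w \<Longrightarrow> eval w s xQ = qcode (s 2) (s 4) (s 6) (s 8)"
  by (simp add: xQ_def qcode_def)

lemma start_simps [simp]: "start (Suc 0) = length w"
  by (simp add: start_def)

lemma agrees_simple:
  "agrees lft rgt w start p_pin" "agrees lft rgt w start p_pad" "agrees lft rgt w start p_low"
  "agrees lft rgt w start p_high" "agrees lft rgt w start p_hole" "agrees lft rgt w start p_pair"
  "agrees lft rgt w start p_clause"
  by (simp_all add: p_pin_def p_pad_def p_low_def p_high_def p_hole_def p_pair_def p_clause_def)

lemma agrees_lit: "agrees lft rgt w start p_lit"
proof -
  have "eval w s xdelay = (if occ (qcode f t i j) l then 0 else 1) \<and> qcode f t i j < nc"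
    if "f < length cs" "t < S" "i < S" "j < S" "s = start(2 := f, 4 := t, 6 := i, 8 := j, 10 := l)" for f t i j l s
    using eval_xdelay[of f s t i j l] occ_qcode qcode_less[of f "length cs" t i j] that by (simp add: nc_def)
  then show ?thesis by (simp add: p_lit_def eval_xQ)
qed

lemma agrees_all: "agrees lft rgt w start p_all"
  using agrees_simple agrees_lit by (simp add: p_all_def)

lemma items_eq:
  "items w start p_pin = concat (map (\<lambda>l. map (\<lambda>i. Pin l i 0) [0..<nc + 2] @
     map (\<lambda>i. Pin l i 1) [0..<nc + 1] @ map (\<lambda>i. Pin l i 2) [0..<nc] @ [Pin l nc 2]) [0..<lits])"
  "items w start p_pad = concat (map (\<lambda>j. map (\<lambda>c. Pad c j) [0..<j]) [0..<ncol])"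
  "items w start p_low = concat (map (\<lambda>l. map (\<lambda>i. Low l i) [0..<nc]) [0..<lits])"
  "items w start p_high = concat (map (\<lambda>l. map (\<lambda>i. High l i) [0..<nc]) [0..<lits])"
  "items w start p_hole = map Hole [0..<lits]"
  "items w start p_pair = concat (map (\<lambda>j. [Low (2 * j) nc, Low (2 * j + 1) nc, High (2 * j) nc,
     High (2 * j + 1) nc, Lit (2 * j) nc, Lit (2 * j + 1) nc, PairE j, PairC2 j, PairF2 j, PairC1 j,
     PairD j, PairF1 j]) [0..<nv])"
  "items w start p_clause = concat (map (\<lambda>q. map (\<lambda>l. Guard q l) [0..<lits] @
     map (\<lambda>m. Slot q m) [0..<lits + 1] @ map (\<lambda>j. Rest q j) [0..<lits - 1]) [0..<nc])"
  by (simp_all add: p_pin_def p_pad_def p_low_def p_high_def p_hole_def p_pair_def p_clause_def)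

lemma items_lit: "items w start p_lit = concat (map (\<lambda>q. map (\<lambda>l. Lit l q) [0..<lits]) [0..<nc])"
proof -
  let ?F = "\<lambda>q. map (\<lambda>l. Lit l q) [0..<lits]"
  have "items w start p_lit = concat (map (\<lambda>f. concat (map (\<lambda>t. concat (map (\<lambda>i. concat (map
      (\<lambda>j. ?F (((f * S + t) * S + i) * S + j)) [0..<S])) [0..<S])) [0..<S])) [0..<length cs])"
    by (simp add: p_lit_def eval_xQ qcode_def)
  also have "\<dots> = concat (map ?F [0..<nc])"
    unfolding nc_def
      concat_upt_mult[of "\<lambda>y. concat (map (\<lambda>i. concat (map (\<lambda>j. ?F ((y * S + i) * S + j)) [0..<S])) [0..<S])"]
      concat_upt_mult[of "\<lambda>x. concat (map (\<lambda>j. ?F (x * S + j)) [0..<S])"]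
      concat_upt_mult[of ?F] ..
  finally show ?thesis .
qed

lemma set_items: "set (items w start p_all) = {v. valid v}"
proof (intro equalityI subsetI)
  fix v assume "v \<in> set (items w start p_all)"
  then show "v \<in> {v. valid v}"
    unfolding p_all_def by (auto simp: items_eq items_lit lits_def)
next
  fix v assume v: "v \<in> {v. valid v}"
  have pair: "\<exists>j<nv. l = 2 * j \<or> l = 2 * j + 1" if "l < lits" for l
    using that unfolding lits_def by (intro exI[of _ "l div 2"]) auto
  show "v \<in> set (items w start p_all)"
  proof (cases v)
    case (Pin l i s)
    then have "s = 0 \<and> i < nc + 2 \<or> s = 1 \<and> i < nc + 1 \<or> s = 2 \<and> (i < nc \<or> i = nc)"
      using v by auto
    then have "v \<in> set (items w start p_pin)" using v Pin by (auto simp: items_eq)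
    then show ?thesis by (simp add: p_all_def)
  next
    case (Pad c j)
    then have "v \<in> set (items w start p_pad)" using v by (auto simp: items_eq intro!: bexI[of _ j])
    then show ?thesis by (simp add: p_all_def)
  next
    case (Low l i)
    show ?thesis
    proof (cases "i = nc")
      case True
      obtain j where "j < nv" "l = 2 * j \<or> l = 2 * j + 1" using pair[of l] v Low by auto
      then have "v \<in> set (items w start p_pair)"
        unfolding Low True by (auto simp: items_eq intro!: bexI[of _ j])
      then show ?thesis by (simp add: p_all_def)
    next
      case False
      then have "v \<in> set (items w start p_low)" using v Low by (auto simp: items_eq intro!: bexI[of _ l])
      then show ?thesis by (simp add: p_all_def)
    qed
  next
    case (High l i)
    show ?thesis
    proof (cases "i = nc")
      case True
      obtain j where "j < nv" "l = 2 * j \<or> l = 2 * j + 1" using pair[of l] v High by auto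
      then have "v \<in> set (items w start p_pair)"
        unfolding High True by (auto simp: items_eq intro!: bexI[of _ j])
      then show ?thesis by (simp add: p_all_def)
    next
      case False
      then have "v \<in> set (items w start p_high)" using v High by (auto simp: items_eq intro!: bexI[of _ l])
      then show ?thesis by (simp add: p_all_def)
    qed
  next
    case (Lit l i)
    show ?thesis
    proof (cases "i = nc")
      case True
      obtain j where "j < nv" "l = 2 * j \<or> l = 2 * j + 1" using pair[of l] v Lit by auto
      then have "v \<in> set (items w start p_pair)"
        unfolding Lit True by (auto simp: items_eq intro!: bexI[of _ j])
      then show ?thesis by (simp add: p_all_def)
    next
      case False
      then have "v \<in> set (items w start p_lit)" using v Lit by (auto simp: items_lit intro!: bexI[of _ i])
      then show ?thesis by (simp add: p_all_def)
    qed
  next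
    case (Hole l)
    then have "v \<in> set (items w start p_hole)" using v by (auto simp: items_eq)
    then show ?thesis by (simp add: p_all_def)
  next
    case (Guard q l)
    then have "v \<in> set (items w start p_clause)" using v by (auto simp: items_eq intro!: bexI[of _ q])
    then show ?thesis by (simp add: p_all_def)
  next
    case (Slot q l)
    then have "v \<in> set (items w start p_clause)" using v by (auto simp: items_eq intro!: bexI[of _ q])
    then show ?thesis by (simp add: p_all_def)
  next
    case (Rest q l)
    then have "v \<in> set (items w start p_clause)" using v by (auto simp: items_eq intro!: bexI[of _ q])
    then show ?thesis by (simp add: p_all_def)
  qed (use v in \<open>auto simp: p_all_def items_eq\<close>)
qed

lemma distinct_items: "distinct (items w start p_all)"
proof -
  have "distinct (items w start p_pin)" unfolding items_eq
    by (rule distinct_concat_map[where key = "\<lambda>v. case v of Pin l i s \<Rightarrow> l"])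
      (auto simp: distinct_map inj_on_def)
  moreover have "distinct (items w start p_pad)" unfolding items_eq
    by (rule distinct_concat_map[where key = "\<lambda>v. case v of Pad c j \<Rightarrow> j"])
      (auto simp: distinct_map inj_on_def)
  moreover have "distinct (items w start p_low)" unfolding items_eq
    by (rule distinct_concat_map[where key = "\<lambda>v. case v of Low l i \<Rightarrow> l"])
      (auto simp: distinct_map inj_on_def)
  moreover have "distinct (items w start p_high)" unfolding items_eq
    by (rule distinct_concat_map[where key = "\<lambda>v. case v of High l i \<Rightarrow> l"])
      (auto simp: distinct_map inj_on_def)
  moreover have "distinct (items w start p_hole)" unfolding items_eq
    by (auto simp: distinct_map inj_on_def)
  moreover have "distinct (items w start p_pair)" unfolding items_eq
    by (rule distinct_concat_map[where key = "\<lambda>v. case v of Low l i \<Rightarrow> l div 2 | High l i \<Rightarrow> l div 2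
        | Lit l i \<Rightarrow> l div 2 | PairE j \<Rightarrow> j | PairC2 j \<Rightarrow> j | PairF2 j \<Rightarrow> j | PairC1 j \<Rightarrow> j
        | PairD j \<Rightarrow> j | PairF1 j \<Rightarrow> j"]) auto
  moreover have "distinct (items w start p_clause)" unfolding items_eq
    by (rule distinct_concat_map[where key = "\<lambda>v. case v of Guard q l \<Rightarrow> q | Slot q m \<Rightarrow> q | Rest q j \<Rightarrow> q"])
      (auto simp: distinct_map inj_on_def)
  moreover have "distinct (items w start p_lit)" unfolding items_lit
    by (rule distinct_concat_map[where key = "\<lambda>v. case v of Lit l q \<Rightarrow> q"])
      (auto simp: distinct_map inj_on_def)
  ultimately show ?thesis
    unfolding p_all_def by (auto simp: items_eq items_lit)
qed

theorem instance_iff_models: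
  "den w start instance_gen \<in> containment_coloring_problem \<longleftrightarrow> (\<exists>A. models w S A cs)"
proof -
  let ?xs = "map span (items w start p_all)"
  have den: "den w start instance_gen = enc_instance ?xs ncol"
    unfolding instance_gen_def enc_instance_def
    by (simp add: den_printer[OF agrees_all] span_def comp_def)
  have fin: "finite {v. valid v}" using set_items by (metis List.finite_set)
  have "distinct ?xs"
    using distinct_items span_inj[OF nv_pos] by (simp add: distinct_map set_items)
  moreover have "\<forall>(l, r)\<in>set ?xs. l \<le> r"
    using lft_le_rgt by (auto simp: set_items span_def)
  moreover have "0 < ncol" using nv_pos by (simp add: ncol_def lits_def bsize_def)
  moreover have "chromatic_number (containment_graph (interval_of ` set ?xs)) \<le> ncol \<longleftrightarrow> sat"
    using chromatic_number_iff_sat[OF fin nv_pos] by (simp add: set_items)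
  ultimately have "enc_instance ?xs ncol \<in> containment_coloring_problem \<longleftrightarrow> sat"
    unfolding containment_coloring_problem_def mem_Collect_eq by (metis enc_instance_inj)
  then show ?thesis using den sat_iff_models by simp
qed

end

theorem (in uniform) models_reducible:
  "poly_time_reducible {w. \<exists>A. models w (eval w ((\<lambda>_. 0)(1 := length w)) a) A cs} containment_coloring_problem"
  unfolding poly_time_reducible_def
proof (intro exI conjI allI)
  show "poly_time_computable (\<lambda>w. den w ((\<lambda>_. 0)(1 := length w)) instance_gen)"
    by (rule generator_poly_time[OF scoped_instance_gen])
  fix w
  interpret uniform_word cs a kn NK w by unfold_locales
  show "w \<in> {w. \<exists>A. models w (eval w ((\<lambda>_. 0)(1 := length w)) a) A cs} \<longleftrightarrow>
      den w ((\<lambda>_. 0)(1 := length w)) instance_gen \<in> containment_coloring_problem"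
    using instance_iff_models unfolding S_def start_def by simp
qed

theorem theorem5: "NP_hard containment_coloring_problem"
  unfolding NP_hard_def
proof
  fix L assume "L \<in> NP"
  then obtain M and p :: "nat poly" where M: "wf_machine M" "runs_in_time M (poly p)" "L = {w. accepts M w}"
    unfolding NP_def by blast
  interpret tableau M p using M by unfold_locales
  have "finite (kinds clauses)" unfolding kinds_def by simp
  then obtain kn :: "kind \<Rightarrow> nat" and n where kn: "kn ` kinds clauses = {i. i < n}" "inj_on kn (kinds clauses)"
    using finite_imp_inj_to_nat_seg by metis
  \<comment> \<open>\<open>Suc n\<close> makes the number of kinds positive, so that there is at
    least one variable and one color.\<close>
  interpret uniform clauses Size kn "Suc n"
  proof
    show "vars Size \<subseteq> {1}" by (rule vars_Size)
    show "0 < eval w s Size" for w s by (simp add: Size_def)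
    show "clause_wf Size c" if "c \<in> set clauses" for c using clauses_wf[OF that] .
    show "inj_on kn (kinds clauses)" by (rule kn(2))
    show "kn k < Suc n" if "k \<in> kinds clauses" for k using kn(1) that by (auto simp: less_Suc_eq)
  qed simp
  have "eval w ((\<lambda>_. 0)(1 := length w)) Size = size w" for w
    by (simp add: Size_def size_def tm_def)
  then have "L = {w. \<exists>A. models w (eval w ((\<lambda>_. 0)(1 := length w)) Size) A clauses}"
    unfolding M(3) accepts_iff_models by simp
  then show "poly_time_reducible L containment_coloring_problem" using models_reducible by simp
qed

end
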